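(* There is a finite constant $C^*$ such that for every $m \in \mathbb{Z} \setminus \{ 0 \}$, we have $$\lim_{V \to 0} \frac{|U_m(V)|}{|V|} = \frac{C_m}{|m|}$$ for a suitable $C_m \in (0, C^* )$.
   Context: Let $\alpha = \frac{\sqrt{5}-1}{2}$. For $x\in\mathbb{R}$, $\{x\} = x - \lfloor x\rfloor$ denotes the fractional part of $x$. For $V>0$ and $\omega \in \mathbb{T} = \mathbb{R}/\mathbb{Z}$, the Fibonacci Hamiltonian is the bounded self-adjoint operator on $\ell^2(\mathbb{Z})$ given by $$[H_{V,\omega} \psi](n) = \psi(n+1) + \psi(n-1) + V \chi_{[1-\alpha,1)}(n\alpha + \omega \bmod 1)\, \psi(n).$$ Its spectrum does not depend on $\omega$; $\Sigma_V$ denotes the common spectrum, $\Sigma_V = \sigma(H_{V,\omega})$ for every $\omega \in \mathbb{T}$; it is a Cantor set. Integrated density of states: for a finite interval $\Lambda\subset\mathbb{Z}$ let $H_{V,\omega}^\Lambda$ be the restriction of $H_{V,\omega}$ to $\Lambda$ with Dirichlet boundary conditions, and let $N(E,\omega,V,\Lambda)$ be the number of eigenvalues of $H_{V,\omega}^\Lambda$ that are less than or equal to $E$. Then $N(E,V) = \lim_{n\to\infty} \frac1n N(E,\omega,V,[1,n])$; it is known that the limit exists for every $\omega$ and does not depend on $\omega$, and $N(\cdot,V)$ is constant on each gap. A gap of $\Sigma_V$ is a bounded connected component of $\mathbb{R}\setminus\Sigma_V$. For $m\in\mathbb{Z}\setminus\{0\}$, $U_m(V)$ denotes the gap of $\Sigma_V$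 on which $N(\cdot,V)$ takes the value $\{m\alpha\}$; for all sufficiently small $V>0$ (uniformly in $m$) this gap exists, because for such $V$ one has $\{N(E,V) : E\in\mathbb{R}\setminus\Sigma_V\} = \{\{m\alpha\}: m\in\mathbb{Z}\}\cup\{1\}$. $|U_m(V)|$ denotes its length. The limit $V\to0$ is taken over $V>0$. *)

theory Defs
  imports "HOL-Analysis.Analysis" "Jordan_Normal_Form.Char_Poly"
begin

definition ell2 :: "(int \<Rightarrow> complex) set" where
  "ell2 = {\<psi>. (\<lambda>n. (cmod (\<psi> n))\<^sup>2) summable_on UNIV}"

definition ell2_norm :: "(int \<Rightarrow> complex) \<Rightarrow> real" where
  "ell2_norm \<psi> = sqrt (\<Sum>\<^sub>\<infinity>n. (cmod (\<psi> n))\<^sup>2)"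

text \<open>Operators on \<open>ell2\<close> are functions on all of \<open>int \<Rightarrow> complex\<close>, of which only the
  action on \<open>ell2\<close> matters. The inverse \<open>R\<close> of a linear operator is automatically linear.\<close>

definition ell2_resolvent_set ::
    "((int \<Rightarrow> complex) \<Rightarrow> (int \<Rightarrow> complex)) \<Rightarrow> complex set" where
  "ell2_resolvent_set T = {z. \<exists>R.
     (\<forall>\<psi>\<in>ell2. R \<psi> \<in> ell2) \<and>
     (\<exists>K. \<forall>\<psi>\<in>ell2. ell2_norm (R \<psi>) \<le> K * ell2_norm \<psi>) \<and>
     (\<forall>\<psi>\<in>ell2. R (\<lambda>n. T \<psi> n - z * \<psi> n) = \<psi>) \<and>
     (\<forall>\<psi>\<in>ell2. (\<lambda>n. T (R \<psi>) n - z * R \<psi> n) = \<psi>)}"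

definition ell2_spectrum ::
    "((int \<Rightarrow> complex) \<Rightarrow> (int \<Rightarrow> complex)) \<Rightarrow> complex set" where
  "ell2_spectrum T = - ell2_resolvent_set T"

definition fib_alpha :: real where
  "fib_alpha = (sqrt 5 - 1) / 2"

text \<open>A phase in \<open>\<real>/\<int>\<close> is given by a real representative \<open>\<omega>\<close>; the potential depends on
  \<open>\<omega>\<close> modulo 1 only.\<close>

definition fib_potential :: "real \<Rightarrow> real \<Rightarrow> int \<Rightarrow> real" where
  "fib_potential V \<omega> n =
     V * indicator {1 - fib_alpha..<1} (frac (of_int n * fib_alpha + \<omega>))"

definition fib_hamiltonian :: "real \<Rightarrow> real \<Rightarrow> (int \<Rightarrow> complex) \<Rightarrow> (int \<Rightarrow> complex)" where
  "fib_hamiltonian V \<omega> \<psi> =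
     (\<lambda>n. \<psi> (n + 1) + \<psi> (n - 1) + complex_of_real (fib_potential V \<omega> n) * \<psi> n)"

text \<open>The common spectrum of all \<open>fib_hamiltonian V \<omega>\<close>, as a set of real numbers.\<close>

definition fib_spectrum :: "real \<Rightarrow> real set" where
  "fib_spectrum V =
     (THE S. \<forall>\<omega>. ell2_spectrum (fib_hamiltonian V \<omega>) = complex_of_real ` S)"

text \<open>Restriction to the interval \<open>{a..b}\<close> with Dirichlet boundary conditions: the matrix of
  the compression to sequences supported in \<open>{a..b}\<close>, in the basis of unit sequences.\<close>

definition fib_box :: "real \<Rightarrow> real \<Rightarrow> int \<Rightarrow> int \<Rightarrow> complex Matrix.mat" where
  "fib_box V \<omega> a b = Matrix.mat (nat (b - a + 1)) (nat (b - a + 1))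
     (\<lambda>(i, j). fib_hamiltonian V \<omega> (\<lambda>k. if k = a + int j then 1 else 0) (a + int i))"

text \<open>Eigenvalues are counted with multiplicity. The matrices are Hermitian, so that all
  eigenvalues are real.\<close>

definition fib_count :: "real \<Rightarrow> real \<Rightarrow> real \<Rightarrow> int \<Rightarrow> int \<Rightarrow> nat" where
  "fib_count E \<omega> V a b =
     (\<Sum>x \<in> {x::real. x \<le> E \<and> eigenvalue (fib_box V \<omega> a b) (complex_of_real x)}.
        Polynomial.order (complex_of_real x) (char_poly (fib_box V \<omega> a b)))"

definition fib_ids :: "real \<Rightarrow> real \<Rightarrow> real" where
  "fib_ids E V =
     (THE L. \<forall>\<omega>. (\<lambda>n. real (fib_count E \<omega> V 1 (int n)) / real n) \<longlonglongrightarrow> L)"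

definition fib_gaps :: "real \<Rightarrow> real set set" where
  "fib_gaps V = {U \<in> components (- fib_spectrum V). bounded U}"

definition fib_gap :: "int \<Rightarrow> real \<Rightarrow> real set" where
  "fib_gap m V =
     (THE U. U \<in> fib_gaps V \<and> (\<forall>E\<in>U. fib_ids E V = frac (of_int m * fib_alpha)))"

end

(*
For V = 0 the integrated density of states takes the value {m alpha} at E0 = 2 cos th with
th = pi (1 - {m alpha}). At E = E0 + lam V write a solution as u(n) = Im(z(n) exp(i th n)). Then z
varies slowly, and since exp(-2 i th n) = exp(2 pi i m n alpha), averaging over long blocks along the
rotation turns the equation for its phase phi into
phi' = - (lam - alpha) - Re(c exp(-2 i phi)), where c is the m-th Fourier coefficient of the indicator
function of [1 - alpha, 1). If |lam - alpha| < |c| the phase is trapped, so that the integrated density of states is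
exactly {m alpha}; if |lam - alpha| > |c| the phase drifts and the integrated density of states is different
from {m alpha}. It is constant on gaps and strictly increasing at points of the spectrum, hence the
gap is asymptotically the interval |lam - alpha| < |c|, of length 2 |c| V, and
|c| = |1 - exp(2 pi i m alpha)| / (2 pi |m|). All averages reduce to the telescoping sums of
floor(x + alpha) - floor(x) along the rotation.
*)
theory Submission imports Defs begin

section \<open>Means along the golden rotation\<close>

text \<open>The order of limits shapes the proof. First \<open>lam\<close> is fixed off the two
  critical values \<open>\<bar>lam - fib_alpha\<bar> = norm (fib_mode m)\<close>, then the block
  length \<open>B\<close> is chosen from the means alone, and only then \<open>V\<close> tends to 0.
  The averaged equation is thus a discrete scheme with time step
  \<open>V * B / (2 * sin th)\<close>, and the gap edges are only approached from both sides. The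
  phase is tied to the integrated density of states by Sturm oscillation: the number of eigenvalues
  of a box above the energy is the angle of the solution divided by pi, up to a bounded error. The
  gap is found indirectly. Two energies with equal integrated density of states have no spectrum
  between them: near the spectrum there is an approximate eigenvector of finite support, which
  recurs along the orbit with positive frequency and forces eigenvalues in every long box. The
  bridge between boxes and operator is \<open>energy_gap\<close>, a lower bound on finitely
  supported real sequences. Through it the definite descriptions for spectrum and gap are seen to
  denote something; for the integrated density of states this is almost additivity of the
  counts.\<close>

lemma fib_alpha_bounds: "0 < fib_alpha" "fib_alpha < 1"
proof -
  have "sqrt 5 < 3" by (rule real_less_lsqrt) auto
  moreover have "1 < sqrt 5" by simp
  ultimately show "0 < fib_alpha" "fib_alpha < 1" by (auto simp: fib_alpha_def)
qed

lemma fib_alpha_irrational: "fib_alpha \<notin> \<rat>"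
proof
  assume "fib_alpha \<in> \<rat>"
  then have "2 * fib_alpha + 1 \<in> \<rat>" by simp
  moreover have "2 * fib_alpha + 1 = sqrt 5" by (simp add: fib_alpha_def field_simps)
  ultimately have "sqrt 5 \<in> \<rat>" by metis
  then obtain m n :: nat where mn: "n \<noteq> 0" "\<bar>sqrt 5\<bar> = real m / real n" "coprime m n"
    by (rule Rats_abs_nat_div_natE)
  then have "real m = sqrt 5 * real n" by (simp add: field_simps)
  then have "(real m)\<^sup>2 = 5 * (real n)\<^sup>2" by (simp add: power_mult_distrib)
  then have "real (m\<^sup>2) = real (5 * n\<^sup>2)" by simp
  then have eq: "m\<^sup>2 = 5 * n\<^sup>2" using of_nat_eq_iff by blast
  have p5: "prime (5::nat)" by simp
  from eq have "5 dvd m\<^sup>2" by simp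
  then have m: "5 dvd m" using p5 prime_dvd_power by blast
  then obtain k where "m = 5 * k" by blast
  with eq have "n\<^sup>2 = 5 * k\<^sup>2" by (simp add: power2_eq_square)
  then have "5 dvd n\<^sup>2" by simp
  then have "5 dvd n" using p5 prime_dvd_power by blast
  with m mn(3) have "(5::nat) dvd 1" by (metis coprime_common_divisor_nat dvd_refl nat_dvd_1_iff_1)
  then show False by simp
qed

definition rot_avg :: "(real \<Rightarrow> 'a::real_normed_vector) \<Rightarrow> nat \<Rightarrow> real \<Rightarrow> 'a" where
  "rot_avg h K w = (\<Sum>k<K. h (w + real k * fib_alpha)) /\<^sub>R real K"

text \<open>Uniformity in the starting point \<open>w\<close> makes the means available on every
  block of a single orbit, wherever the block begins.\<close>

definition has_mean :: "(real \<Rightarrow> 'a::real_normed_vector) \<Rightarrow> 'a \<Rightarrow> bool" where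
  "has_mean h M \<longleftrightarrow> uniform_limit UNIV (rot_avg h) (\<lambda>_. M) sequentially"

lemma has_mean_iff:
  "has_mean h M \<longleftrightarrow> (\<forall>e>0. \<exists>K0. \<forall>K\<ge>K0. \<forall>w. norm (rot_avg h K w - M) < e)"
  unfolding has_mean_def uniform_limit_sequentially_iff dist_norm by auto

lemma has_meanD:
  assumes "has_mean h M" "e > 0"
  obtains K0 where "K0 > 0" "\<And>K w. K \<ge> K0 \<Longrightarrow> norm (rot_avg h K w - M) < e"
proof -
  obtain K0 where K0: "\<forall>K\<ge>K0. \<forall>w. norm (rot_avg h K w - M) < e"
    using assms has_mean_iff by blast
  show ?thesis by (rule that[of "Suc K0"]) (use K0 in auto)
qed

lemma has_mean_const: "has_mean (\<lambda>_. c) c"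
proof -
  have "rot_avg (\<lambda>_. c) K w = c" if "K \<ge> 1" for K w
    using that by (simp add: rot_avg_def sum_constant_scaleR)
  then show ?thesis by (auto simp: has_mean_iff intro!: exI[of _ 1])
qed

lemma has_mean_add:
  assumes "has_mean g M" "has_mean h N" shows "has_mean (\<lambda>x. g x + h x) (M + N)"
proof -
  have "rot_avg (\<lambda>x. g x + h x) = (\<lambda>K w. rot_avg g K w + rot_avg h K w)"
    by (simp add: rot_avg_def sum.distrib scaleR_right_distrib fun_eq_iff)
  then show ?thesis using uniform_limit_add assms by (fastforce simp: has_mean_def)
qed

lemma has_mean_linear:
  assumes "has_mean h M" "bounded_linear f" shows "has_mean (\<lambda>x. f (h x)) (f M)"
proof -
  interpret bounded_linear f by fact
  have "rot_avg (\<lambda>x. f (h x)) = (\<lambda>K w. f (rot_avg h K w))"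
    by (simp add: rot_avg_def sum scaleR fun_eq_iff)
  then show ?thesis using uniform_limit assms(1) by (fastforce simp: has_mean_def)
qed

lemma has_mean_diff:
  assumes "has_mean g M" "has_mean h N" shows "has_mean (\<lambda>x. g x - h x) (M - N)"
  using has_mean_add[OF assms(1) has_mean_linear[OF assms(2) bounded_linear_minus[OF bounded_linear_ident]]] by simp

lemma has_mean_shift:
  assumes "has_mean h M" shows "has_mean (\<lambda>x. h (x + t)) M"
proof -
  have "rot_avg (\<lambda>x. h (x + t)) K w = rot_avg h K (w + t)" for K w
    by (simp add: rot_avg_def algebra_simps)
  then show ?thesis using assms unfolding has_mean_iff by metis
qed

lemma rot_avg_bound:
  assumes "\<And>x. norm (h x) \<le> C" "K > 0" shows "norm (rot_avg h K w) \<le> C"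
proof -
  have "norm (\<Sum>k<K. h (w + real k * fib_alpha)) \<le> real K * C"
    using sum_norm_le[of "{..<K}" "\<lambda>k. h (w + real k * fib_alpha)" "\<lambda>_. C"] assms by simp
  then show ?thesis using assms(2) by (simp add: rot_avg_def field_simps)
qed

lemma rot_avg_diff: "rot_avg (\<lambda>x. g x - h x) K w = rot_avg g K w - rot_avg h K w"
  by (simp add: rot_avg_def sum_subtractf scaleR_right_diff_distrib)

lemma has_mean_bound:
  assumes "has_mean h M" "\<And>x. norm (h x) \<le> C" shows "norm M \<le> C"
proof (rule field_le_epsilon)
  fix e :: real assume "e > 0"
  then obtain K0 where K0: "K0 > 0" "\<And>K w. K \<ge> K0 \<Longrightarrow> norm (rot_avg h K w - M) < e"
    using has_meanD[OF assms(1)] by metis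
  have "norm (rot_avg h K0 0) \<le> C" using K0 rot_avg_bound assms(2) by blast
  moreover have "norm (rot_avg h K0 0 - M) < e" using K0 by blast
  ultimately show "norm M \<le> C + e"
    by (smt (verit) norm_minus_commute norm_triangle_sub)
qed

text \<open>A mean is bounded by the sup norm, so the means of uniform approximants form a Cauchy
  sequence; its limit is the mean of \<open>h\<close> by splitting the error into three
  parts.\<close>

lemma has_mean_close:
  fixes h :: "real \<Rightarrow> 'a::banach"
  assumes "\<And>e. e > 0 \<Longrightarrow> \<exists>g N. has_mean g N \<and> (\<forall>x. norm (h x - g x) \<le> e)"
  shows "\<exists>M. has_mean h M"
proof -
  have "\<forall>n. \<exists>p. has_mean (fst p) (snd p) \<and> (\<forall>x. norm (h x - fst p x) \<le> 1 / real (Suc n))"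
    using assms[of "1 / real (Suc n)" for n] by simp
  from choice[OF this] obtain p where p:
    "\<And>n. has_mean (fst (p n)) (snd (p n)) \<and> (\<forall>x. norm (h x - fst (p n) x) \<le> 1 / real (Suc n))" by blast
  define g N where "g n = fst (p n)" and "N n = snd (p n)" for n
  have gN: "has_mean (g n) (N n)" "norm (h x - g n x) \<le> 1 / real (Suc n)" for n x
    using p[of n] by (simp_all add: g_def N_def)
  have d: "norm (N n - N m) \<le> 1 / real (Suc n) + 1 / real (Suc m)" for n m
  proof (rule has_mean_bound)
    show "has_mean (\<lambda>x. g n x - g m x) (N n - N m)" by (intro has_mean_diff gN)
    show "norm (g n x - g m x) \<le> 1 / real (Suc n) + 1 / real (Suc m)" for x
      using gN(2)[of x n] gN(2)[of x m] norm_triangle_ineq4[of "h x - g m x" "h x - g n x"]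
      by (simp add: algebra_simps)
  qed
  have "Cauchy N"
  proof (rule CauchyI)
    fix e :: real assume e: "e > 0"
    then obtain n0 where n0: "1 / real (Suc n0) < e / 2"
      using nat_approx_posE[of "e/2"] by auto
    have "norm (N m - N n) < e" if "m \<ge> n0" "n \<ge> n0" for m n
    proof -
      have "1 / real (Suc m) \<le> 1 / real (Suc n0)" "1 / real (Suc n) \<le> 1 / real (Suc n0)"
        using that by (simp_all add: frac_le)
      then show ?thesis using d[of m n] n0 by linarith
    qed
    then show "\<exists>M. \<forall>m\<ge>M. \<forall>n\<ge>M. norm (N m - N n) < e" by blast
  qed
  then obtain M where M: "N \<longlonglongrightarrow> M" using convergent_eq_Cauchy by blast
  have "has_mean h M"
    unfolding has_mean_iff
  proof (intro allI impI)
    fix e :: real assume e: "e > 0"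
    obtain n1 where n1: "\<And>n. n \<ge> n1 \<Longrightarrow> norm (N n - M) < e / 3"
      using LIMSEQ_D[OF M, of "e/3"] e by auto
    obtain n2 where n2: "1 / real (Suc n2) < e / 3"
      using nat_approx_posE[of "e/3"] e by auto
    define n where "n = max n1 n2"
    have "1 / real (Suc n) \<le> 1 / real (Suc n2)" by (simp add: n_def frac_le)
    with n2 have n: "1 / real (Suc n) < e / 3" by simp
    obtain K0 where K0: "K0 > 0" "\<And>K w. K \<ge> K0 \<Longrightarrow> norm (rot_avg (g n) K w - N n) < e / 3"
      using has_meanD[OF gN(1)[of n], of "e/3"] e by auto
    have "norm (rot_avg h K w - M) < e" if "K \<ge> K0" for K w
    proof -
      have "norm (rot_avg h K w - rot_avg (g n) K w) \<le> 1 / real (Suc n)"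
        using rot_avg_bound[of "\<lambda>x. h x - g n x" "1 / real (Suc n)" K w] gN(2) that K0(1)
        by (simp add: rot_avg_diff)
      moreover have "norm (rot_avg (g n) K w - N n) < e / 3" using K0 that by blast
      moreover have "norm (N n - M) < e / 3" using n1 by (simp add: n_def)
      moreover have "norm (rot_avg h K w - M) \<le> norm (rot_avg h K w - rot_avg (g n) K w)
          + norm (rot_avg (g n) K w - N n) + norm (N n - M)"
        using norm_triangle_ineq[of "(rot_avg h K w - rot_avg (g n) K w) + (rot_avg (g n) K w - N n)" "N n - M"]
          norm_triangle_ineq[of "rot_avg h K w - rot_avg (g n) K w" "rot_avg (g n) K w - N n"] by simp
      ultimately show ?thesis using n by linarith
    qed
    then show "\<exists>K0. \<forall>K\<ge>K0. \<forall>w. norm (rot_avg h K w - M) < e" by blast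
  qed
  then show ?thesis by blast
qed

text \<open>Indicators of different arcs are never uniformly close, so they have to be compared from
  above and from below.\<close>

lemma has_mean_squeeze:
  fixes h :: "real \<Rightarrow> real"
  assumes "\<And>e. e > 0 \<Longrightarrow> \<exists>g N. has_mean g N \<and> N < M + e \<and> (\<forall>x. h x \<le> g x)"
    and "\<And>e. e > 0 \<Longrightarrow> \<exists>g N. has_mean g N \<and> M - e < N \<and> (\<forall>x. g x \<le> h x)"
  shows "has_mean h M"
  unfolding has_mean_iff
proof (intro allI impI)
  fix e :: real assume e: "e > 0"
  obtain g N where g: "has_mean g N" "N < M + e/2" "\<And>x. h x \<le> g x" using assms(1)[of "e/2"] e by auto
  obtain g' N' where g': "has_mean g' N'" "M - e/2 < N'" "\<And>x. g' x \<le> h x" using assms(2)[of "e/2"] e by auto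
  have e2: "e/2 > 0" using e by simp
  obtain K0 where K0: "K0 > 0" "\<And>K w. K \<ge> K0 \<Longrightarrow> norm (rot_avg g K w - N) < e/2"
    by (rule has_meanD[OF g(1) e2]) blast
  obtain K1 where K1: "K1 > 0" "\<And>K w. K \<ge> K1 \<Longrightarrow> norm (rot_avg g' K w - N') < e/2"
    by (rule has_meanD[OF g'(1) e2]) blast
  have "norm (rot_avg h K w - M) < e" if "K \<ge> max K0 K1" for K w
  proof -
    have "rot_avg h K w \<le> rot_avg g K w" "rot_avg g' K w \<le> rot_avg h K w"
      unfolding rot_avg_def by (auto intro!: mult_left_mono sum_mono g(3) g'(3))
    moreover have "norm (rot_avg g K w - N) < e/2" "norm (rot_avg g' K w - N') < e/2"
      using K0(2) K1(2) that by auto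
    ultimately show ?thesis using g(2) g'(2) unfolding real_norm_def abs_less_iff by linarith
  qed
  then show "\<exists>K0. \<forall>K\<ge>K0. \<forall>w. norm (rot_avg h K w - M) < e" by blast
qed

text \<open>Both sides are what remains when the orbit segments \<open>0..<K\<close> and
  \<open>j..<K + j\<close> cancel on their overlap. The exchange turns \<open>K\<close> terms into
  \<open>j\<close>, a number that stays fixed while \<open>K\<close> grows.\<close>

lemma floor_rotation_telescope:
  fixes w a :: real
  shows "(\<Sum>k<K. real_of_int (\<lfloor>w + real k * a + real j * a\<rfloor> - \<lfloor>w + real k * a\<rfloor>))
     = (\<Sum>i<j. real_of_int (\<lfloor>w + real (K + i) * a\<rfloor> - \<lfloor>w + real i * a\<rfloor>))"
proof (induction K)
  case 0 then show ?case by simp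
next
  case (Suc K)
  have "(\<Sum>i<j. real_of_int (\<lfloor>w + real (Suc K + i) * a\<rfloor> - \<lfloor>w + real i * a\<rfloor>))
      - (\<Sum>i<j. real_of_int (\<lfloor>w + real (K + i) * a\<rfloor> - \<lfloor>w + real i * a\<rfloor>))
     = (\<Sum>i<j. real_of_int (\<lfloor>w + real (K + Suc i) * a\<rfloor>) - real_of_int \<lfloor>w + real (K + i) * a\<rfloor>)"
    by (simp add: sum_subtractf)
  also have "\<dots> = real_of_int (\<lfloor>w + real (K + j) * a\<rfloor>) - real_of_int \<lfloor>w + real K * a\<rfloor>"
    by (subst sum_lessThan_telescope) simp
  finally show ?case using Suc by (simp add: algebra_simps)
qed

text \<open>The summand is a coboundary up to a constant, so its rotation sums stay within a bounded distance of
  their mean; this replaces Weyl equidistribution for arcs with end points in \<open>\<int> fib_alpha + \<int>\<close>.\<close>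

lemma has_mean_floor_diff: "has_mean (\<lambda>x. real_of_int (\<lfloor>x + real j * fib_alpha\<rfloor> - \<lfloor>x\<rfloor>)) (real j * fib_alpha)"
  (is "has_mean ?h _")
  unfolding has_mean_iff
proof (intro allI impI)
  fix e :: real assume e: "e > 0"
  obtain K0 :: nat where K0: "real j / e < real K0" using reals_Archimedean2 by blast
  have "norm (rot_avg ?h K w - real j * fib_alpha) < e" if K: "K \<ge> Suc K0" for K w
  proof -
    define F where "F i = real_of_int (\<lfloor>w + real (K + i) * fib_alpha\<rfloor> - \<lfloor>w + real i * fib_alpha\<rfloor>)" for i
    have "\<bar>F i - real K * fib_alpha\<bar> \<le> 1" for i
    proof -
      have "w + real (K + i) * fib_alpha = (w + real i * fib_alpha) + real K * fib_alpha"
        by (simp add: algebra_simps)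
      then show ?thesis
        using of_int_floor_le[of "w + real i * fib_alpha"] real_of_int_floor_add_one_gt[of "w + real i * fib_alpha"]
          of_int_floor_le[of "w + real (K + i) * fib_alpha"] real_of_int_floor_add_one_gt[of "w + real (K + i) * fib_alpha"]
        unfolding F_def of_int_diff abs_le_iff by linarith
    qed
    then have "\<bar>\<Sum>i<j. F i - real K * fib_alpha\<bar> \<le> (\<Sum>i<j. 1)"
      by (rule order_trans[OF sum_abs sum_mono])
    then have bd: "\<bar>(\<Sum>i<j. F i) - real j * (real K * fib_alpha)\<bar> \<le> real j"
      by (simp add: sum_subtractf)
    have "rot_avg ?h K w = (\<Sum>i<j. F i) / real K"
      unfolding rot_avg_def F_def floor_rotation_telescope by (simp add: divide_inverse mult.commute)
    then have "rot_avg ?h K w - real j * fib_alpha = ((\<Sum>i<j. F i) - real j * (real K * fib_alpha)) / real K"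
      using K by (simp add: field_simps)
    then have "norm (rot_avg ?h K w - real j * fib_alpha) \<le> real j / real K"
      using bd K by (simp add: divide_right_mono)
    also have "real j / real K < e"
    proof -
      have "real j < e * real K0" using K0 e by (simp add: field_simps)
      also have "\<dots> \<le> e * real K" using K e by simp
      finally show ?thesis using K by (simp add: field_simps)
    qed
    finally show ?thesis .
  qed
  then show "\<exists>K0. \<forall>K\<ge>K0. \<forall>w. norm (rot_avg ?h K w - real j * fib_alpha) < e"
    by blast
qed

text \<open>Adding \<open>t\<close> produces a carry exactly when \<open>frac x\<close> lies in the
  top arc of length \<open>frac t\<close>; the carry is the excess of the floor difference over
  \<open>\<lfloor>t\<rfloor>\<close>.\<close>

lemma indicator_top_arc: "indicator {1 - frac t..<1} (frac x) = real_of_int (\<lfloor>x + t\<rfloor> - \<lfloor>x\<rfloor>) - real_of_int \<lfloor>t\<rfloor>"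
proof (cases "frac x + frac t < 1")
  case True
  then show ?thesis unfolding floor_add if_P[OF True] by (simp add: indicator_def)
next
  case False
  then show ?thesis unfolding floor_add if_not_P[OF False] using frac_lt_1[of x] by (simp add: indicator_def)
qed

text \<open>For lengths \<open>frac (real j * fib_alpha)\<close> the indicator is a floor difference
  minus a constant. These lengths are dense by Kronecker's theorem, which squeezes the others. At
  \<open>s = 0\<close> there is no longer arc and at \<open>s = 1\<close> no shorter one, so
  constants take their place.\<close>

lemma has_mean_top_arc:
  assumes "0 \<le> s" "s \<le> 1" shows "has_mean (\<lambda>x. indicator {s..<1} (frac x)) (1 - s)"
proof -
  have *: "has_mean (\<lambda>x. indicator {1 - frac (real j * fib_alpha)..<1} (frac x)) (frac (real j * fib_alpha))" for j
    unfolding indicator_top_arc using has_mean_diff[OF has_mean_floor_diff has_mean_const]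
    by (simp add: frac_def)
  have dense: "\<exists>j. a < frac (real j * fib_alpha) \<and> frac (real j * fib_alpha) < b" if "0 \<le> a" "a < b" "b \<le> 1" for a b
  proof -
    have "0 \<le> (a+b)/2" "(a+b)/2 \<le> 1" "0 < (b-a)/2" using that by auto
    then obtain k where "k > 0" "\<bar>frac (real k * fib_alpha) - (a + b) / 2\<bar> < (b - a) / 2"
      by (rule Kronecker_approx_1_explicit[OF fib_alpha_irrational])
    then show ?thesis by (intro exI[of _ k]) (auto simp: abs_if field_simps split: if_splits)
  qed
  show ?thesis
  proof (rule has_mean_squeeze)
    fix e :: real assume e: "e > 0"
    show "\<exists>g N. has_mean g N \<and> N < 1 - s + e \<and> (\<forall>x. indicator {s..<1} (frac x) \<le> (g x::real))"
    proof (cases "s = 0")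
      case True
      show ?thesis
        by (rule exI[of _ "\<lambda>_. 1"], rule exI[of _ 1]) (use True e has_mean_const in \<open>auto simp: indicator_def\<close>)
    next
      case False
      obtain j where "1 - s < frac (real j * fib_alpha)" "frac (real j * fib_alpha) < min 1 (1 - s + e)"
        using dense[of "1 - s" "min 1 (1 - s + e)"] assms False e by auto
      then show ?thesis
        by (intro exI[of _ "\<lambda>x. indicator {1 - frac (real j * fib_alpha)..<1} (frac x)"]
            exI[of _ "frac (real j * fib_alpha)"] conjI * allI) (auto simp: indicator_def)
    qed
    show "\<exists>g N. has_mean g N \<and> 1 - s - e < N \<and> (\<forall>x. (g x::real) \<le> indicator {s..<1} (frac x))"
    proof (cases "s = 1")
      case True
      show ?thesis
        by (rule exI[of _ "\<lambda>_. 0"], rule exI[of _ 0]) (use True e has_mean_const in \<open>auto simp: indicator_def\<close>)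
    next
      case False
      obtain j where "max 0 (1 - s - e) < frac (real j * fib_alpha)" "frac (real j * fib_alpha) < 1 - s"
        using dense[of "max 0 (1 - s - e)" "1 - s"] assms False e by auto
      then show ?thesis
        by (intro exI[of _ "\<lambda>x. indicator {1 - frac (real j * fib_alpha)..<1} (frac x)"]
            exI[of _ "frac (real j * fib_alpha)"] conjI * allI) (auto simp: indicator_def)
    qed
  qed
qed

lemma has_mean_arc:
  assumes "0 \<le> a" "a \<le> b" "b \<le> 1" shows "has_mean (\<lambda>x. indicator {a..<b} (frac x)) (b - a)"
proof -
  have "(\<lambda>x. indicator {a..<b} (frac x) :: real) = (\<lambda>x. indicator {a..<1} (frac x) - indicator {b..<1} (frac x))"
    using assms by (auto simp: fun_eq_iff indicator_def)
  then show ?thesis using has_mean_diff[OF has_mean_top_arc[of a] has_mean_top_arc[of b]] assms by simp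
qed

text \<open>Cutting \<open>[0,1)\<close> by bisection (lemma \<open>Bolzano\<close>) into arcs on which \<open>h\<close> is nearly constant.\<close>

lemma has_mean_regulated:
  fixes h :: "real \<Rightarrow> 'a::banach"
  assumes per: "\<And>x. h (frac x) = h x"
    and reg: "\<And>x e. e > 0 \<Longrightarrow> \<exists>d>0. \<exists>c. (\<forall>y. x - d < y \<and> y < x \<longrightarrow> norm (h y - c) \<le> e) \<and>
                              (\<forall>y. x \<le> y \<and> y < x + d \<longrightarrow> norm (h y - h x) \<le> e)"
  shows "\<exists>M. has_mean h M"
proof (rule has_mean_close)
  fix e :: real assume e: "e > 0"
  \<comment> \<open>Vanishing outside the arc is what makes the approximants of adjacent arcs add
    up.\<close>
  define P where "P a b \<longleftrightarrow> (0 \<le> a \<and> a \<le> b \<and> b \<le> 1 \<longrightarrow> (\<exists>g N. has_mean g N \<and>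
     (\<forall>x. if a \<le> frac x \<and> frac x < b then norm (h x - g x) \<le> e else g x = 0)))" for a b
  have "P 0 1"
  proof (rule Bolzano)
    show "(0::real) \<le> 1" by simp
  next
    fix a b c assume trans: "P a b" "P b c" "a \<le> b" "b \<le> c"
    show "P a c"
    proof (cases "0 \<le> a \<and> c \<le> 1")
      case True
      obtain g N where g: "has_mean g N" "\<And>x. if a \<le> frac x \<and> frac x < b then norm (h x - g x) \<le> e else g x = 0"
        using trans True unfolding P_def by auto
      obtain g' N' where g': "has_mean g' N'" "\<And>x. if b \<le> frac x \<and> frac x < c then norm (h x - g' x) \<le> e else g' x = 0"
        using trans True unfolding P_def by auto
      have "if a \<le> frac x \<and> frac x < c then norm (h x - (g x + g' x)) \<le> e else g x + g' x = 0" for x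
        using g(2)[of x] g'(2)[of x] trans(3,4) by (auto split: if_splits)
      then show ?thesis unfolding P_def using has_mean_add[OF g(1) g'(1)] by blast
    next
      case False then show ?thesis by (auto simp: P_def)
    qed
  next
    fix x :: real
    obtain d c where d: "d > 0" "\<And>y. x - d < y \<and> y < x \<Longrightarrow> norm (h y - c) \<le> e"
      "\<And>y. x \<le> y \<and> y < x + d \<Longrightarrow> norm (h y - h x) \<le> e"
      using reg[OF e, of x] by metis
    show "\<exists>d>0. \<forall>a b. a \<le> x \<and> x \<le> b \<and> b - a < d \<longrightarrow> P a b"
    proof (intro exI[of _ d] conjI allI impI d(1))
      fix a b assume ab: "a \<le> x \<and> x \<le> b \<and> b - a < d"
      show "P a b" unfolding P_def
      proof (intro impI)
        assume ab2: "0 \<le> a \<and> a \<le> b \<and> b \<le> 1"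
        \<comment> \<open>\<open>h\<close> may jump at \<open>x\<close>: the constant
          \<open>c\<close> replaces it to the left, the value \<open>h x\<close> from
          \<open>x\<close> on.\<close>
        define g where "g y = indicator {a..<x} (frac y) *\<^sub>R c + indicator {x..<b} (frac y) *\<^sub>R h x" for y
        have "has_mean g ((x - a) *\<^sub>R c + (b - x) *\<^sub>R h x)"
          unfolding g_def using ab ab2
          by (intro has_mean_add has_mean_linear[OF _ bounded_linear_scaleR_left] has_mean_arc) auto
        moreover have "if a \<le> frac y \<and> frac y < b then norm (h y - g y) \<le> e else g y = 0" for y
          using d(2)[of "frac y"] d(3)[of "frac y"] ab by (auto simp: g_def indicator_def per)
        ultimately show "\<exists>g N. has_mean g N \<and> (\<forall>x. if a \<le> frac x \<and> frac x < b then norm (h x - g x) \<le> e else g x = 0)"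
          by blast
      qed
    qed
  qed
  then obtain g N where "has_mean g N" "\<And>x. if 0 \<le> frac x \<and> frac x < 1 then norm (h x - g x) \<le> e else g x = 0"
    unfolding P_def by auto
  then show "\<exists>g N. has_mean g N \<and> (\<forall>x. norm (h x - g x) \<le> e)"
    using frac_lt_1 frac_ge_0 by metis
qed

lemma has_mean_norm_le:
  assumes "has_mean h M" "has_mean g N" "\<And>x. norm (h x) \<le> g x" shows "norm M \<le> N"
proof (rule field_le_epsilon)
  fix e :: real assume "e > 0"
  then have e2: "e / 2 > 0" by simp
  obtain K0 where K0: "K0 > 0" "\<And>K w. K \<ge> K0 \<Longrightarrow> norm (rot_avg h K w - M) < e / 2"
    by (rule has_meanD[OF assms(1) e2]) blast
  obtain K1 where K1: "K1 > 0" "\<And>K w. K \<ge> K1 \<Longrightarrow> norm (rot_avg g K w - N) < e / 2"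
    by (rule has_meanD[OF assms(2) e2]) blast
  define K where "K = max K0 K1"
  have "norm (rot_avg h K 0) \<le> rot_avg g K 0"
    unfolding rot_avg_def norm_scaleR real_scaleR_def
    by (rule mult_mono) (auto intro: assms(3) sum_norm_le)
  moreover have "norm (rot_avg h K 0 - M) < e / 2" "norm (rot_avg g K 0 - N) < e / 2"
    using K0(2) K1(2) by (simp_all add: K_def)
  ultimately show "norm M \<le> N + e"
    using norm_triangle_ineq2[of M "rot_avg h K 0"] unfolding norm_minus_commute[of M] real_norm_def by linarith
qed

lemma has_mean_unique: "has_mean h M \<Longrightarrow> has_mean h N \<Longrightarrow> M = N"
  using has_mean_norm_le[OF has_mean_diff has_mean_const[of 0], of h M h N] by simp

text \<open>Just to the left of \<open>x\<close> the floor of \<open>y + j\<close> is the largest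
  integer strictly below \<open>x + j\<close>, which is \<open>\<lceil>x + j\<rceil> - 1\<close>
  also when \<open>x + j\<close> is an integer. Finiteness of \<open>J\<close> gives a common
  \<open>d\<close>.\<close>

lemma floor_left_right:
  fixes x :: real
  assumes "finite J"
  shows "\<exists>d>0. (\<forall>j\<in>J. \<forall>y. x - d < y \<and> y < x \<longrightarrow> \<lfloor>y + j\<rfloor> = \<lceil>x + j\<rceil> - 1) \<and>
               (\<forall>j\<in>J. \<forall>y. x \<le> y \<and> y < x + d \<longrightarrow> \<lfloor>y + j\<rfloor> = \<lfloor>x + j\<rfloor>)"
  using assms
proof (induction J)
  case empty then show ?case by (auto intro: exI[of _ 1])
next
  case (insert j J)
  then obtain d where d: "d > 0" "\<forall>j\<in>J. \<forall>y. x - d < y \<and> y < x \<longrightarrow> \<lfloor>y + j\<rfloor> = \<lceil>x + j\<rceil> - 1"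
    "\<forall>j\<in>J. \<forall>y. x \<le> y \<and> y < x + d \<longrightarrow> \<lfloor>y + j\<rfloor> = \<lfloor>x + j\<rfloor>" by blast
  define l where "l = x + j - of_int (\<lceil>x + j\<rceil> - 1)"
  define r where "r = of_int (\<lfloor>x + j\<rfloor> + 1) - (x + j)"
  have lr: "l > 0" "r > 0" unfolding l_def r_def by linarith+
  define d' where "d' = min d (min l r)"
  have A: "\<lfloor>y + j\<rfloor> = \<lceil>x + j\<rceil> - 1" if "x - d' < y" "y < x" for y
  proof (rule floor_unique)
    show "of_int (\<lceil>x + j\<rceil> - 1) \<le> y + j" using that(1) unfolding d'_def l_def by linarith
    show "y + j < of_int (\<lceil>x + j\<rceil> - 1) + 1" using that(2) by (simp add: less_le_trans[OF _ le_of_int_ceiling])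
  qed
  have B: "\<lfloor>y + j\<rfloor> = \<lfloor>x + j\<rfloor>" if "x \<le> y" "y < x + d'" for y
  proof (rule floor_unique)
    show "of_int \<lfloor>x + j\<rfloor> \<le> y + j" using that(1) by linarith
    show "y + j < of_int \<lfloor>x + j\<rfloor> + 1" using that(2) unfolding d'_def r_def by linarith
  qed
  have d': "d' > 0" "d' \<le> d" using d(1) lr by (auto simp: d'_def)
  show ?case
  proof (intro exI[of _ d'] conjI ballI allI impI d'(1))
    fix i y assume "i \<in> insert j J" "x - d' < y \<and> y < x"
    then show "\<lfloor>y + i\<rfloor> = \<lceil>x + i\<rceil> - 1" using A[of y] d(2)[rule_format, of i y] d'(2) by fastforce
  next
    fix i y assume "i \<in> insert j J" "x \<le> y \<and> y < x + d'"
    then show "\<lfloor>y + i\<rfloor> = \<lfloor>x + i\<rfloor>" using B[of y] d(3)[rule_format, of i y] d'(2) by fastforce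
  qed
qed

text \<open>Near \<open>x\<close> only two branches occur, \<open>\<lceil>x\<rceil> - 1\<close> to
  the left and \<open>\<lfloor>x\<rfloor>\<close> to the right. This covers the characters and the
  twisted sawtooth below.\<close>

lemma has_mean_floor_piecewise:
  fixes h :: "real \<Rightarrow> 'a::banach"
  assumes per: "\<And>x. h (frac x) = h x" and cont: "\<And>k. continuous_on UNIV (F k)" and h: "\<And>y. h y = F \<lfloor>y\<rfloor> y"
  shows "\<exists>M. has_mean h M"
proof (rule has_mean_regulated)
  show "h (frac x) = h x" for x by (rule per)
next
  fix x e :: real assume e: "e > 0"
  obtain d where d: "d > 0" "\<And>y. x - d < y \<and> y < x \<Longrightarrow> \<lfloor>y\<rfloor> = \<lceil>x\<rceil> - 1" "\<And>y. x \<le> y \<and> y < x + d \<Longrightarrow> \<lfloor>y\<rfloor> = \<lfloor>x\<rfloor>"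
    using floor_left_right[of "{0}" x] by auto
  have "\<exists>d>0. \<forall>y. dist y x < d \<longrightarrow> norm (F k y - F k x) < e" for k
    using cont[of k] e unfolding continuous_on_iff by (simp add: dist_norm)
  from this[of "\<lceil>x\<rceil> - 1"] this[of "\<lfloor>x\<rfloor>"]
  obtain d1 d2 where d1: "d1 > 0" "\<And>y. dist y x < d1 \<Longrightarrow> norm (F (\<lceil>x\<rceil> - 1) y - F (\<lceil>x\<rceil> - 1) x) < e"
    and d2: "d2 > 0" "\<And>y. dist y x < d2 \<Longrightarrow> norm (F \<lfloor>x\<rfloor> y - F \<lfloor>x\<rfloor> x) < e" by blast
  have 1: "norm (h y - F (\<lceil>x\<rceil> - 1) x) \<le> e" if "x - min d (min d1 d2) < y \<and> y < x" for y
  proof -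
    have "dist y x < d1" "\<lfloor>y\<rfloor> = \<lceil>x\<rceil> - 1" using that d(2)[of y] unfolding dist_real_def by linarith+
    then show ?thesis using d1(2)[of y] by (simp add: h)
  qed
  have 2: "norm (h y - h x) \<le> e" if "x \<le> y \<and> y < x + min d (min d1 d2)" for y
  proof -
    have "dist y x < d2" "\<lfloor>y\<rfloor> = \<lfloor>x\<rfloor>" using that d(3)[of y] unfolding dist_real_def by linarith+
    then show ?thesis using d2(2)[of y] by (simp add: h)
  qed
  show "\<exists>d>0. \<exists>c. (\<forall>y. x - d < y \<and> y < x \<longrightarrow> norm (h y - c) \<le> e) \<and> (\<forall>y. x \<le> y \<and> y < x + d \<longrightarrow> norm (h y - h x) \<le> e)"
    by (rule exI[of _ "min d (min d1 d2)"], intro conjI exI[of _ "F (\<lceil>x\<rceil> - 1) x"] allI impI 1 2)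
      (use d(1) d1(1) d2(1) in simp_all)
qed

section \<open>Characters of the circle and the mean of the twisted sawtooth\<close>

definition char_e :: "int \<Rightarrow> real \<Rightarrow> complex" where
  "char_e m x = cis (2 * pi * of_int m * x)"

lemma char_e_add: "char_e m (x + y) = char_e m x * char_e m y"
  by (simp add: char_e_def cis_mult algebra_simps)

lemma char_e_of_int [simp]: "char_e m (of_int k) = 1"
proof -
  have "2 * pi * real_of_int m * real_of_int k = 2 * pi * of_int (m * k)" by simp
  then show ?thesis unfolding char_e_def using cis_multiple_2pi[OF Ints_of_int[of "m * k"]] by (simp only:)
qed

lemma char_e_0 [simp]: "char_e m 0 = 1" by (simp add: char_e_def)

lemma char_e_minus: "char_e m (- x) * char_e m x = 1"
  by (simp flip: char_e_add)

lemma norm_char_e [simp]: "norm (char_e m x) = 1" by (simp add: char_e_def)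

lemma char_e_frac: "char_e m (frac x) = char_e m x"
proof -
  have "char_e m x = char_e m (frac x + of_int \<lfloor>x\<rfloor>)" by (simp add: frac_def)
  then show ?thesis unfolding char_e_add by simp
qed

lemma continuous_char_e: "continuous_on S (char_e m)"
  unfolding char_e_def by (intro continuous_intros)

lemma char_e_alpha_neq_1: "m \<noteq> 0 \<Longrightarrow> char_e m fib_alpha \<noteq> 1"
proof
  assume m: "m \<noteq> 0" "char_e m fib_alpha = 1"
  have "cos (2 * pi * of_int m * fib_alpha) = Re (char_e m fib_alpha)" by (simp add: char_e_def)
  also have "\<dots> = 1" using m by simp
  finally obtain k :: int where "2 * pi * of_int m * fib_alpha = of_int k * 2 * pi"
    unfolding cos_one_2pi_int by blast
  then have "fib_alpha = of_int k / of_int m" using m by (simp add: field_simps)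
  moreover have "(of_int k / of_int m :: real) \<in> \<rat>" by simp
  ultimately show False using fib_alpha_irrational by (simp only:)
qed

text \<open>Shifting by \<open>fib_alpha\<close> multiplies the character by
  \<open>char_e m fib_alpha\<close> and preserves the mean; as this factor differs from 1, the mean
  is 0.\<close>

lemma has_mean_char_e:
  assumes "m \<noteq> 0" shows "has_mean (char_e m) 0"
proof -
  have "\<exists>M. has_mean (char_e m) M"
  proof (rule has_mean_floor_piecewise)
    show "char_e m (frac x) = char_e m x" for x by (rule char_e_frac)
    show "continuous_on UNIV (char_e m)" for k :: int by (rule continuous_char_e)
  qed (rule refl)
  then obtain M where M: "has_mean (char_e m) M" ..
  have "(\<lambda>x. char_e m (x + fib_alpha)) = (\<lambda>x. char_e m fib_alpha * char_e m x)"
    unfolding char_e_add by (simp add: mult.commute)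
  with has_mean_shift[OF M, of fib_alpha] have "has_mean (\<lambda>x. char_e m fib_alpha * char_e m x) M"
    by simp
  then have "char_e m fib_alpha * M = M"
    using has_mean_unique has_mean_linear[OF M bounded_linear_mult_right] by blast
  then have "M = 0" using char_e_alpha_neq_1[OF assms] by simp
  then show ?thesis using M by simp
qed

definition saw :: "int \<Rightarrow> real \<Rightarrow> complex" where
  "saw m x = of_real (frac x) * char_e m x"

text \<open>The indicator of the top arc is \<open>frac x + t - frac (x + t)\<close>. Multiplication
  by the character turns this into a twisted difference of \<open>saw m\<close>. It is used with
  \<open>t\<close> tending to 0 to find the mean of \<open>saw m\<close>, and then with
  \<open>t = fib_alpha\<close>.\<close>

lemma saw_shift:
  assumes "0 \<le> t" "t < 1"
  shows "of_real (indicator {1 - t..<1} (frac x)) * char_e m x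
    = of_real t * char_e m x - char_e m (- t) * saw m (x + t) + saw m x"
proof -
  have t: "frac t = t" using assms by (simp add: frac_eq)
  have *: "char_e m (- t) * (a * char_e m (x + t)) = a * char_e m x" for a
    using char_e_minus[of m t] by (simp add: char_e_add algebra_simps)
  have "frac (x + t) = frac x + t - indicator {1 - t..<1} (frac x)"
    using frac_lt_1[of x] by (simp add: frac_add t indicator_def)
  then have eq: "complex_of_real (frac (x + t)) = of_real (frac x) + of_real t - of_real (indicator {1 - t..<1} (frac x))"
    by simp
  show ?thesis unfolding saw_def * eq by (simp add: algebra_simps)
qed

lemma norm_char_e_diff_le: "norm (char_e m x - char_e m y) \<le> 2 * pi * \<bar>of_int m\<bar> * \<bar>x - y\<bar>"
proof -
  have "norm (char_e m x - char_e m y) = norm (cis (2 * pi * of_int m * (x - y)) - 1)"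
  proof -
    have "char_e m x - char_e m y = char_e m y * (char_e m (x - y) - 1)"
      using char_e_add[of m y "x - y"] by (simp add: algebra_simps)
    then show ?thesis by (simp add: norm_mult char_e_def)
  qed
  also have "\<dots> \<le> \<bar>2 * pi * of_int m * (x - y)\<bar>"
    using dist_exp_i_1[of "2 * pi * of_int m * (x - y)"] abs_sin_x_le_abs_x[of "2 * pi * of_int m * (x - y) / 2"]
    by (simp only: cis_conv_exp)
  finally show ?thesis by (simp add: abs_mult)
qed

text \<open>The mean \<open>M\<close> is found without integration: by \<open>saw_shift\<close>, \<open>(1 - char_e m (- t)) * M\<close> is the mean of
  \<open>char_e m\<close> over an arc of length \<open>t\<close> ending at \<open>1\<close>, that is \<open>t + O(t\<^sup>2)\<close>; now let \<open>t\<close> tend to \<open>0\<close>.\<close>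

lemma has_mean_saw:
  assumes "m \<noteq> 0" shows "has_mean (saw m) (1 / (2 * pi * \<i> * of_int m))"
proof -
  obtain M where M: "has_mean (saw m) M"
  proof -
    have "\<exists>M. has_mean (saw m) M"
    proof (rule has_mean_floor_piecewise)
      show "saw m (frac x) = saw m x" for x by (simp add: saw_def char_e_frac)
      show "continuous_on UNIV (\<lambda>x. of_real (x - of_int k) * char_e m x)" for k
        by (intro continuous_intros continuous_char_e)
      show "saw m y = of_real (y - of_int \<lfloor>y\<rfloor>) * char_e m y" for y by (simp add: saw_def frac_def)
    qed
    then show ?thesis using that by blast
  qed
  have arc: "has_mean (\<lambda>x. of_real (indicator {1 - t..<1} (frac x)) * char_e m x) ((1 - char_e m (- t)) * M)"
    if "0 \<le> t" "t < 1" for t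
    using has_mean_add[OF has_mean_diff[OF has_mean_linear[OF has_mean_char_e[OF assms] bounded_linear_mult_right[of "of_real t"]]
        has_mean_linear[OF has_mean_shift[OF M, of t] bounded_linear_mult_right[of "char_e m (- t)"]]] M]
    unfolding saw_shift[OF that] by (simp add: algebra_simps)
  \<comment> \<open>On the top arc the character differs from 1 by at most
    \<open>2 * pi * \<bar>of_int m\<bar> * t\<close>, and the arc itself has mean
    \<open>t\<close>.\<close>
  have bd: "norm ((1 - char_e m (- t)) * M - of_real t) \<le> 2 * pi * \<bar>of_int m\<bar> * t * t" if "0 \<le> t" "t < 1" for t
  proof (rule has_mean_norm_le)
    have top: "has_mean (\<lambda>x. indicator {1 - t..<1} (frac x)) t"
      using has_mean_top_arc[of "1 - t"] that by simp
    show "has_mean (\<lambda>x. of_real (indicator {1 - t..<1} (frac x)) * char_e m x - of_real (indicator {1 - t..<1} (frac x)))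
       ((1 - char_e m (- t)) * M - of_real t)"
      using has_mean_diff[OF arc[OF that] has_mean_linear[OF top bounded_linear_of_real]] by simp
    show "has_mean (\<lambda>x. 2 * pi * \<bar>of_int m\<bar> * t * indicator {1 - t..<1} (frac x)) (2 * pi * \<bar>of_int m\<bar> * t * t)"
      using has_mean_linear[OF top bounded_linear_mult_right] by simp
    show "norm (of_real (indicator {1 - t..<1} (frac x)) * char_e m x - of_real (indicator {1 - t..<1} (frac x)))
       \<le> 2 * pi * \<bar>of_int m\<bar> * t * indicator {1 - t..<1} (frac x)" for x
    proof (cases "1 - t \<le> frac x")
      case True
      have "norm (char_e m x - 1) \<le> 2 * pi * \<bar>of_int m\<bar> * \<bar>frac x - 1\<bar>"
        using norm_char_e_diff_le[of m "frac x" 1] char_e_of_int[of m 1] by (simp add: char_e_frac)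
      also have "\<dots> \<le> 2 * pi * \<bar>of_int m\<bar> * t"
        using True frac_lt_1[of x] by (intro mult_left_mono) auto
      finally show ?thesis using True frac_lt_1[of x] by simp
    qed (simp add: indicator_def)
  qed
  have "((\<lambda>t. (1 - char_e m (- t)) / of_real t) \<longlongrightarrow> 2 * pi * \<i> * of_int m) (at_right 0)"
  proof -
    define c where "c = 2 * complex_of_real pi * \<i> * of_int m"
    have "((\<lambda>z. - exp (- (c * z))) has_field_derivative c) (at 0)"
      by (auto intro!: derivative_eq_intros)
    then have "((\<lambda>z. (1 - exp (- (c * z))) / z) \<longlongrightarrow> c) (at 0)"
      by (simp add: has_field_derivative_iff)
    moreover have "filterlim complex_of_real (at 0) (at_right 0)"
      unfolding filterlim_at
      by (intro conjI) (auto simp: eventually_at_filter intro!: tendsto_eq_intros)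
    ultimately have "((\<lambda>t. (1 - exp (- (c * of_real t))) / of_real t) \<longlongrightarrow> c) (at_right 0)"
      by (rule filterlim_compose)
    moreover have "exp (- (c * of_real t)) = char_e m (- t)" for t
      by (simp add: c_def char_e_def cis_conv_exp mult_ac)
    ultimately show ?thesis by (simp add: c_def)
  qed
  then have "((\<lambda>t. (1 - char_e m (- t)) / of_real t * M) \<longlongrightarrow> 2 * pi * \<i> * of_int m * M) (at_right 0)"
    by (intro tendsto_intros)
  moreover have "((\<lambda>t. (1 - char_e m (- t)) / of_real t * M) \<longlongrightarrow> 1) (at_right 0)"
  proof (rule LIM_zero_cancel, rule Lim_null_comparison)
    show "eventually (\<lambda>t. norm ((1 - char_e m (- t)) / complex_of_real t * M - 1) \<le> 2 * pi * \<bar>of_int m\<bar> * t) (at_right 0)"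
      unfolding eventually_at_right_field
    proof (intro exI[of _ 1] conjI allI impI)
      fix t :: real assume t: "0 < t" "t < 1"
      have "(1 - char_e m (- t)) / complex_of_real t * M - 1 = ((1 - char_e m (- t)) * M - of_real t) / of_real t"
        using t by (simp add: field_simps)
      then have "norm ((1 - char_e m (- t)) / complex_of_real t * M - 1) = norm ((1 - char_e m (- t)) * M - of_real t) / t"
        using t by (simp add: norm_divide)
      also have "\<dots> \<le> (2 * pi * \<bar>of_int m\<bar> * t * t) / t"
        using bd[of t] t by (intro divide_right_mono) auto
      finally show "norm ((1 - char_e m (- t)) / complex_of_real t * M - 1) \<le> 2 * pi * \<bar>of_int m\<bar> * t"
        using t by simp
    qed simp
    show "((\<lambda>t. 2 * pi * \<bar>real_of_int m\<bar> * t) \<longlongrightarrow> 0) (at_right 0)"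
      by (auto intro!: tendsto_eq_intros)
  qed
  ultimately have "2 * pi * \<i> * of_int m * M = 1" 
    using tendsto_unique trivial_limit_at_right_real by blast
  then have "M = 1 / (2 * pi * \<i> * of_int m)" using assms by (simp add: field_simps)
  then show ?thesis using M by simp
qed

section \<open>Slowly varying amplitudes\<close>

text \<open>Variation of constants: \<open>prufer\<close> is the slowly varying complex amplitude for which
  \<open>u n = Im (prufer n * cis (th * n))\<close> solves the perturbed equation (\<open>prufer_solution\<close>), and
  \<open>prufer_phase\<close> below is a continuous choice of its argument.\<close>

primrec prufer :: "real \<Rightarrow> real \<Rightarrow> (nat \<Rightarrow> real) \<Rightarrow> nat \<Rightarrow> complex" where
  "prufer th V g 0 = of_real (1 / sin th)"
| "prufer th V g (Suc n) = prufer th V g n +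
     of_real (V * g (Suc n) / sin th * Im (prufer th V g n * cis (th * real (Suc n)))) * cis (- (th * real (Suc n)))"

declare prufer.simps(2) [simp del]

text \<open>The increment is a real multiple of \<open>cis (- (th * real (Suc n)))\<close>. Rotated
  to site \<open>Suc n\<close> it is real and leaves \<open>u (Suc n)\<close> unchanged; rotated one
  site further it contributes exactly \<open>V * g (Suc n) * u (Suc n)\<close>, thanks to the
  division by \<open>sin th\<close>.\<close>

lemma prufer_solution:
  assumes "sin th \<noteq> 0" "u 0 = 0" "u (Suc 0) = 1"
    and "\<And>n. u (Suc (Suc n)) = (2 * cos th + V * g (Suc n)) * u (Suc n) - u n"
  shows "u n = Im (prufer th V g n * cis (th * real n))" "u (Suc n) = Im (prufer th V g n * cis (th * real (Suc n)))"
proof (induction n)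
  case 0
  show "u 0 = Im (prufer th V g 0 * cis (th * real 0))" "u (Suc 0) = Im (prufer th V g 0 * cis (th * real (Suc 0)))"
    using assms by simp_all
next
  case (Suc n)
  define p where "p = prufer th V g n"
  define a where "a = V * g (Suc n) / sin th * u (Suc n)"
  define x where "x = th * real (Suc n)"
  have q: "prufer th V g (Suc n) = p + of_real a * cis (- x)"
    using Suc(2) by (simp add: prufer.simps(2) p_def a_def x_def)
  have 1: "u n = Im (p * cis (x - th))" "u (Suc n) = Im (p * cis x)"
    using Suc by (simp_all add: p_def x_def algebra_simps)
  have "(of_real a * cis (- x)) * cis x = of_real a"
    unfolding mult.assoc cis_mult by simp
  then have "Im ((p + of_real a * cis (- x)) * cis x) = Im (p * cis x)"
    unfolding distrib_right by (simp only: plus_complex.sel Im_complex_of_real)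
  then show "u (Suc n) = Im (prufer th V g (Suc n) * cis (th * real (Suc n)))"
    unfolding q x_def[symmetric] 1 by simp
  have "(of_real a * cis (- x)) * cis (x + th) = of_real a * cis th"
    unfolding mult.assoc cis_mult by simp
  moreover have "Im (of_real a * cis th) = a * sin th" by simp
  ultimately have "Im ((p + of_real a * cis (- x)) * cis (x + th)) = Im (p * cis (x + th)) + a * sin th"
    unfolding distrib_right by (simp only: plus_complex.sel)
  moreover have "a * sin th = V * g (Suc n) * u (Suc n)" using assms(1) by (simp add: a_def)
  moreover have "Im (p * cis (x + th)) = 2 * cos th * Im (p * cis x) - Im (p * cis (x - th))"
    by (simp add: cos_add sin_add cos_diff sin_diff algebra_simps)
  moreover have "th * real (Suc (Suc n)) = x + th" by (simp add: x_def algebra_simps)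
  ultimately show "u (Suc (Suc n)) = Im (prufer th V g (Suc n) * cis (th * real (Suc (Suc n))))"
    unfolding q assms(4) 1 by (simp only:) (simp add: algebra_simps)
qed

lemma norm_prufer_diff:
  assumes "sin th > 0" "V > 0" "\<bar>g (Suc n)\<bar> \<le> G"
  shows "norm (prufer th V g (Suc n) - prufer th V g n) \<le> V * G / sin th * norm (prufer th V g n)"
proof -
  have "norm (prufer th V g (Suc n) - prufer th V g n)
     = V / sin th * (\<bar>g (Suc n)\<bar> * \<bar>Im (prufer th V g n * cis (th * real (Suc n)))\<bar>)"
    unfolding prufer.simps(2) add_diff_cancel_left' norm_mult norm_of_real norm_cis
    using assms by (simp only: abs_mult abs_divide) simp
  also have "\<dots> \<le> V / sin th * (G * norm (prufer th V g n))"
    using assms abs_Im_le_cmod[of "prufer th V g n * cis (th * real (Suc n))"]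
    by (intro mult_left_mono mult_mono) (auto simp: norm_mult)
  finally show ?thesis by (simp add: mult_ac)
qed

definition prufer_phase :: "real \<Rightarrow> real \<Rightarrow> (nat \<Rightarrow> real) \<Rightarrow> nat \<Rightarrow> real" where
  "prufer_phase th V g n = (\<Sum>k<n. Im (Ln (prufer th V g (Suc k) / prufer th V g k)))"

lemma abs_Im_Ln_le:
  assumes "norm (w - 1) \<le> d" "d \<le> 1/2" shows "\<bar>Im (Ln w)\<bar> \<le> 2 * d" "\<bar>Im (Ln w) - Im (w - 1)\<bar> \<le> 2 * d\<^sup>2"
proof -
  have d0: "0 \<le> d" using assms(1) norm_ge_zero order_trans by blast
  have "norm (Ln (1 + (w - 1)) - (w - 1)) \<le> norm (w - 1) ^ 2 / (1 - norm (w - 1))"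
    by (rule Ln_approx_linear) (use assms in linarith)
  also have "\<dots> \<le> d ^ 2 / (1/2)"
    using assms by (intro frac_le power_mono) auto
  finally have 1: "norm (Ln w - (w - 1)) \<le> 2 * d\<^sup>2" by simp
  then show 2: "\<bar>Im (Ln w) - Im (w - 1)\<bar> \<le> 2 * d\<^sup>2"
    using abs_Im_le_cmod[of "Ln w - (w - 1)"] by simp
  have "2 * d\<^sup>2 \<le> d" using assms(2) d0 mult_right_mono[of "2 * d" 1 d] by (simp add: power2_eq_square)
  moreover have "\<bar>Im (w - 1)\<bar> \<le> d" using abs_Im_le_cmod[of "w - 1"] assms(1) by linarith
  ultimately show "\<bar>Im (Ln w)\<bar> \<le> 2 * d" using 2 by linarith
qed

context
  fixes th V :: real and g :: "nat \<Rightarrow> real" and G d :: real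
  assumes th: "sin th > 0" and V: "V > 0" and gG: "\<And>n. \<bar>g n\<bar> \<le> G"
    and d: "d = V * G / sin th" "d \<le> 1/2"
begin

lemma prufer_step: "norm (prufer th V g (Suc n) - prufer th V g n) \<le> d * norm (prufer th V g n)"
  using norm_prufer_diff[of th V g n G] th V gG d by simp

lemma prufer_step_nonneg: "0 \<le> d"
  using gG[of 0] th V d by simp

lemma prufer_nonzero: "prufer th V g n \<noteq> 0"
proof (induction n)
  case 0 then show ?case using th by simp
next
  case (Suc n)
  show ?case
  proof
    assume "prufer th V g (Suc n) = 0"
    then have "norm (prufer th V g n) \<le> d * norm (prufer th V g n)" using prufer_step[of n] by simp
    also have "\<dots> \<le> 1/2 * norm (prufer th V g n)" using d by (intro mult_right_mono) auto
    finally show False using Suc by simp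
  qed
qed

text \<open>Since \<open>d \<le> 1/2\<close>, ratios of consecutive amplitudes stay in a disc about
  1 that avoids the branch cut of \<open>Ln\<close>; hence \<open>prufer_phase\<close> moves by
  small steps.\<close>

lemma prufer_ratio: "norm (prufer th V g (Suc n) / prufer th V g n - 1) \<le> d"
proof -
  have "prufer th V g (Suc n) / prufer th V g n - 1 = (prufer th V g (Suc n) - prufer th V g n) / prufer th V g n"
    using prufer_nonzero by (simp add: field_simps)
  then show ?thesis using prufer_step[of n] prufer_nonzero[of n] by (simp add: norm_divide pos_divide_le_eq)
qed

lemma prufer_phase_step: "\<bar>prufer_phase th V g (Suc n) - prufer_phase th V g n\<bar> \<le> 2 * d"
  using abs_Im_Ln_le(1)[OF prufer_ratio] d by (simp add: prufer_phase_def)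

lemma prufer_phase_steps: "\<bar>prufer_phase th V g (n + k) - prufer_phase th V g n\<bar> \<le> 2 * d * real k"
proof (induction k)
  case (Suc k) then show ?case using prufer_phase_step[of "n + k"] by (simp add: algebra_simps)
qed simp

lemma prufer_polar: "prufer th V g n = of_real (norm (prufer th V g n)) * cis (prufer_phase th V g n)"
proof (induction n)
  case 0 then show ?case using th by (simp add: prufer_phase_def norm_divide)
next
  case (Suc n)
  define r where "r = prufer th V g (Suc n) / prufer th V g n"
  have r: "r \<noteq> 0" using prufer_nonzero by (simp add: r_def)
  have "r = of_real (norm r) * cis (Im (Ln r))"
    using r exp_eq_polar[of "Ln r"] by (simp add: Re_Ln)
  moreover have "prufer th V g (Suc n) = r * prufer th V g n" using prufer_nonzero by (simp add: r_def)
  moreover have "norm (prufer th V g (Suc n)) = norm r * norm (prufer th V g n)"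
    using \<open>prufer th V g (Suc n) = r * prufer th V g n\<close> norm_mult by metis
  moreover have "prufer_phase th V g (Suc n) = prufer_phase th V g n + Im (Ln r)" by (simp add: prufer_phase_def r_def)
  moreover have "of_real (norm r * a) * cis (b + Im (Ln r)) = (of_real (norm r) * cis (Im (Ln r))) * (of_real a * cis b)" for a b
    by (simp add: cis_mult[symmetric] mult_ac)
  ultimately show ?case using Suc by metis
qed

lemma prufer_growth: "norm (prufer th V g (n + k) - prufer th V g n) \<le> ((1 + d) ^ k - 1) * norm (prufer th V g n)"
proof (induction k)
  case (Suc k)
  let ?A = "norm (prufer th V g n)"
  have 1: "norm (prufer th V g (n + k)) \<le> (1 + d) ^ k * ?A"
    using Suc norm_triangle_ineq2[of "prufer th V g (n + k)" "prufer th V g n"] by (simp add: algebra_simps)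
  have "norm (prufer th V g (n + Suc k) - prufer th V g n)
      \<le> norm (prufer th V g (Suc (n + k)) - prufer th V g (n + k)) + norm (prufer th V g (n + k) - prufer th V g n)"
    using norm_triangle_ineq[of "prufer th V g (Suc (n + k)) - prufer th V g (n + k)" "prufer th V g (n + k) - prufer th V g n"] by (simp only: add_Suc_right diff_add_cancel add_diff_eq)
  also have "\<dots> \<le> d * ((1 + d) ^ k * ?A) + ((1 + d) ^ k - 1) * ?A"
    using prufer_step[of "n + k"] mult_left_mono[OF 1 prufer_step_nonneg] Suc by linarith
  finally show ?case by (simp add: algebra_simps)
qed simp

lemma power_one_plus_small:
  assumes "real B * d \<le> 1/2" "k \<le> B" shows "(1 + d) ^ k - 1 \<le> 2 * (real B * d)"
proof -
  have "(1 + d) ^ k \<le> exp (real k * d)"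
    using exp_ge_add_one_self[of d] prufer_step_nonneg power_mono[of "1 + d" "exp d" k] by (simp add: exp_of_nat_mult)
  also have "\<dots> \<le> exp (real B * d)" using assms prufer_step_nonneg by (simp add: mult_right_mono)
  also have "\<dots> \<le> 1 + 2 * (real B * d)"
    using exp_bound_lemma[of "real B * d"] assms(1) prufer_step_nonneg by simp
  finally show ?thesis by simp
qed

text \<open>The amplitude is frozen at its value \<open>p\<close> at the start of the block. Each
  increment is a real-linear map of norm at most \<open>d\<close>, and inside the block the
  amplitude moves by at most \<open>2 * (real B * d) * norm p\<close>, so freezing costs
  \<open>real B * d\<close> times that.\<close>

lemma prufer_block:
  fixes n :: nat
  assumes B: "real B * d \<le> 1/8"
  defines "p \<equiv> prufer th V g n"
  shows "norm (prufer th V g (n + B) / p - 1 - of_real (V / sin th) *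
       (\<Sum>j<B. of_real (g (n + Suc j)) * ((1 - cnj p / p * cis (- (2 * th * real (n + Suc j)))) / (2 * \<i>))))
     \<le> 2 * (real B * d)\<^sup>2"
    and "norm (prufer th V g (n + B) / p - 1) \<le> 2 * (real B * d)"
proof -
  define c where "c j = V / sin th * g (n + Suc j)" for j
  define e where "e j = cis (- (2 * th * real (n + Suc j)))" for j
  define A where "A j q = of_real (c j) * ((q - cnj q * e j) / (2 * \<i>))" for j q
  have p0: "p \<noteq> 0" unfolding p_def by (rule prufer_nonzero)
  have step: "prufer th V g (n + Suc j) - prufer th V g (n + j) = A j (prufer th V g (n + j))" for j
  proof -
    define q x where "q = prufer th V g (n + j)" and "x = th * real (Suc (n + j))"
    have im: "of_real (Im w) = (w - cnj w) / (2 * \<i>)" for w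
      by (simp add: complex_eq_iff)
    have e: "e j = cis (- x) * cis (- x)" by (simp add: e_def x_def cis_mult mult.assoc)
    have "cis x * cis (- x) = 1" by (simp add: cis_mult)
    then have "(q * cis x - cnj q * cis (- x)) * cis (- x) = q - cnj q * e j"
      unfolding e left_diff_distrib by (simp only: mult.assoc mult_1_right)
    then have "of_real (Im (q * cis x)) * cis (- x) = (q - cnj q * e j) / (2 * \<i>)"
      unfolding im complex_cnj_mult cis_cnj by (simp only: times_divide_eq_left)
    moreover have "prufer th V g (n + Suc j) - q = of_real (c j) * (of_real (Im (q * cis x)) * cis (- x))"
      unfolding add_Suc_right prufer.simps(2) q_def[symmetric] x_def[symmetric] add_diff_cancel_left' c_def
      by (simp only: of_real_mult of_real_divide mult.assoc times_divide_eq_left)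
    ultimately show ?thesis unfolding A_def q_def by simp
  qed
  have Alin: "A j q - A j q' = A j (q - q')" for j q q'
  proof -
    have "(q - cnj q * e j) - (q' - cnj q' * e j) = (q - q') - cnj (q - q') * e j" by (simp add: algebra_simps)
    then show ?thesis unfolding A_def right_diff_distrib[symmetric] diff_divide_distrib[symmetric] by simp
  qed
  have Abd: "norm (A j q) \<le> d * norm q" for j q
  proof -
    have "norm (q - cnj q * e j) \<le> 2 * norm q"
      using norm_triangle_ineq4[of q "cnj q * e j"] by (simp add: norm_mult e_def)
    then have 1: "norm ((q - cnj q * e j) / (2 * \<i>)) \<le> norm q"
      by (simp add: norm_divide norm_mult)
    have "\<bar>c j\<bar> \<le> d"
      using gG[of "n + Suc j"] th V unfolding c_def d(1) abs_mult by (simp add: field_simps)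
    then show ?thesis unfolding A_def norm_mult norm_of_real by (rule mult_mono[OF _ 1]) (use prufer_step_nonneg in auto)
  qed
  have tel: "prufer th V g (n + B) - p = (\<Sum>j<B. A j (prufer th V g (n + j)))"
    using sum_lessThan_telescope[of "\<lambda>j. prufer th V g (n + j)" B] step by (simp add: p_def)
  have gr: "norm (prufer th V g (n + j) - p) \<le> 2 * (real B * d) * norm p" if "j \<le> B" for j
  proof -
    have "(1 + d) ^ j - 1 \<le> 2 * (real B * d)" using power_one_plus_small[OF _ that] B by simp
    from mult_right_mono[OF this norm_ge_zero] show ?thesis
      unfolding p_def by (rule order_trans[OF prufer_growth])
  qed
  have "prufer th V g (n + B) / p - 1 = (prufer th V g (n + B) - p) / p" using p0 by (simp add: field_simps)
  then show "norm (prufer th V g (n + B) / p - 1) \<le> 2 * (real B * d)"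
    using gr[of B] p0 by (simp add: norm_divide field_simps)
  have "norm ((\<Sum>j<B. A j (prufer th V g (n + j))) - (\<Sum>j<B. A j p)) \<le> (\<Sum>j<B. d * (2 * (real B * d) * norm p))"
    unfolding sum_subtractf[symmetric] Alin
    by (rule sum_norm_le, rule order_trans[OF Abd], rule mult_left_mono[OF gr prufer_step_nonneg]) simp
  then have err: "norm (prufer th V g (n + B) - p - (\<Sum>j<B. A j p)) \<le> 2 * (real B * d)\<^sup>2 * norm p"
    unfolding tel by (simp add: power2_eq_square mult_ac)
  \<comment> \<open>Because of the conjugate \<open>A j\<close> is only real-linear: dividing by
    \<open>p\<close> leaves the factor \<open>cnj p / p\<close>, which carries the phase.\<close>
  have Ap: "A j p = of_real (V / sin th) * (of_real (g (n + Suc j)) * ((1 - cnj p / p * e j) / (2 * \<i>))) * p" for j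
  proof -
    have "(1 - cnj p / p * e j) / (2 * \<i>) * p = (p - cnj p * e j) / (2 * \<i>)"
      using p0 by (simp add: left_diff_distrib diff_divide_distrib)
    then show ?thesis unfolding A_def c_def of_real_mult mult.assoc by simp
  qed
  have "prufer th V g (n + B) / p - 1 - of_real (V / sin th) *
       (\<Sum>j<B. of_real (g (n + Suc j)) * ((1 - cnj p / p * e j) / (2 * \<i>)))
     = (prufer th V g (n + B) - p - (\<Sum>j<B. A j p)) / p"
    unfolding Ap sum_distrib_left[symmetric] sum_distrib_right[symmetric] using p0 by (simp add: diff_divide_distrib)
  moreover have "norm ((prufer th V g (n + B) - p - (\<Sum>j<B. A j p)) / p) \<le> 2 * (real B * d)\<^sup>2"
    using err p0 by (simp add: norm_divide pos_divide_le_eq)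
  ultimately show "norm (prufer th V g (n + B) / p - 1 - of_real (V / sin th) *
       (\<Sum>j<B. of_real (g (n + Suc j)) * ((1 - cnj p / p * cis (- (2 * th * real (n + Suc j)))) / (2 * \<i>))))
     \<le> 2 * (real B * d)\<^sup>2"
    unfolding e_def by (simp only:)
qed

text \<open>The phase gained over a block is at most \<open>1/4\<close> in modulus, hence it is the
  principal argument of the ratio of the amplitudes, and \<open>cnj p / p\<close> is
  \<open>cis\<close> of minus twice the phase. Of the constant 10, the part 8 comes from linearising
  \<open>Ln\<close> and 2 from \<open>prufer_block\<close>.\<close>

lemma prufer_phase_block:
  assumes B: "real B * d \<le> 1/8"
  shows "\<bar>prufer_phase th V g (n + B) - prufer_phase th V g n + V / (2 * sin th) * (\<Sum>j<B. g (n + Suc j) *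
     (1 - Re (cis (- (2 * prufer_phase th V g n)) * cis (- (2 * th * real (n + Suc j))))))\<bar> \<le> 10 * (real B * d)\<^sup>2"
proof -
  define p ph where "p = prufer th V g n" and "ph = prufer_phase th V g n"
  have p0: "p \<noteq> 0" unfolding p_def by (rule prufer_nonzero)
  have pp: "p = of_real (norm p) * cis ph" unfolding p_def ph_def by (rule prufer_polar)
  define w where "w = prufer th V g (n + B) / p"
  define D where "D = prufer_phase th V g (n + B) - ph"
  have wb: "norm (w - 1) \<le> 2 * (real B * d)" using prufer_block(2)[OF B] by (simp add: w_def p_def)
  have w0: "w \<noteq> 0" using prufer_nonzero by (simp add: w_def p_def)
  have "\<bar>D\<bar> \<le> 2 * d * real B" unfolding D_def ph_def by (rule prufer_phase_steps)
  then have Dpi: "- pi < D" "D \<le> pi" using B pi_gt3 by (auto simp: abs_le_iff mult_ac)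
  have "w = of_real (norm w) * cis D"
  proof -
    have "prufer th V g (n + B) = of_real (norm (prufer th V g (n + B))) * (cis D * cis ph)"
      using prufer_polar[of "n + B"] by (simp add: cis_mult D_def)
    also have "\<dots> = of_real (norm (prufer th V g (n + B)) / norm p) * cis D * p"
      using pp p0 by (subst (2) pp) (simp add: field_simps)
    finally show ?thesis using p0 by (simp add: w_def norm_divide field_simps)
  qed
  then have "w = exp (Complex (ln (norm w)) D)"
    using w0 by (simp add: exp_eq_polar)
  then have "Ln w = Complex (ln (norm w)) D" using Dpi by (intro Ln_unique) simp_all
  then have "Im (Ln w) = D" by simp
  moreover have "2 * (real B * d) \<le> 1/2" using B by simp
  ultimately have 1: "\<bar>D - Im (w - 1)\<bar> \<le> 2 * (2 * (real B * d))\<^sup>2"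
    using abs_Im_Ln_le(2)[OF wb] by metis
  define S where "S = of_real (V / sin th) *
       (\<Sum>j<B. of_real (g (n + Suc j)) * ((1 - cnj p / p * cis (- (2 * th * real (n + Suc j)))) / (2 * \<i>)))"
  have 2: "\<bar>Im (w - 1) - Im S\<bar> \<le> 2 * (real B * d)\<^sup>2"
    using abs_Im_le_cmod[of "w - 1 - S"] prufer_block(1)[OF B, of n] unfolding w_def S_def p_def by simp
  have cp: "cnj p / p = cis (- (2 * ph))"
  proof -
    have "cnj p = of_real (norm p) * cis (- ph)" by (subst pp) (simp add: cis_cnj)
    moreover have "cis (- ph) = cis (- (2 * ph)) * cis ph" by (simp add: cis_mult)
    ultimately have "cnj p = cis (- (2 * ph)) * p" using pp by (metis mult.left_commute)
    then show ?thesis using p0 by simp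
  qed
  have im: "Im (of_real a * ((1 - z) / (2 * \<i>))) = - (a * (1 - Re z)) / 2" for a z
    by (simp add: Im_divide)
  have im2: "Im (of_real a * z) = a * Im z" for a z by simp
  have "Im S = V / sin th * (\<Sum>j<B. - (g (n + Suc j) * (1 - Re (cis (- (2 * ph)) * cis (- (2 * th * real (n + Suc j)))))) / 2)"
    unfolding S_def cp im2 Im_sum
    by (intro arg_cong2[of _ _ _ _ "(*)"] sum.cong refl, subst im2[symmetric], rule im)
  also have "\<dots> = - (V / (2 * sin th) * (\<Sum>j<B. g (n + Suc j) * (1 - Re (cis (- (2 * ph)) * cis (- (2 * th * real (n + Suc j)))))))"
    unfolding sum_divide_distrib[symmetric] sum_negf by simp
  finally have 3: "Im S = - (V / (2 * sin th) * (\<Sum>j<B. g (n + Suc j) * (1 - Re (cis (- (2 * ph)) * cis (- (2 * th * real (n + Suc j)))))))" .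
  have "2 * (2 * (real B * d))\<^sup>2 + 2 * (real B * d)\<^sup>2 = 10 * (real B * d)\<^sup>2" by (simp add: power_mult_distrib)
  with 1 2 3 show ?thesis unfolding D_def ph_def by linarith
qed

end

text \<open>Within distance \<open>\<eta> / l\<close> above \<open>x0\<close> the velocity is still
  at least \<open>\<eta>\<close>, which beats the error, so the step is not downward. Farther up, a
  single step has size at most \<open>\<kappa> * (H + \<eta>)\<close>, at most
  \<open>\<eta> / l\<close>, and cannot jump over \<open>x0\<close>.\<close>

lemma barrier:
  fixes \<Phi> :: "nat \<Rightarrow> real"
  assumes step: "\<And>k. \<bar>\<Phi> (Suc k) - \<Phi> k - \<kappa> * h (\<Phi> k)\<bar> \<le> \<kappa> * \<eta>"
    and lip: "\<And>x y. \<bar>h x - h y\<bar> \<le> l * \<bar>x - y\<bar>" and H: "\<And>x. \<bar>h x\<bar> \<le> H"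
    and "h x0 \<ge> 2 * \<eta>" "\<kappa> > 0" "l > 0" "\<kappa> * (H + \<eta>) * l \<le> \<eta>" "\<Phi> 0 \<ge> x0"
  shows "\<Phi> k \<ge> x0"
proof (induction k)
  case (Suc k)
  show ?case
  proof (cases "l * (\<Phi> k - x0) \<le> \<eta>")
    case True
    then have "\<bar>h (\<Phi> k) - h x0\<bar> \<le> \<eta>" using lip[of "\<Phi> k" x0] Suc by simp
    then have "h (\<Phi> k) \<ge> \<eta>" using assms(4) by linarith
    then have "\<kappa> * h (\<Phi> k) \<ge> \<kappa> * \<eta>" using assms(5) by simp
    then show ?thesis using step[of k] Suc by linarith
  next
    case False
    then have "l * (\<kappa> * (H + \<eta>)) < l * (\<Phi> k - x0)" using assms(7) by (simp add: mult_ac)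
    then have "\<kappa> * (H + \<eta>) < \<Phi> k - x0" using assms(6) by simp
    moreover have "\<bar>\<kappa> * h (\<Phi> k)\<bar> \<le> \<kappa> * H" using H[of "\<Phi> k"] assms(5) by (simp add: abs_mult)
    ultimately show ?thesis using step[of k] by (simp add: algebra_simps)
  qed
qed (use assms in simp)

section \<open>The averaged phase equation\<close>

text \<open>The Fourier coefficient of the indicator function of \<open>[1 - fib_alpha, 1)\<close> at frequency \<open>m\<close>.\<close>

definition fib_mode :: "int \<Rightarrow> complex" where
  "fib_mode m = (1 - char_e m (- fib_alpha)) / (2 * pi * \<i> * of_int m)"

lemma has_mean_fib_mode:
  assumes "m \<noteq> 0"
  shows "has_mean (\<lambda>x. of_real (indicator {1 - fib_alpha..<1} (frac x)) * char_e m x) (fib_mode m)"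
proof -
  have "has_mean (\<lambda>x. of_real fib_alpha * char_e m x - char_e m (- fib_alpha) * saw m (x + fib_alpha) + saw m x)
    (of_real fib_alpha * 0 - char_e m (- fib_alpha) * (1 / (2 * pi * \<i> * of_int m)) + 1 / (2 * pi * \<i> * of_int m))"
    by (intro has_mean_add has_mean_diff has_mean_linear[OF _ bounded_linear_mult_right]
        has_mean_shift has_mean_saw has_mean_char_e assms)
  moreover have "of_real fib_alpha * 0 - char_e m (- fib_alpha) * (1 / (2 * pi * \<i> * of_int m)) + 1 / (2 * pi * \<i> * of_int m) = fib_mode m"
    by (simp add: fib_mode_def diff_divide_distrib)
  moreover have "0 \<le> fib_alpha" "fib_alpha < 1" using fib_alpha_bounds by auto
  ultimately show ?thesis by (simp add: saw_shift)
qed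

text \<open>Irrationality of \<open>fib_alpha\<close> makes the numerator of
  \<open>fib_mode m\<close> nonzero; bounding it by 2 gives the decay in \<open>m\<close> behind the
  uniform constant of the theorem.\<close>

lemma norm_fib_mode:
  assumes "m \<noteq> 0" shows "0 < norm (fib_mode m)" "norm (fib_mode m) \<le> 1 / (pi * \<bar>of_int m\<bar>)"
proof -
  have "char_e m (- fib_alpha) \<noteq> 1"
    using char_e_minus[of m fib_alpha] char_e_alpha_neq_1[OF assms] by auto
  then show "0 < norm (fib_mode m)" using assms by (simp add: fib_mode_def)
  have "norm (1 - char_e m (- fib_alpha)) \<le> 2"
    using norm_triangle_ineq4[of 1 "char_e m (- fib_alpha)"] by simp
  then have "norm (1 - char_e m (- fib_alpha)) / (2 * pi * \<bar>of_int m\<bar>) \<le> 2 / (2 * pi * \<bar>of_int m\<bar>)"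
    by (intro divide_right_mono) auto
  then show "norm (fib_mode m) \<le> 1 / (pi * \<bar>of_int m\<bar>)"
    by (simp add: fib_mode_def norm_divide norm_mult)
qed

text \<open>For \<open>V = 0\<close> the integrated density of states at \<open>2 * cos th\<close> is \<open>1 - th / pi\<close>, so the gap with label
  \<open>m\<close> opens at \<open>2 * cos (label_angle m)\<close>.\<close>

definition label_angle :: "int \<Rightarrow> real" where
  "label_angle m = pi * (1 - frac (of_int m * fib_alpha))"

lemma frac_label:
  assumes "m \<noteq> 0" shows "0 < frac (of_int m * fib_alpha)" "frac (of_int m * fib_alpha) < 1"
proof -
  have "of_int m * fib_alpha \<notin> \<int>"
  proof
    assume "of_int m * fib_alpha \<in> \<int>"
    then have "of_int m * fib_alpha / of_int m \<in> \<rat>" using Ints_subset_Rats by (intro Rats_divide) auto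
    then show False using assms fib_alpha_irrational by simp
  qed
  then show "0 < frac (of_int m * fib_alpha)" by (simp add: frac_gt_0_iff)
qed (rule frac_lt_1)

lemma label_angle_bounds:
  assumes "m \<noteq> 0" shows "0 < label_angle m" "label_angle m < pi" "0 < sin (label_angle m)"
  using frac_label[OF assms] by (auto simp: label_angle_def intro!: sin_gt_zero)

lemma cis_label_angle: "cis (- (2 * label_angle m * real n)) = char_e m (real n * fib_alpha)"
proof -
  have "- (2 * label_angle m * real n) = 2 * pi * of_int m * (real n * fib_alpha)
     + 2 * pi * of_int (- int n - \<lfloor>of_int m * fib_alpha\<rfloor> * int n)"
    by (simp add: label_angle_def frac_def algebra_simps)
  then show ?thesis
    unfolding char_e_def by (simp only: cis_mult[symmetric] cis_multiple_2pi[OF Ints_of_int] mult_1_right)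
qed

text \<open>The perturbation for \<open>prufer\<close>: \<open>V * fib_g lam n\<close> is the energy
  shift \<open>lam * V\<close> minus the potential of phase 0 at site \<open>n\<close>.\<close>

definition fib_g :: "real \<Rightarrow> nat \<Rightarrow> real" where
  "fib_g lam n = lam - indicator {1 - fib_alpha..<1} (frac (real n * fib_alpha))"

lemma fib_g_bound: "\<bar>fib_g lam n\<bar> \<le> \<bar>lam\<bar> + 1"
  by (auto simp: fib_g_def indicator_def)

text \<open>The averaged velocity of the phase at energy \<open>2 * cos (label_angle m) + (\<mu> + fib_alpha) * V\<close>. It has
  zeros if and only if \<open>\<bar>\<mu>\<bar> \<le> norm (fib_mode m)\<close>, which is where the asymptotic gap width comes from.\<close>

definition drift :: "int \<Rightarrow> real \<Rightarrow> real \<Rightarrow> real" where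
  "drift m \<mu> x = - \<mu> - Re (fib_mode m * cis (- (2 * x)))"

text \<open>One block is an Euler step of the averaged equation with time step
  \<open>V * real B / (2 * sin (label_angle m))\<close>. \<open>B\<close> is fixed by the two means
  alone, each costing \<open>\<eta> / 4\<close>; afterwards small \<open>V\<close> makes the
  quadratic error of the block cost the remaining \<open>\<eta> / 2\<close>.\<close>

lemma prufer_phase_block_drift:
  assumes m: "m \<noteq> 0" and \<eta>: "\<eta> > 0"
  shows "\<exists>B>0. \<exists>k0>0. \<forall>V>0. V * real B / (2 * sin (label_angle m)) \<le> k0 \<longrightarrow> (\<forall>n.
     \<bar>prufer_phase (label_angle m) V (fib_g lam) (n + B) - prufer_phase (label_angle m) V (fib_g lam) n
      - V * real B / (2 * sin (label_angle m)) * drift m (lam - fib_alpha) (prufer_phase (label_angle m) V (fib_g lam) n)\<bar>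
     \<le> V * real B / (2 * sin (label_angle m)) * \<eta>)"
proof -
  define s G where "s = sin (label_angle m)" and "G = \<bar>lam\<bar> + 1"
  have s: "s > 0" using label_angle_bounds[OF m] by (simp add: s_def)
  have G: "G > 0" "G \<ge> 1" by (auto simp: G_def)
  define h where "h x = lam - indicator {1 - fib_alpha..<1} (frac x)" for x
  have top: "has_mean (\<lambda>x. indicator {1 - fib_alpha..<1} (frac x)) fib_alpha"
    using has_mean_top_arc[of "1 - fib_alpha"] fib_alpha_bounds by simp
  have mean_h: "has_mean h (lam - fib_alpha)"
    unfolding h_def by (intro has_mean_diff has_mean_const top)
  have "has_mean (\<lambda>x. of_real lam * char_e m x - of_real (indicator {1 - fib_alpha..<1} (frac x)) * char_e m x)
     (of_real lam * 0 - fib_mode m)"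
    by (intro has_mean_diff has_mean_linear[OF _ bounded_linear_mult_right] has_mean_char_e has_mean_fib_mode m)
  then have mean_he: "has_mean (\<lambda>x. of_real (h x) * char_e m x) (- fib_mode m)"
    by (simp add: h_def left_diff_distrib)
  have \<eta>4: "\<eta> / 4 > 0" using \<eta> by simp
  obtain B1 where B1: "B1 > 0" "\<And>K w. K \<ge> B1 \<Longrightarrow> norm (rot_avg h K w - (lam - fib_alpha)) < \<eta> / 4"
    by (rule has_meanD[OF mean_h \<eta>4]) blast
  obtain B2 where B2: "B2 > 0" "\<And>K w. K \<ge> B2 \<Longrightarrow> norm (rot_avg (\<lambda>x. of_real (h x) * char_e m x) K w - - fib_mode m) < \<eta> / 4"
    by (rule has_meanD[OF mean_he \<eta>4]) blast
  define B where "B = max B1 B2"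
  have B: "B > 0" using B1 by (simp add: B_def)
  \<comment> \<open>As \<open>real B * d = 2 * G * k\<close>, the first bound gives
    \<open>real B * d \<le> 1/8\<close>; the second makes the quadratic error
    \<open>40 * G\<^sup>2 * k\<^sup>2\<close> at most \<open>k * (\<eta> / 2)\<close>.\<close>
  define k0 where "k0 = min (1 / (16 * G)) (\<eta> / (80 * G\<^sup>2))"
  have k0: "k0 > 0" using G \<eta> by (simp add: k0_def)
  show ?thesis
  proof (intro exI[of _ B] exI[of _ k0] conjI allI impI B k0)
    fix V :: real and n assume V: "V > 0" and Vk: "V * real B / (2 * sin (label_angle m)) \<le> k0"
    define k where "k = V * real B / (2 * s)"
    have k: "k > 0" "k \<le> 1 / (16 * G)" "k \<le> \<eta> / (80 * G\<^sup>2)"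
      using Vk V s B by (auto simp: k_def k0_def s_def)
    define d where "d = V * G / s"
    have Bd: "real B * d = 2 * G * k" using s by (simp add: k_def d_def)
    have Bd8: "real B * d \<le> 1/8" using k(2) G unfolding Bd by (simp add: field_simps)
    have "d \<le> real B * d" using B V G s by (simp add: d_def divide_right_mono)
    then have d2: "d \<le> 1/2" using Bd8 by simp
    define ph where "ph = prufer_phase (label_angle m) V (fib_g lam) n"
    define S where "S = (\<Sum>j<B. fib_g lam (n + Suc j) *
       (1 - Re (cis (- (2 * ph)) * cis (- (2 * label_angle m * real (n + Suc j))))))"
    have blk: "\<bar>prufer_phase (label_angle m) V (fib_g lam) (n + B) - ph + V / (2 * s) * S\<bar> \<le> 10 * (real B * d)\<^sup>2"
      unfolding S_def ph_def s_def
      by (rule prufer_phase_block[of _ _ "fib_g lam" G d]) (use s V fib_g_bound d2 Bd8 in \<open>auto simp: s_def d_def G_def\<close>)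
    define a where "a = rot_avg h B (real (Suc n) * fib_alpha)"
    define b where "b = rot_avg (\<lambda>x. of_real (h x) * char_e m x) B (real (Suc n) * fib_alpha)"
    have pt: "real (Suc n) * fib_alpha + real j * fib_alpha = real (n + Suc j) * fib_alpha" for j
      by (simp add: algebra_simps)
    have ha: "(\<Sum>j<B. fib_g lam (n + Suc j)) = real B * a"
      unfolding a_def rot_avg_def pt using B by (simp add: h_def fib_g_def)
    have hb: "(\<Sum>j<B. of_real (fib_g lam (n + Suc j)) * char_e m (real (n + Suc j) * fib_alpha)) = of_real (real B) * b"
      unfolding b_def rot_avg_def pt using B by (simp add: h_def fib_g_def scaleR_conv_of_real)
    have "S = (\<Sum>j<B. fib_g lam (n + Suc j)) - Re (cis (- (2 * ph)) *
       (\<Sum>j<B. of_real (fib_g lam (n + Suc j)) * char_e m (real (n + Suc j) * fib_alpha)))"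
      unfolding S_def cis_label_angle sum_distrib_left Re_sum sum_subtractf[symmetric]
    proof (intro sum.cong refl)
      fix j
      have re: "Re (z * (of_real x * w)) = x * Re (z * w)" for z w :: complex and x :: real
        by (simp add: algebra_simps)
      show "fib_g lam (n + Suc j) * (1 - Re (cis (- (2 * ph)) * char_e m (real (n + Suc j) * fib_alpha)))
        = fib_g lam (n + Suc j) - Re (cis (- (2 * ph)) * (of_real (fib_g lam (n + Suc j)) * char_e m (real (n + Suc j) * fib_alpha)))"
        unfolding re by (simp only: right_diff_distrib mult_1_right)
    qed
    then have S: "S = real B * (a - Re (cis (- (2 * ph)) * b))"
      unfolding ha hb by (simp add: algebra_simps)
    have "\<bar>a - (lam - fib_alpha)\<bar> < \<eta> / 4" using B1(2)[of B] by (simp add: a_def B_def)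
    moreover have "\<bar>Re (cis (- (2 * ph)) * b) + Re (fib_mode m * cis (- (2 * ph)))\<bar> < \<eta> / 4"
    proof -
      have "\<bar>Re (cis (- (2 * ph)) * (b + fib_mode m))\<bar> \<le> norm (cis (- (2 * ph)) * (b + fib_mode m))"
        by (rule abs_Re_le_cmod)
      also have "\<dots> < \<eta> / 4" using B2(2)[of B] by (simp add: b_def B_def norm_mult)
      finally show ?thesis by (simp add: algebra_simps)
    qed
    ultimately have "\<bar>(a - Re (cis (- (2 * ph)) * b)) + drift m (lam - fib_alpha) ph\<bar> \<le> \<eta> / 2"
      unfolding drift_def by linarith
    then have "\<bar>k * ((a - Re (cis (- (2 * ph)) * b)) + drift m (lam - fib_alpha) ph)\<bar> \<le> k * (\<eta> / 2)"
      unfolding abs_mult using k(1) by simp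
    moreover have "V / (2 * s) * S = k * (a - Re (cis (- (2 * ph)) * b))" by (simp add: S k_def)
    moreover have "10 * (real B * d)\<^sup>2 \<le> k * (\<eta> / 2)"
    proof -
      have "10 * (real B * d)\<^sup>2 = k * (40 * G\<^sup>2 * k)" unfolding Bd by (simp add: power2_eq_square)
      also have "\<dots> \<le> k * (40 * G\<^sup>2 * (\<eta> / (80 * G\<^sup>2)))" using k G by (intro mult_left_mono) auto
      also have "\<dots> = k * (\<eta> / 2)" using G by simp
      finally show ?thesis .
    qed
    ultimately have "\<bar>prufer_phase (label_angle m) V (fib_g lam) (n + B) - ph - k * drift m (lam - fib_alpha) ph\<bar> \<le> k * \<eta>"
      using blk unfolding distrib_left by linarith
    then show "\<bar>prufer_phase (label_angle m) V (fib_g lam) (n + B) - prufer_phase (label_angle m) V (fib_g lam) n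
      - V * real B / (2 * sin (label_angle m)) * drift m (lam - fib_alpha) (prufer_phase (label_angle m) V (fib_g lam) n)\<bar>
     \<le> V * real B / (2 * sin (label_angle m)) * \<eta>"
      by (simp add: ph_def k_def s_def)
  qed
qed

lemma drift_lipschitz: "\<bar>drift m \<mu> x - drift m \<mu> y\<bar> \<le> 2 * norm (fib_mode m) * \<bar>x - y\<bar>"
proof -
  have "drift m \<mu> x - drift m \<mu> y = Re (fib_mode m * (cis (- (2 * y)) - cis (- (2 * x))))"
    by (simp add: drift_def algebra_simps)
  then have "\<bar>drift m \<mu> x - drift m \<mu> y\<bar> \<le> norm (fib_mode m) * norm (cis (- (2 * y)) - cis (- (2 * x)))"
    using abs_Re_le_cmod norm_mult by metis
  moreover have "norm (cis (- (2 * y)) - cis (- (2 * x))) \<le> 2 * \<bar>x - y\<bar>"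
  proof -
    have "cis (- (2 * y)) - cis (- (2 * x)) = cis (- (2 * x)) * (cis (2 * (x - y)) - 1)"
      by (simp add: right_diff_distrib cis_mult algebra_simps)
    then have "norm (cis (- (2 * y)) - cis (- (2 * x))) = norm (cis (2 * (x - y)) - 1)" by (simp add: norm_mult)
    also have "\<dots> \<le> \<bar>2 * (x - y)\<bar>"
      using dist_exp_i_1[of "2 * (x - y)"] abs_sin_x_le_abs_x[of "2 * (x - y) / 2"] by (simp only: cis_conv_exp)
    finally show ?thesis unfolding abs_mult by simp
  qed
  from mult_left_mono[OF this norm_ge_zero[of "fib_mode m"]]
  have "norm (fib_mode m) * norm (cis (- (2 * y)) - cis (- (2 * x))) \<le> 2 * norm (fib_mode m) * \<bar>x - y\<bar>"
    by (simp add: mult_ac)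
  ultimately show ?thesis by linarith
qed

lemma drift_bound: "- \<mu> - norm (fib_mode m) \<le> drift m \<mu> x" "drift m \<mu> x \<le> - \<mu> + norm (fib_mode m)"
  using abs_Re_le_cmod[of "fib_mode m * cis (- (2 * x))"] by (simp_all add: drift_def norm_mult)

text \<open>The phases of largest and of smallest velocity, repeated with period \<open>pi\<close>.
  If the two values have opposite signs, points of the first kind serve as lower barriers and points
  of the second kind as upper barriers.\<close>

lemma drift_extreme:
  "drift m \<mu> ((Arg (fib_mode m) + pi) / 2 + pi * of_int k) = - \<mu> + norm (fib_mode m)"
  "drift m \<mu> (Arg (fib_mode m) / 2 + pi * of_int k) = - \<mu> - norm (fib_mode m)"
proof -
  define a r where "a = Arg (fib_mode m)" and "r = norm (fib_mode m)"
  have c: "fib_mode m = of_real r * cis a"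
    unfolding a_def r_def by (metis Arg_zero cis_Arg mult_eq_0_iff norm_zero of_real_0 rcis_cmod_Arg rcis_def)
  have per: "cis (y + 2 * pi * of_int j) = cis y" for y j
    using cis_multiple_2pi[OF Ints_of_int[of j]] by (simp flip: cis_mult)
  have re: "Re (of_real r * (cis a * z)) = r * Re (cis a * z)" for z by (simp add: algebra_simps)
  have eq: "drift m \<mu> x = - \<mu> - r * Re (cis a * cis (- (2 * x)))" for x
    unfolding drift_def c mult.assoc re ..
  have "a + - (2 * ((a + pi) / 2 + pi * of_int k)) = - pi + 2 * pi * of_int (- k)" 
    by (simp add: field_simps)
  then have "cis a * cis (- (2 * ((a + pi) / 2 + pi * of_int k))) = cis (- pi)"
    unfolding cis_mult by (simp only: per)
  then show "drift m \<mu> ((Arg (fib_mode m) + pi) / 2 + pi * of_int k) = - \<mu> + norm (fib_mode m)"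
    unfolding eq a_def[symmetric] r_def[symmetric] by simp
  have "a + - (2 * (a / 2 + pi * of_int k)) = 0 + 2 * pi * of_int (- k)"
    by (simp add: field_simps)
  then have "cis a * cis (- (2 * (a / 2 + pi * of_int k))) = cis 0"
    unfolding cis_mult by (simp only: per)
  then show "drift m \<mu> (Arg (fib_mode m) / 2 + pi * of_int k) = - \<mu> - norm (fib_mode m)"
    unfolding eq a_def[symmetric] r_def[symmetric] by simp
qed

abbreviation fib_phase :: "int \<Rightarrow> real \<Rightarrow> real \<Rightarrow> nat \<Rightarrow> real" where
  "fib_phase m lam V \<equiv> prufer_phase (label_angle m) V (fib_g lam)"

lemma fib_phase_interpolate:
  assumes m: "m \<noteq> 0" and V: "V > 0" "V * (\<bar>lam\<bar> + 1) / sin (label_angle m) \<le> 1/2"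
  shows "\<bar>fib_phase m lam V n - fib_phase m lam V (B * (n div B))\<bar> \<le> real (n mod B)"
proof -
  define d where "d = V * (\<bar>lam\<bar> + 1) / sin (label_angle m)"
  have "\<bar>fib_phase m lam V (B * (n div B) + n mod B) - fib_phase m lam V (B * (n div B))\<bar> \<le> 2 * d * real (n mod B)"
    by (rule prufer_phase_steps[of _ _ "fib_g lam" "\<bar>lam\<bar> + 1" d])
       (use V label_angle_bounds[OF m] fib_g_bound in \<open>auto simp: d_def\<close>)
  also have "\<dots> \<le> 1 * real (n mod B)" using V(2)[folded d_def] by (intro mult_right_mono) auto
  finally show ?thesis by simp
qed

text \<open>At its extreme points the velocity has modulus at least \<open>2 * \<eta>\<close>, twice
  the error per unit of time, so \<open>barrier\<close> confines the phases at block ends from both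
  sides; inside a block the phase moves by at most one per site.\<close>

lemma fib_phase_bounded:
  assumes m: "m \<noteq> 0" and hyp: "\<bar>lam - fib_alpha\<bar> < norm (fib_mode m)"
  shows "\<exists>V0>0. \<forall>V. 0 < V \<and> V < V0 \<longrightarrow> (\<exists>M. \<forall>n. \<bar>fib_phase m lam V n\<bar> \<le> M)"
proof -
  define \<mu> r s where "\<mu> = lam - fib_alpha" and "r = norm (fib_mode m)" and "s = sin (label_angle m)"
  have s: "s > 0" using label_angle_bounds[OF m] by (simp add: s_def)
  define \<eta> where "\<eta> = (r - \<bar>\<mu>\<bar>) / 2"
  have \<eta>: "\<eta> > 0" using hyp by (simp add: \<eta>_def r_def \<mu>_def)
  have r: "r > 0" using norm_fib_mode[OF m] by (simp add: r_def)
  obtain B k0 where B: "B > 0" "k0 > 0" and blk: "\<And>V n. V > 0 \<Longrightarrow> V * real B / (2 * s) \<le> k0 \<Longrightarrow>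
     \<bar>fib_phase m lam V (n + B) - fib_phase m lam V n - V * real B / (2 * s) * drift m \<mu> (fib_phase m lam V n)\<bar>
     \<le> V * real B / (2 * s) * \<eta>"
    using prufer_phase_block_drift[OF m \<eta>, of lam] unfolding s_def \<mu>_def by metis
  define H where "H = \<bar>\<mu>\<bar> + r"
  \<comment> \<open>The second bound is the step size condition of \<open>barrier\<close>, with the
    Lipschitz constant \<open>2 * r\<close> of the drift.\<close>
  define k1 where "k1 = min k0 (\<eta> / ((H + \<eta>) * (2 * r)))"
  have Hp: "H + \<eta> > 0" using \<eta> r by (simp add: H_def)
  have k1: "k1 > 0" using B \<eta> r Hp by (simp add: k1_def)
  define V0 where "V0 = min (2 * s * k1 / real B) (s / (2 * (\<bar>lam\<bar> + 1)))"
  have V0: "V0 > 0" using s k1 B by (simp add: V0_def add_nonneg_pos)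
  have "\<exists>M. \<forall>n. \<bar>fib_phase m lam V n\<bar> \<le> M" if V: "0 < V" "V < V0" for V
  proof -
    define \<kappa> where "\<kappa> = V * real B / (2 * s)"
    have k: "\<kappa> > 0" "\<kappa> \<le> k1" using V B s by (auto simp: \<kappa>_def V0_def field_simps)
    have kk: "\<kappa> \<le> k0" "\<kappa> * (H + \<eta>) * (2 * r) \<le> \<eta>"
    proof -
      show "\<kappa> \<le> k0" using k by (simp add: k1_def)
      have "\<kappa> \<le> \<eta> / ((H + \<eta>) * (2 * r))" using k by (simp add: k1_def)
      then show "\<kappa> * (H + \<eta>) * (2 * r) \<le> \<eta>" using Hp r by (simp add: pos_le_divide_eq mult.assoc)
    qed
    have d: "V * (\<bar>lam\<bar> + 1) / sin (label_angle m) \<le> 1/2"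
      using V s by (simp add: V0_def s_def[symmetric] field_simps)
    define \<Phi> where "\<Phi> k = fib_phase m lam V (B * k)" for k
    have step: "\<bar>\<Phi> (Suc k) - \<Phi> k - \<kappa> * drift m \<mu> (\<Phi> k)\<bar> \<le> \<kappa> * \<eta>" for k
      using blk[of V "B * k"] V kk(1) by (simp add: \<Phi>_def \<kappa>_def add.commute)
    have \<Phi>0: "\<Phi> 0 = 0" by (simp add: \<Phi>_def prufer_phase_def)
    have H: "\<bar>drift m \<mu> x\<bar> \<le> H" for x
      using drift_bound[where m = m and \<mu> = \<mu> and x = x] by (auto simp: H_def r_def)
    \<comment> \<open>The barriers have to enclose the initial phase 0: a lower one is taken at or
      below it, an upper one at or above it.\<close>
    obtain i :: int where i: "(Arg (fib_mode m) + pi) / 2 + pi * of_int i \<le> 0"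
    proof -
      obtain i :: int where "of_int i < - ((Arg (fib_mode m) + pi) / 2) / pi" using ex_of_int_less by blast
      then show ?thesis by (intro that[of i]) (simp add: field_simps)
    qed
    obtain j :: int where j: "Arg (fib_mode m) / 2 + pi * of_int j \<ge> 0"
    proof -
      obtain j :: int where "of_int j > - (Arg (fib_mode m) / 2) / pi" using ex_less_of_int by blast
      then show ?thesis by (intro that[of j]) (simp add: field_simps)
    qed
    have lo: "\<Phi> k \<ge> (Arg (fib_mode m) + pi) / 2 + pi * of_int i" for k
    proof (rule barrier[where \<Phi> = \<Phi> and h = "drift m \<mu>", OF step drift_lipschitz H])
      show "2 * \<eta> \<le> drift m \<mu> ((Arg (fib_mode m) + pi) / 2 + pi * of_int i)"
        unfolding drift_extreme \<eta>_def r_def by simp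
    qed (use k kk i \<Phi>0 r in \<open>auto simp: r_def\<close>)
    \<comment> \<open>The upper barrier is the lower barrier of the reflected sequence.\<close>
    have hi: "- \<Phi> k \<ge> - (Arg (fib_mode m) / 2 + pi * of_int j)" for k
    proof (rule barrier[where \<Phi> = "\<lambda>k. - \<Phi> k" and h = "\<lambda>x. - drift m \<mu> (- x)"])
      show "\<bar>- \<Phi> (Suc k) - (- \<Phi> k) - \<kappa> * (- drift m \<mu> (- (- \<Phi> k)))\<bar> \<le> \<kappa> * \<eta>" for k
        using step[of k] unfolding minus_minus mult_minus_right by linarith
      show "\<bar>- drift m \<mu> (- x) - (- drift m \<mu> (- y))\<bar> \<le> 2 * norm (fib_mode m) * \<bar>x - y\<bar>" for x y
        using drift_lipschitz[of m \<mu> "- y" "- x"] by (simp add: abs_minus_commute)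
      show "\<bar>- drift m \<mu> (- x)\<bar> \<le> H" for x using H by simp
      show "2 * \<eta> \<le> - drift m \<mu> (- (- (Arg (fib_mode m) / 2 + pi * of_int j)))"
        unfolding minus_minus drift_extreme \<eta>_def r_def by simp
      show "- \<Phi> 0 \<ge> - (Arg (fib_mode m) / 2 + pi * of_int j)" using j \<Phi>0 by linarith
      show "\<kappa> * (H + \<eta>) * (2 * norm (fib_mode m)) \<le> \<eta>" using kk(2) by (simp add: r_def)
    qed (use k(1) r in \<open>auto simp: r_def\<close>)
    show ?thesis
    proof (intro exI allI)
      fix n
      have "\<bar>\<Phi> (n div B)\<bar> \<le> \<bar>(Arg (fib_mode m) + pi) / 2 + pi * of_int i\<bar> + \<bar>Arg (fib_mode m) / 2 + pi * of_int j\<bar>"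
        using lo[of "n div B"] hi[of "n div B"] by linarith
      moreover have "\<bar>fib_phase m lam V n - \<Phi> (n div B)\<bar> \<le> real (n mod B)"
        unfolding \<Phi>_def by (rule fib_phase_interpolate[OF m V(1) d])
      moreover have "real (n mod B) \<le> real B" using B by (simp add: less_imp_le)
      ultimately show "\<bar>fib_phase m lam V n\<bar> \<le> real B + (\<bar>(Arg (fib_mode m) + pi) / 2 + pi * of_int i\<bar> + \<bar>Arg (fib_mode m) / 2 + pi * of_int j\<bar>)"
        by linarith
    qed
  qed
  then show ?thesis using V0 by blast
qed

text \<open>Here the velocity in direction \<open>\<sigma>\<close> is at most
  \<open>- (2 * \<eta>)\<close> at every phase, while a block errs by \<open>\<eta>\<close> per unit
  of time, so every block pushes the phase against \<open>\<sigma>\<close> by at least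
  \<open>\<kappa> * \<eta>\<close>.\<close>

lemma fib_phase_drifts:
  assumes m: "m \<noteq> 0" and sg: "\<sigma> = 1 \<or> \<sigma> = - 1"
    and ell: "\<sigma> * (lam - fib_alpha) > norm (fib_mode m)"
  shows "\<exists>V0>0. \<forall>V. 0 < V \<and> V < V0 \<longrightarrow> (\<exists>\<epsilon>>0. \<exists>C. \<forall>n. \<sigma> * fib_phase m lam V n \<le> C - \<epsilon> * real n)"
proof -
  define \<mu> r s where "\<mu> = lam - fib_alpha" and "r = norm (fib_mode m)" and "s = sin (label_angle m)"
  have s: "s > 0" using label_angle_bounds[OF m] by (simp add: s_def)
  define \<eta> where "\<eta> = (\<sigma> * \<mu> - r) / 2"
  have \<eta>: "\<eta> > 0" using ell by (simp add: \<eta>_def r_def \<mu>_def)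
  obtain B k0 where B: "B > 0" "k0 > 0" and blk: "\<And>V n. V > 0 \<Longrightarrow> V * real B / (2 * s) \<le> k0 \<Longrightarrow>
     \<bar>fib_phase m lam V (n + B) - fib_phase m lam V n - V * real B / (2 * s) * drift m \<mu> (fib_phase m lam V n)\<bar>
     \<le> V * real B / (2 * s) * \<eta>"
    using prufer_phase_block_drift[OF m \<eta>, of lam] unfolding s_def \<mu>_def by metis
  define V0 where "V0 = min (2 * s * k0 / real B) (s / (2 * (\<bar>lam\<bar> + 1)))"
  have V0: "V0 > 0" using s B by (simp add: V0_def add_nonneg_pos)
  have "\<exists>\<epsilon>>0. \<exists>C. \<forall>n. \<sigma> * fib_phase m lam V n \<le> C - \<epsilon> * real n" if V: "0 < V" "V < V0" for V
  proof -
    define \<kappa> where "\<kappa> = V * real B / (2 * s)"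
    have k: "\<kappa> > 0" "\<kappa> \<le> k0" using V B s by (auto simp: \<kappa>_def V0_def field_simps)
    have d: "V * (\<bar>lam\<bar> + 1) / sin (label_angle m) \<le> 1/2"
      using V s by (simp add: V0_def s_def[symmetric] field_simps)
    define \<Phi> where "\<Phi> k = fib_phase m lam V (B * k)" for k
    have step: "\<sigma> * \<Phi> (Suc k) \<le> \<sigma> * \<Phi> k - \<kappa> * \<eta>" for k
    proof -
      have "\<bar>\<Phi> (Suc k) - \<Phi> k - \<kappa> * drift m \<mu> (\<Phi> k)\<bar> \<le> \<kappa> * \<eta>"
        using blk[of V "B * k"] V k(2) by (simp add: \<Phi>_def \<kappa>_def add.commute)
      then have "\<sigma> * \<Phi> (Suc k) \<le> \<sigma> * \<Phi> k + \<kappa> * (\<sigma> * drift m \<mu> (\<Phi> k)) + \<kappa> * \<eta>"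
        using sg by auto
      moreover have "\<sigma> * drift m \<mu> (\<Phi> k) \<le> - (2 * \<eta>)"
        using sg drift_bound[where m = m and \<mu> = \<mu> and x = "\<Phi> k"] by (auto simp: \<eta>_def r_def field_simps)
      then have "\<kappa> * (\<sigma> * drift m \<mu> (\<Phi> k)) \<le> - (2 * (\<kappa> * \<eta>))"
        using mult_left_mono[of _ _ \<kappa>] k(1) by fastforce
      ultimately show ?thesis by linarith
    qed
    have it: "\<sigma> * \<Phi> k \<le> - (\<kappa> * \<eta> * real k)" for k
    proof (induction k)
      case 0 then show ?case by (simp add: \<Phi>_def prufer_phase_def)
    next
      case (Suc k) then show ?case using step[of k] by (simp add: algebra_simps)
    qed
    show ?thesis
    proof (rule exI[of _ "\<kappa> * \<eta> / real B"], rule conjI, rule_tac [2] exI[of _ "real B + \<kappa> * \<eta>"], rule_tac [2] allI)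
      show "0 < \<kappa> * \<eta> / real B" using k \<eta> B by simp
      fix n
      have "\<bar>fib_phase m lam V n - \<Phi> (n div B)\<bar> \<le> real (n mod B)"
        unfolding \<Phi>_def by (rule fib_phase_interpolate[OF m V(1) d])
      moreover have "real (n mod B) \<le> real B" using B by (simp add: less_imp_le)
      ultimately have 1: "\<sigma> * fib_phase m lam V n \<le> real B + \<sigma> * \<Phi> (n div B)"
        using sg by auto
      have "real n = real (n div B) * real B + real (n mod B)"
        by (metis div_mult_mod_eq of_nat_add of_nat_mult)
      then have "real n / real B \<le> real (n div B) + 1"
        using B \<open>real (n mod B) \<le> real B\<close> by (simp add: field_simps)
      then have "\<kappa> * \<eta> * (real n / real B) \<le> \<kappa> * \<eta> * (real (n div B) + 1)"
        using k \<eta> by (intro mult_left_mono) auto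
      then show "\<sigma> * fib_phase m lam V n \<le> real B + \<kappa> * \<eta> - \<kappa> * \<eta> / real B * real n"
        using 1 it[of "n div B"] by (simp add: algebra_simps)
    qed
  qed
  then show ?thesis using V0 by blast
qed

section \<open>Jacobi matrices on finite boxes\<close>

text \<open>The characteristic polynomials of the Jacobi matrices on \<open>{1..n}\<close>. Their
  values at \<open>E\<close> also form the solution of the difference equation with
  \<open>u 0 = 0\<close> and \<open>u 1 = 1\<close>, shifted by one site; both readings are
  used.\<close>

fun jacobi_poly :: "(nat \<Rightarrow> real) \<Rightarrow> nat \<Rightarrow> real poly" where
  "jacobi_poly v 0 = 1"
| "jacobi_poly v (Suc 0) = [:- v 1, 1:]"
| "jacobi_poly v (Suc (Suc n)) = [:- v (Suc (Suc n)), 1:] * jacobi_poly v (Suc n) - jacobi_poly v n"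

lemma jacobi_poly_monic: "degree (jacobi_poly v n) = n \<and> lead_coeff (jacobi_poly v n) = 1"
proof (induction v n rule: jacobi_poly.induct)
  case (3 v n)
  define q where "q = [:- v (Suc (Suc n)), 1:] * jacobi_poly v (Suc n)"
  have nz: "jacobi_poly v (Suc n) \<noteq> 0" using 3 by auto
  have dq: "degree q = Suc (Suc n)" "lead_coeff q = 1"
  proof -
    have a: "degree (jacobi_poly v (Suc n)) = Suc n" "lead_coeff (jacobi_poly v (Suc n)) = 1" using 3(1) by blast+
    show "lead_coeff q = 1" unfolding q_def lead_coeff_mult a(2) by simp
    show "degree q = Suc (Suc n)" unfolding q_def using nz a(1) by (subst degree_mult_eq) auto
  qed
  have a: "degree (jacobi_poly v n) = n" using 3(2) by blast
  have "degree (q - jacobi_poly v n) = Suc (Suc n)" "lead_coeff (q - jacobi_poly v n) = 1"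
    using a dq degree_add_eq_left[of "- jacobi_poly v n" q] by (simp_all add: coeff_eq_0 del: jacobi_poly.simps)
  then show ?case by (simp add: q_def del: mult_pCons_left)
qed auto

lemma prod_linear_dvd:
  fixes p :: "'a::field poly"
  assumes "finite S" "\<And>x. x \<in> S \<Longrightarrow> poly p x = 0"
  shows "(\<Prod>x\<in>S. [:- x, 1:]) dvd p"
  using assms
proof (induction S)
  case (insert x S)
  then obtain q where q: "p = (\<Prod>x\<in>S. [:- x, 1:]) * q" by (auto elim: dvdE)
  have "poly (\<Prod>x\<in>S. [:- x, 1:]) x \<noteq> 0" using insert by (auto simp: poly_prod)
  moreover have "poly p x = 0" using insert by simp
  ultimately have "[:- x, 1:] dvd q" by (simp add: q poly_eq_0_iff_dvd[symmetric])
  then have "[:- x, 1:] * (\<Prod>x\<in>S. [:- x, 1:]) dvd q * (\<Prod>x\<in>S. [:- x, 1:])" by (rule mult_dvd_mono) simp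
  then show ?case using insert(1,2) unfolding q by (simp add: mult.commute del: mult_pCons_left mult_pCons_right)
qed simp

lemma degree_prod_linear: "finite S \<Longrightarrow> degree (\<Prod>x\<in>S. [:- f x, 1:: 'a::field:]) = card S"
  by (subst degree_prod_eq_sum_degree) auto

lemma monic_prod_linear: "lead_coeff (\<Prod>x\<in>S. [:- f x, 1:: 'a::field:]) = 1"
  by (simp add: lead_coeff_prod)

lemma monic_eq_prod_linear:
  fixes p :: "'a::field poly"
  assumes "finite S" "\<And>x. x \<in> S \<Longrightarrow> poly p x = 0" "degree p = card S" "lead_coeff p = 1"
  shows "p = (\<Prod>x\<in>S. [:- x, 1:])"
proof -
  obtain q where q: "p = (\<Prod>x\<in>S. [:- x, 1:]) * q" using prod_linear_dvd[OF assms(1,2)] by (metis dvdE)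
  have p0: "p \<noteq> 0" using assms(4) by auto
  then have q0: "q \<noteq> 0" "(\<Prod>x\<in>S. [:- x, 1:]) \<noteq> 0" using q by auto
  have "degree p = card S + degree q" using q q0 degree_prod_linear[OF assms(1), of "\<lambda>x. x"] by (simp add: degree_mult_eq)
  then have "degree q = 0" using assms(3) by simp
  then obtain a where a: "q = [:a:]" using degree_eq_zeroE by blast
  have "lead_coeff p = lead_coeff (\<Prod>x\<in>S. [:- x, 1:]) * lead_coeff q" unfolding q by (rule lead_coeff_mult)
  then have "a = 1" using assms(4) monic_prod_linear[of "\<lambda>x. x" S] a by simp
  then have "q = 1" using a by (simp add: one_pCons)
  then show ?thesis using q by simp
qed

lemma sign_prod:
  fixes f :: "nat \<Rightarrow> real"
  assumes "i \<le> n" "\<And>j. j < i \<Longrightarrow> 0 < f j" "\<And>j. i \<le> j \<Longrightarrow> j < n \<Longrightarrow> f j < 0"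
  shows "0 < (- 1) ^ (n - i) * (\<Prod>j<n. f j)"
  using assms
proof (induction n)
  case (Suc n)
  show ?case
  proof (cases "i = Suc n")
    case True
    have "0 < (\<Prod>j<Suc n. f j)" by (rule prod_pos) (use Suc.prems(2) True in auto)
    then show ?thesis using True by simp
  next
    case False
    then have "0 < (- 1) ^ (n - i) * (\<Prod>j<n. f j)" and fn: "f n < 0" using Suc by auto
    then have "0 < ((- 1) ^ (n - i) * (\<Prod>j<n. f j)) * (- f n)" using mult_pos_pos[of "(- 1) ^ (n - i) * (\<Prod>j<n. f j)" "- f n"] fn by simp
    moreover have "Suc n - i = Suc (n - i)" using False Suc.prems by simp
    ultimately show ?thesis by (simp add: mult_ac)
  qed
qed simp

definition interlaces :: "nat \<Rightarrow> (nat \<Rightarrow> real) \<Rightarrow> (nat \<Rightarrow> real) \<Rightarrow> bool" where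
  "interlaces n r s \<longleftrightarrow> (\<forall>i<n. s i < r i \<and> r i < s (Suc i))"

lemma interlaces_mono:
  assumes "interlaces n r s" shows "i < j \<Longrightarrow> j \<le> n \<Longrightarrow> s i < s j"
proof (induction j)
  case (Suc j)
  have "s j < s (Suc j)" using assms Suc.prems less_trans[of "s j" "r j" "s (Suc j)"] by (auto simp: interlaces_def)
  then show ?case using Suc by (cases "i = j") auto
qed simp

lemma interlaces_less: assumes "interlaces n r s" "i \<le> j" "j < n" shows "s i < r j"
  using assms interlaces_mono[OF assms(1), of i j] by (cases "i = j") (force simp: interlaces_def)+

lemma interlaces_greater: assumes "interlaces n r s" "j < i" "i \<le> n" shows "r j < s i"
proof -
  have 1: "r j < s (Suc j)" using assms by (simp add: interlaces_def)
  show ?thesis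
  proof (cases "i = Suc j")
    case False
    then have "s (Suc j) < s i" using interlaces_mono[OF assms(1), of "Suc j" i] assms by simp
    with 1 show ?thesis by simp
  qed (use 1 in simp)
qed

text \<open>At a root of the middle polynomial the recurrence reduces to minus the lower polynomial,
  whose sign there is read off the interlacing.\<close>

lemma jacobi_poly_step_sign:
  assumes r: "jacobi_poly v n = (\<Prod>i<n. [:- r i, 1:])" and s: "jacobi_poly v (Suc n) = (\<Prod>i<Suc n. [:- s i, 1:])"
    and il: "interlaces n r s" and i: "i \<le> n"
  shows "(- 1) ^ (n - i) * poly (jacobi_poly v (Suc (Suc n))) (s i) < 0"
proof -
  have z: "poly (jacobi_poly v (Suc n)) (s i) = 0" unfolding s poly_prod using i by (intro prod_zero) auto
  have "poly (jacobi_poly v (Suc (Suc n))) (s i) = (s i - v (Suc (Suc n))) * poly (jacobi_poly v (Suc n)) (s i) - poly (jacobi_poly v n) (s i)"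
    by (simp add: algebra_simps)
  then have eq: "poly (jacobi_poly v (Suc (Suc n))) (s i) = - poly (jacobi_poly v n) (s i)" unfolding z by simp
  have "0 < (- 1) ^ (n - i) * (\<Prod>j<n. s i - r j)"
    by (rule sign_prod) (use i interlaces_less[OF il] interlaces_greater[OF il] in auto)
  then have "0 < (- 1) ^ (n - i) * poly (jacobi_poly v n) (s i)" unfolding r poly_prod by simp
  then show ?thesis unfolding eq by simp
qed

text \<open>The roots above \<open>s 0\<close> come from sign changes; the lowest one is the zero of the remaining linear
  factor, whose position is read off the sign at \<open>s 0\<close>.\<close>

lemma jacobi_poly_step:
  assumes r: "jacobi_poly v n = (\<Prod>i<n. [:- r i, 1:])" and s: "jacobi_poly v (Suc n) = (\<Prod>i<Suc n. [:- s i, 1:])"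
    and il: "interlaces n r s"
  shows "\<exists>t. jacobi_poly v (Suc (Suc n)) = (\<Prod>i<Suc (Suc n). [:- t i, 1:]) \<and> interlaces (Suc n) s t"
proof -
  define P where "P = jacobi_poly v (Suc (Suc n))"
  have P: "degree P = Suc (Suc n)" "lead_coeff P = 1" using jacobi_poly_monic[of v "Suc (Suc n)"] by (auto simp: P_def)
  have sg: "(- 1) ^ (n - i) * poly P (s i) < 0" if "i \<le> n" for i
    using jacobi_poly_step_sign[OF r s il that] by (simp only: P_def)
  have mid: "\<exists>x. s i < x \<and> x < s (Suc i) \<and> poly P x = 0" if "i < n" for i
  proof -
    have "s i < s (Suc i)" using interlaces_mono[OF il] that by simp
    moreover have "poly P (s i) * poly P (s (Suc i)) < 0"
    proof -
      have "n - i = Suc (n - Suc i)" using that by simp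
      then have "0 < (- 1) ^ (n - Suc i) * poly P (s i)" using sg[of i] that by simp
      moreover have "(- 1) ^ (n - Suc i) * poly P (s (Suc i)) < 0" using sg[of "Suc i"] that by simp
      ultimately have "((- 1) ^ (n - Suc i) * poly P (s i)) * ((- 1) ^ (n - Suc i) * poly P (s (Suc i))) < 0"
        by (rule mult_pos_neg)
      moreover have "((- 1) ^ (n - Suc i) * poly P (s i)) * ((- 1) ^ (n - Suc i) * poly P (s (Suc i)))
         = ((- 1) ^ (n - Suc i) * (- 1) ^ (n - Suc i)) * (poly P (s i) * poly P (s (Suc i)))" by (simp only: mult_ac)
      ultimately show ?thesis by (simp flip: power_mult_distrib)
    qed
    ultimately show ?thesis using poly_IVT[of "s i" "s (Suc i)" P] by blast
  qed
  have top: "\<exists>x. s n < x \<and> poly P x = 0"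
  proof -
    have neg: "poly P (s n) < 0" using sg[of n] by simp
    have "eventually (\<lambda>x. poly P x \<ge> lead_coeff P) at_top"
      using poly_pinfty_gt_lc[of P] P(2) unfolding eventually_at_top_linorder by simp
    then obtain b where b: "\<And>x. x \<ge> b \<Longrightarrow> poly P x \<ge> 1" using P(2) unfolding eventually_at_top_linorder by auto
    define c where "c = max b (s n + 1)"
    have "poly P c > 0" using b[of c] by (simp add: c_def)
    moreover have "s n < c" by (simp add: c_def)
    ultimately show ?thesis using poly_IVT_pos[of "s n" c P] neg by blast
  qed
  have "\<forall>i. \<exists>x. i \<le> n \<longrightarrow> s i < x \<and> (i < n \<longrightarrow> x < s (Suc i)) \<and> poly P x = 0"
    using mid top by (metis le_neq_implies_less less_irrefl)
  from choice[OF this] obtain y where y: "\<And>i. i \<le> n \<Longrightarrow> s i < y i \<and> (i < n \<longrightarrow> y i < s (Suc i)) \<and> poly P (y i) = 0"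
    by blast
  have ymono: "y i < y j" if "i < j" "j \<le> n" for i j
  proof -
    have "y i < s (Suc i)" using y[of i] that by simp
    also have "s (Suc i) \<le> s j" using interlaces_mono[OF il, of "Suc i" j] that by (cases "Suc i = j") auto
    also have "s j < y j" using y[of j] that by simp
    finally show ?thesis .
  qed
  then have inj: "inj_on y {..n}" by (intro inj_onI) (metis atMost_iff less_irrefl linorder_neqE_nat)
  \<comment> \<open>\<open>Q\<close> collects the \<open>Suc n\<close> roots found so far; the
    cofactor is then monic of degree one.\<close>
  define Q where "Q = (\<Prod>x\<in>y ` {..n}. [:- x, 1:])"
  have Qy: "Q = (\<Prod>i\<le>n. [:- y i, 1:])" unfolding Q_def by (simp add: prod.reindex[OF inj])
  have "Q dvd P" unfolding Q_def by (rule prod_linear_dvd) (use y in auto)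
  then obtain q where q: "P = Q * q" by (auto elim: dvdE)
  have Q: "degree Q = Suc n" "lead_coeff Q = 1" unfolding Qy
    using degree_prod_linear[of "{..n}" y] monic_prod_linear[of y "{..n}"] by simp_all
  have "P \<noteq> 0" using P by auto
  then have "degree P = degree Q + degree q" using q degree_mult_eq[of Q q] by auto
  then have dq: "degree q = 1" using P Q by simp
  have lq: "lead_coeff q = 1" using P(2) Q(2) unfolding q lead_coeff_mult by simp
  define t0 where "t0 = - coeff q 0"
  have qt: "q = [:- t0, 1:]"
    using dq lq by (intro poly_eqI) (auto simp: t0_def coeff_pCons coeff_eq_0 split: nat.splits)
  define t where "t i = (case i of 0 \<Rightarrow> t0 | Suc j \<Rightarrow> y j)" for i
  have Pt: "P = (\<Prod>i<Suc (Suc n). [:- t i, 1:])"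
    unfolding q Qy qt by (subst prod.lessThan_Suc_shift) (simp add: t_def lessThan_Suc_atMost mult.commute del: mult_pCons_left mult_pCons_right)
  have t0: "t0 < s 0"
  proof -
    have Qs: "0 < (- 1) ^ (Suc n - 0) * (\<Prod>i<Suc n. s 0 - y i)"
    proof (rule sign_prod)
      fix j assume "j < Suc n"
      then have "s 0 \<le> s j" "s j < y j" using interlaces_mono[OF il, of 0 j] y[of j] by (cases "j = 0"; simp)+
      then show "s 0 - y j < 0" by simp
    qed auto
    have "poly P (s 0) = (\<Prod>i<Suc n. s 0 - y i) * (s 0 - t0)"
      unfolding q Qy qt by (simp add: poly_prod lessThan_Suc_atMost del: mult_pCons_left mult_pCons_right)
    then have "(- 1) ^ n * ((\<Prod>i<Suc n. s 0 - y i) * (s 0 - t0)) < 0" using sg[of 0] by (simp del: prod.lessThan_Suc)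
    then have "0 < ((- 1) ^ (Suc n - 0) * (\<Prod>i<Suc n. s 0 - y i)) * (s 0 - t0)"
      by (simp add: mult.assoc del: prod.lessThan_Suc)
    then have "0 < s 0 - t0" using Qs zero_less_mult_pos by blast
    then show ?thesis by simp
  qed
  have "interlaces (Suc n) s t"
    unfolding interlaces_def using t0 y by (auto simp: t_def split: nat.splits)
  then show ?thesis using Pt unfolding P_def by (intro exI[of _ t] conjI)
qed

lemma jacobi_poly_roots:
  "\<exists>r s. jacobi_poly v n = (\<Prod>i<n. [:- r i, 1:]) \<and> jacobi_poly v (Suc n) = (\<Prod>i<Suc n. [:- s i, 1:]) \<and> interlaces n r s"
proof (induction n)
  case 0
  show ?case by (rule exI, rule exI[of _ "\<lambda>_. v 1"]) (simp add: interlaces_def)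
next
  case (Suc n) then show ?case using jacobi_poly_step by blast
qed

section \<open>Eigenvectors of a box and the eigenvalue count\<close>

lemma sum_shift_vanish:
  fixes f g :: "int \<Rightarrow> real"
  assumes "f (b + 1) = 0" "g (a - 1) = 0"
  shows "(\<Sum>k\<in>{a..b}. f (k + 1) * g k) = (\<Sum>k\<in>{a..b}. f k * g (k - 1))"
proof -
  have "(\<Sum>k\<in>{a..b}. f (k + 1) * g k) = (\<Sum>k\<in>{a + 1..b + 1}. f k * g (k - 1))"
    by (rule sum.reindex_bij_witness[of _ "\<lambda>k. k - 1" "\<lambda>k. k + 1"]) auto
  also have "\<dots> = (\<Sum>k\<in>{a..b + 1}. f k * g (k - 1))"
    by (rule sum.mono_neutral_left) (use assms(2) in \<open>auto simp: not_le\<close>)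
  also have "\<dots> = (\<Sum>k\<in>{a..b}. f k * g (k - 1))"
  proof (rule sum.mono_neutral_right)
    show "\<forall>k\<in>{a..b + 1} - {a..b}. f k * g (k - 1) = 0"
    proof
      fix k assume "k \<in> {a..b + 1} - {a..b}"
      then have "k = b + 1" by auto
      then show "f k * g (k - 1) = 0" using assms(1) by simp
    qed
  qed auto
  finally show ?thesis .
qed

lemma jacobi_symmetric:
  fixes f g :: "int \<Rightarrow> real"
  assumes "f (a - 1) = 0" "f (b + 1) = 0" "g (a - 1) = 0" "g (b + 1) = 0"
  shows "(\<Sum>k\<in>{a..b}. (f (k + 1) + f (k - 1) + v k * f k) * g k) = (\<Sum>k\<in>{a..b}. f k * (g (k + 1) + g (k - 1) + v k * g k))"
proof -
  have "(\<Sum>k\<in>{a..b}. f (k + 1) * g k) = (\<Sum>k\<in>{a..b}. f k * g (k - 1))"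
    "(\<Sum>k\<in>{a..b}. g (k + 1) * f k) = (\<Sum>k\<in>{a..b}. g k * f (k - 1))"
    using assms by (auto intro: sum_shift_vanish)
  then show ?thesis by (simp add: algebra_simps sum.distrib)
qed

text \<open>A one-sided inverse of a square matrix is two-sided; this turns orthonormality of the
  eigenvectors into completeness.\<close>

lemma orthonormal_rows_imp_columns:
  fixes e :: "nat \<Rightarrow> nat \<Rightarrow> real"
  assumes "\<And>i j. i < n \<Longrightarrow> j < n \<Longrightarrow> (\<Sum>k<n. e i k * e j k) = (if i = j then 1 else 0)"
    and "k < n" "l < n"
  shows "(\<Sum>i<n. e i k * e i l) = (if k = l then 1 else 0)"
proof -
  define A where "A = Matrix.mat n n (\<lambda>(i, j). e i j)"
  have A: "A \<in> carrier_mat n n" "transpose_mat A \<in> carrier_mat n n" by (auto simp: A_def)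
  have "A * transpose_mat A = 1\<^sub>m n"
    by (rule eq_matI) (auto simp: A_def scalar_prod_def assms(1) lessThan_atLeast0[symmetric])
  then have "transpose_mat A * A = 1\<^sub>m n" by (rule mat_mult_left_right_inverse[OF A])
  then have "(transpose_mat A * A) $$ (k, l) = (1\<^sub>m n) $$ (k, l)" by simp
  then show ?thesis using assms(2,3) by (auto simp: A_def scalar_prod_def lessThan_atLeast0[symmetric])
qed

text \<open>Eigenvectors are stored as functions on \<open>int\<close> vanishing outside the box \<open>{1..n}\<close>, so that
  Dirichlet boundary conditions are built into the three-term recurrence.\<close>

definition box_spectral :: "(int \<Rightarrow> real) \<Rightarrow> nat \<Rightarrow> (nat \<Rightarrow> real) \<Rightarrow> (nat \<Rightarrow> int \<Rightarrow> real) \<Rightarrow> bool" where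
  "box_spectral v n r e \<longleftrightarrow> inj_on r {..<n} \<and>
     (\<forall>i<n. \<forall>k. k \<notin> {1..int n} \<longrightarrow> e i k = 0) \<and>
     (\<forall>i<n. \<forall>k\<in>{1..int n}. e i (k + 1) + e i (k - 1) + v k * e i k = r i * e i k) \<and>
     (\<forall>i<n. \<forall>j<n. (\<Sum>k\<in>{1..int n}. e i k * e j k) = (if i = j then 1 else 0)) \<and>
     (\<forall>k\<in>{1..int n}. \<forall>l\<in>{1..int n}. (\<Sum>i<n. e i k * e i l) = (if k = l then 1 else 0))"

lemma sum_int_box: "(\<Sum>k\<in>{1..int n}. f k) = (\<Sum>k<n. f (int k + 1))"
  by (rule sum.reindex_bij_witness[of _ "\<lambda>k. int k + 1" "\<lambda>k. nat (k - 1)"]) auto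

text \<open>At the root \<open>r i\<close> the eigenvector has the value of the polynomial of degree
  \<open>k - 1\<close> at site \<open>k\<close>; the root condition is the boundary condition at
  \<open>n + 1\<close>, and the value 1 at site 1 makes the vector nonzero. Distinct eigenvalues
  give orthogonality.\<close>

lemma box_spectral_exists:
  fixes v :: "int \<Rightarrow> real"
  assumes "jacobi_poly (\<lambda>k. v (int k)) n = (\<Prod>i<n. [:- r i, 1:])" and inj: "inj_on r {..<n}"
  shows "\<exists>e. box_spectral v n r e"
proof -
  define q where "q = jacobi_poly (\<lambda>k. v (int k))"
  have rt: "poly (q n) (r i) = 0" if "i < n" for i
    unfolding q_def assms(1) poly_prod using that by (intro prod_zero) auto
  define u where "u i k = (if k \<in> {1..int n} then poly (q (nat (k - 1))) (r i) else 0)" for i k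
  have u0: "u i k = 0" if "k \<notin> {1..int n}" for i k using that by (auto simp: u_def)
  have ueq: "u i (k + 1) + u i (k - 1) + v k * u i k = r i * u i k" if i: "i < n" and k: "k \<in> {1..int n}" for i k
  proof -
    obtain j where j: "k = int (Suc j)" "j < n" using k by (intro that[of "nat (k - 1)"]) auto
    have 1: "u i (k + 1) = poly (q (Suc j)) (r i)"
    proof (cases "Suc j = n")
      case True then show ?thesis using rt[OF i] j by (simp add: u_def)
    next
      case False then show ?thesis using j by (simp add: u_def nat_add_distrib)
    qed
    have 2: "u i k = poly (q j) (r i)" using j by (simp add: u_def)
    have 3: "u i (k - 1) = (if j = 0 then 0 else poly (q (j - 1)) (r i))"
      using j by (cases j) (auto simp: u_def)
    show ?thesis
    proof (cases j)
      case 0 then show ?thesis unfolding 1 2 3 by (simp add: q_def j)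
    next
      case (Suc l) then show ?thesis unfolding 1 2 3 by (simp add: q_def j algebra_simps)
    qed
  qed
  have orth: "(\<Sum>k\<in>{1..int n}. u i k * u j k) = 0" if "i < n" "j < n" "i \<noteq> j" for i j
  proof -
    have "(\<Sum>k\<in>{1..int n}. (u i (k + 1) + u i (k - 1) + v k * u i k) * u j k)
        = (\<Sum>k\<in>{1..int n}. u i k * (u j (k + 1) + u j (k - 1) + v k * u j k))"
      by (rule jacobi_symmetric) (auto intro: u0)
    also have "(\<Sum>k\<in>{1..int n}. (u i (k + 1) + u i (k - 1) + v k * u i k) * u j k) = r i * (\<Sum>k\<in>{1..int n}. u i k * u j k)"
      unfolding sum_distrib_left using ueq that by (intro sum.cong) auto
    also have "(\<Sum>k\<in>{1..int n}. u i k * (u j (k + 1) + u j (k - 1) + v k * u j k)) = r j * (\<Sum>k\<in>{1..int n}. u i k * u j k)"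
      unfolding sum_distrib_left using ueq that by (intro sum.cong) auto
    finally show ?thesis using inj that by (auto simp: inj_on_def)
  qed
  define N where "N i = sqrt (\<Sum>k\<in>{1..int n}. (u i k)\<^sup>2)" for i
  have N: "N i > 0" if "i < n" for i
  proof -
    have "u i 1 = 1" using that by (auto simp: u_def q_def)
    then have "0 < (\<Sum>k\<in>{1..int n}. (u i k)\<^sup>2)" using that by (intro sum_pos2[of _ 1]) auto
    then show ?thesis by (simp add: N_def)
  qed
  define e where "e i k = u i k / N i" for i k
  have on: "(\<Sum>k\<in>{1..int n}. e i k * e j k) = (if i = j then 1 else 0)" if "i < n" "j < n" for i j
  proof -
    have "(\<Sum>k\<in>{1..int n}. e i k * e j k) = (\<Sum>k\<in>{1..int n}. u i k * u j k) / (N i * N j)"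
      by (simp add: e_def sum_divide_distrib)
    also have "\<dots> = (if i = j then 1 else 0)"
    proof (cases "i = j")
      case True
      have "(\<Sum>k\<in>{1..int n}. u i k * u i k) = N i * N i"
        unfolding N_def by (simp add: power2_eq_square sum_nonneg)
      then show ?thesis using True N[OF that(1)] by simp
    qed (use orth that in auto)
    finally show ?thesis .
  qed
  have cols: "(\<Sum>i<n. e i k * e i l) = (if k = l then 1 else 0)" if "k \<in> {1..int n}" "l \<in> {1..int n}" for k l
  proof -
    have "(\<Sum>i<n. e i (int (nat (k - 1)) + 1) * e i (int (nat (l - 1)) + 1)) = (if nat (k - 1) = nat (l - 1) then 1 else 0)"
      by (rule orthonormal_rows_imp_columns[of n "\<lambda>i k. e i (int k + 1)"])
         (use on that in \<open>auto simp: sum_int_box\<close>)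
    then show ?thesis using that by (auto simp: nat_eq_iff split: if_splits)
  qed
  have eeq: "e i (k + 1) + e i (k - 1) + v k * e i k = r i * e i k" if "i < n" "k \<in> {1..int n}" for i k
    using ueq[OF that] by (simp add: e_def add_divide_distrib[symmetric])
  have "box_spectral v n r e"
    unfolding box_spectral_def using inj on cols eeq by (auto simp: e_def u0)
  then show ?thesis by blast
qed

text \<open>The \<open>n\<close> distinct roots all are eigenvalues, so the monic characteristic
  polynomial of degree \<open>n\<close> is the product of their linear factors. Every multiplicity
  is therefore 1, and the weighted count is a cardinality.\<close>

lemma fib_count_eq_card:
  fixes V w :: real
  defines "v \<equiv> \<lambda>k. fib_potential V w k"
  assumes q: "jacobi_poly (\<lambda>k. v (int k)) n = (\<Prod>i<n. [:- r i, 1:])" and inj: "inj_on r {..<n}" and sp: "box_spectral v n r e"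
  shows "fib_count E w V 1 (int n) = card {i\<in>{..<n}. r i \<le> E}"
proof -
  define A where "A = fib_box V w 1 (int n)"
  have A: "A \<in> carrier_mat n n" by (simp add: A_def fib_box_def)
  have Aij: "A $$ (i, j) = of_real ((if int j = int i + 1 then 1 else 0) + (if int j = int i - 1 then 1 else 0) + (if i = j then v (int i + 1) else 0))"
    if "i < n" "j < n" for i j
    using that by (auto simp: A_def fib_box_def fib_hamiltonian_def v_def add.commute)
  have ev: "eigenvalue A (of_real (r i))" if i: "i < n" for i
  proof -
    define x where "x = Matrix.vec n (\<lambda>k. complex_of_real (e i (int k + 1)))"
    have "x \<noteq> 0\<^sub>v n"
    proof
      assume "x = 0\<^sub>v n"
      then have z: "e i (int k + 1) = 0" if "k < n" for k
        using that by (metis x_def index_vec index_zero_vec(1) of_real_eq_0_iff)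
      have "(\<Sum>k\<in>{1..int n}. e i k * e i k) = 1" using sp i by (auto simp: box_spectral_def)
      then show False unfolding sum_int_box using z by simp
    qed
    moreover have "A *\<^sub>v x = of_real (r i) \<cdot>\<^sub>v x"
    proof (rule eq_vecI)
      fix k assume "k < dim_vec (of_real (r i) \<cdot>\<^sub>v x)"
      then have k: "k < n" by (simp add: x_def)
      have e0: "e i l = 0" if "l \<notin> {1..int n}" for l using sp i that by (auto simp: box_spectral_def)
      have "(A *\<^sub>v x) $ k = (\<Sum>j<n. A $$ (k, j) * of_real (e i (int j + 1)))"
        using A k by (simp add: x_def scalar_prod_def lessThan_atLeast0)
      also have "\<dots> = of_real (\<Sum>j<n. ((if int j = int k + 1 then 1 else 0) + (if int j = int k - 1 then 1 else 0) + (if k = j then v (int k + 1) else 0)) * e i (int j + 1))"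
        using k by (simp add: Aij)
      also have "(\<Sum>j<n. ((if int j = int k + 1 then 1 else 0) + (if int j = int k - 1 then 1 else 0) + (if k = j then v (int k + 1) else 0)) * e i (int j + 1))
         = (\<Sum>j<n. if int j = int k + 1 then e i (int j + 1) else 0) + (\<Sum>j<n. if int j = int k - 1 then e i (int j + 1) else 0)
           + (\<Sum>j<n. if k = j then v (int k + 1) * e i (int j + 1) else 0)"
        unfolding sum.distrib[symmetric] by (intro sum.cong refl) (simp add: algebra_simps)
      also have "(\<Sum>j<n. if int j = int k + 1 then e i (int j + 1) else 0) = e i (int k + 1 + 1)"
      proof (cases "Suc k < n")
        case True
        have "(\<Sum>j<n. if int j = int k + 1 then e i (int j + 1) else 0) = (\<Sum>j<n. if j = Suc k then e i (int j + 1) else 0)"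
          by (intro sum.cong) auto
        then show ?thesis using True by (simp add: add_ac)
      next
        case False
        then show ?thesis using e0[of "int k + 1 + 1"] by (subst sum.neutral) auto
      qed
      also have "(\<Sum>j<n. if int j = int k - 1 then e i (int j + 1) else 0) = e i (int k + 1 - 1)"
      proof (cases k)
        case 0 then show ?thesis using e0[of 0] by (subst sum.neutral) auto
      next
        case (Suc l)
        have "(\<Sum>j<n. if int j = int k - 1 then e i (int j + 1) else 0) = (\<Sum>j<n. if j = l then e i (int j + 1) else 0)"
          using Suc by (intro sum.cong) auto
        then show ?thesis using Suc k by (simp add: add_ac)
      qed
      also have "(\<Sum>j<n. if k = j then v (int k + 1) * e i (int j + 1) else 0) = v (int k + 1) * e i (int k + 1)"
        using k by simp
      also have "e i (int k + 1 + 1) + e i (int k + 1 - 1) + v (int k + 1) * e i (int k + 1) = r i * e i (int k + 1)"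
      proof -
        have "int k + 1 \<in> {1..int n}" using k by simp
        then show ?thesis using sp i unfolding box_spectral_def by blast
      qed
      finally show "(A *\<^sub>v x) $ k = (of_real (r i) \<cdot>\<^sub>v x) $ k" using k by (simp add: x_def)
    qed (use A in \<open>simp add: x_def\<close>)
    ultimately have "eigenvector A x (of_real (r i))"
      using A by (simp add: eigenvector_def x_def)
    then show ?thesis by (auto simp: eigenvalue_def)
  qed
  define S where "S = (\<lambda>i. complex_of_real (r i)) ` {..<n}"
  have injc: "inj_on (\<lambda>i. complex_of_real (r i)) {..<n}" using inj by (auto simp: inj_on_def)
  have cp: "char_poly A = (\<Prod>x\<in>S. [:- x, 1:])"
  proof (rule monic_eq_prod_linear)
    show "finite S" by (simp add: S_def)
    show "poly (char_poly A) x = 0" if "x \<in> S" for x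
      using that ev eigenvalue_root_char_poly[OF A] by (auto simp: S_def)
    show "degree (char_poly A) = card S" using degree_monic_char_poly[OF A] by (simp add: S_def card_image[OF injc])
    show "lead_coeff (char_poly A) = 1" using degree_monic_char_poly[OF A] by simp
  qed
  have evS: "eigenvalue A x \<longleftrightarrow> x \<in> S" for x
    using eigenvalue_root_char_poly[OF A] unfolding cp by (auto simp: poly_prod S_def)
  have ord: "Polynomial.order x (char_poly A) = 1" if "x \<in> S" for x
  proof -
    define R where "R = (\<Prod>y\<in>S - {x}. [:- y, 1:])"
    have "char_poly A = [:- x, 1:] * R"
      unfolding cp R_def using that by (subst prod.remove[of _ x]) (auto simp: S_def)
    moreover have Rx: "poly R x \<noteq> 0" by (auto simp: R_def poly_prod S_def)
    moreover have "[:- x, 1:] * R \<noteq> 0" using Rx by (metis mult_eq_0_iff pCons_eq_0_iff poly_0 zero_neq_one)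
    moreover have "Polynomial.order x [:- x, 1:] = 1" using order_power_n_n[of x 1] by simp
    ultimately show ?thesis using order_mult[of "[:- x, 1:]" R x] order_0I[OF Rx] by (simp del: mult_pCons_left)
  qed
  have set: "{x::real. x \<le> E \<and> eigenvalue A (complex_of_real x)} = r ` {i\<in>{..<n}. r i \<le> E}"
    unfolding evS by (auto simp: S_def)
  have "fib_count E w V 1 (int n) = (\<Sum>x\<in>r ` {i\<in>{..<n}. r i \<le> E}. 1)"
    unfolding fib_count_def A_def[symmetric] set
  proof (rule sum.cong[OF refl])
    fix x assume "x \<in> r ` {i \<in> {..<n}. r i \<le> E}"
    then have "complex_of_real x \<in> S" by (auto simp: S_def)
    then show "Polynomial.order (complex_of_real x) (char_poly A) = 1" by (rule ord)
  qed
  also have "\<dots> = card {i\<in>{..<n}. r i \<le> E}"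
    by (subst sum_constant, subst card_image) (auto intro: inj_on_subset[OF inj])
  finally show ?thesis .
qed

text \<open>Gaussian elimination of one unknown per equation. The index types are arbitrary, so that
  later equations of different kinds, and unknowns from two boxes, form one system.\<close>

lemma homogeneous_system:
  fixes c :: "'s \<Rightarrow> 'i \<Rightarrow> real"
  assumes "finite S" "finite I" "card S < card I"
  shows "\<exists>a. (\<exists>i\<in>I. a i \<noteq> 0) \<and> (\<forall>s\<in>S. (\<Sum>i\<in>I. a i * c s i) = 0)"
  using assms
proof (induction S arbitrary: I c)
  case empty
  then obtain i where "i \<in> I" by fastforce
  then show ?case by (intro exI[of _ "\<lambda>_. 1"]) auto
next
  case (insert s S)
  show ?case
  proof (cases "\<forall>i\<in>I. c s i = 0")
    case True
    have "card S < card I" using insert by simp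
    then obtain a where "\<exists>i\<in>I. a i \<noteq> 0" "\<forall>s\<in>S. (\<Sum>i\<in>I. a i * c s i) = 0"
      using insert.IH[of I c] insert.prems by blast
    then show ?thesis using True by (intro exI[of _ a]) auto
  next
    case False
    then obtain j where j: "j \<in> I" "c s j \<noteq> 0" by blast
    define J where "J = I - {j}"
    have J: "finite J" "card S < card J" using insert j by (auto simp: J_def)
    define c' where "c' t i = c t i - c t j * c s i / c s j" for t i
    obtain a where a: "\<exists>i\<in>J. a i \<noteq> 0" "\<forall>t\<in>S. (\<Sum>i\<in>J. a i * c' t i) = 0"
      using insert.IH[OF J(1,2), of c'] by blast
    define x where "x = - (\<Sum>i\<in>J. a i * c s i) / c s j"
    define b where "b i = (if i = j then x else a i)" for i
    have sum: "(\<Sum>i\<in>I. b i * c t i) = x * c t j + (\<Sum>i\<in>J. a i * c t i)" for t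
    proof -
      have "(\<Sum>i\<in>J. b i * c t i) = (\<Sum>i\<in>J. a i * c t i)" by (intro sum.cong) (auto simp: b_def J_def)
      then show ?thesis using sum.remove[OF insert.prems(1) j(1), of "\<lambda>i. b i * c t i"] by (simp add: J_def b_def)
    qed
    have "(\<Sum>i\<in>I. b i * c t i) = 0" if "t \<in> insert s S" for t
    proof (cases "t = s")
      case True then show ?thesis unfolding sum using j by (simp add: x_def)
    next
      case False
      then have "(\<Sum>i\<in>J. a i * c' t i) = 0" using a that by auto
      moreover have "(\<Sum>i\<in>J. a i * c' t i) = (\<Sum>i\<in>J. a i * c t i) - c t j / c s j * (\<Sum>i\<in>J. a i * c s i)"
        unfolding sum_distrib_left sum_subtractf[symmetric] by (intro sum.cong) (auto simp: c'_def algebra_simps)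
      ultimately show ?thesis unfolding sum by (simp add: x_def)
    qed
    moreover have "\<exists>i\<in>I. b i \<noteq> 0" using a(1) by (auto simp: b_def J_def)
    ultimately show ?thesis by blast
  qed
qed

section \<open>Dimension counts comparing boxes with each other and with the line\<close>

definition jacobi :: "(int \<Rightarrow> real) \<Rightarrow> real \<Rightarrow> (int \<Rightarrow> real) \<Rightarrow> int \<Rightarrow> real" where
  "jacobi v E w k = w (k + 1) + w (k - 1) + (v k - E) * w k"

lemma jacobi_sum: "jacobi v E (\<lambda>k. \<Sum>t\<in>T. c t * f t k) k = (\<Sum>t\<in>T. c t * jacobi v E (f t) k)"
  by (simp add: jacobi_def sum.distrib sum_distrib_left algebra_simps sum_subtractf)

definition eigen_coef :: "nat \<Rightarrow> (nat \<Rightarrow> int \<Rightarrow> real) \<Rightarrow> (int \<Rightarrow> real) \<Rightarrow> nat \<Rightarrow> real" where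
  "eigen_coef n e w i = (\<Sum>k\<in>{1..int n}. w k * e i k)"

lemma eigen_coef_jacobi:
  assumes sp: "box_spectral v n r e" and w: "w 0 = 0" "w (int n + 1) = 0" and i: "i < n"
  shows "eigen_coef n e (jacobi v E w) i = (r i - E) * eigen_coef n e w i"
proof -
  have e0: "e i 0 = 0" "e i (int n + 1) = 0" using sp i by (auto simp: box_spectral_def)
  have "eigen_coef n e (jacobi v E w) i = (\<Sum>k\<in>{1..int n}. (w (k + 1) + w (k - 1) + (v k - E) * w k) * e i k)"
    by (simp add: eigen_coef_def jacobi_def)
  also have "\<dots> = (\<Sum>k\<in>{1..int n}. w k * (e i (k + 1) + e i (k - 1) + (v k - E) * e i k))"
    by (rule jacobi_symmetric[where v = "\<lambda>k. v k - E"]) (use w e0 in auto)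
  also have "\<dots> = (\<Sum>k\<in>{1..int n}. (r i - E) * (w k * e i k))"
  proof (rule sum.cong[OF refl])
    fix k assume "k \<in> {1..int n}"
    then have "e i (k + 1) + e i (k - 1) + v k * e i k = r i * e i k" using sp i unfolding box_spectral_def by blast
    then have "e i (k + 1) + e i (k - 1) + (v k - E) * e i k = (r i - E) * e i k" by (simp add: algebra_simps)
    then show "w k * (e i (k + 1) + e i (k - 1) + (v k - E) * e i k) = (r i - E) * (w k * e i k)" by simp
  qed
  finally show ?thesis by (simp add: eigen_coef_def sum_distrib_left)
qed

lemma parseval:
  assumes sp: "box_spectral v n r e"
  shows "(\<Sum>k\<in>{1..int n}. f k * g k) = (\<Sum>i<n. eigen_coef n e f i * eigen_coef n e g i)"
proof -
  have "(\<Sum>i<n. eigen_coef n e f i * eigen_coef n e g i)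
      = (\<Sum>i<n. \<Sum>k\<in>{1..int n}. \<Sum>l\<in>{1..int n}. f k * g l * (e i k * e i l))"
    unfolding eigen_coef_def sum_product by (simp add: mult_ac)
  also have "\<dots> = (\<Sum>k\<in>{1..int n}. \<Sum>i<n. \<Sum>l\<in>{1..int n}. f k * g l * (e i k * e i l))"
    by (rule sum.swap)
  also have "\<dots> = (\<Sum>k\<in>{1..int n}. \<Sum>l\<in>{1..int n}. \<Sum>i<n. f k * g l * (e i k * e i l))"
    by (intro sum.cong refl sum.swap)
  also have "\<dots> = (\<Sum>k\<in>{1..int n}. \<Sum>l\<in>{1..int n}. if k = l then f k * g l else 0)"
  proof (intro sum.cong refl)
    fix k l assume kl: "k \<in> {1..int n}" "l \<in> {1..int n}"
    then have "(\<Sum>i<n. e i k * e i l) = (if k = l then 1 else 0)"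
      using sp unfolding box_spectral_def by blast
    then show "(\<Sum>i<n. f k * g l * (e i k * e i l)) = (if k = l then f k * g l else 0)"
      unfolding sum_distrib_left[symmetric] by simp
  qed
  also have "\<dots> = (\<Sum>k\<in>{1..int n}. f k * g k)" by (intro sum.cong refl) simp
  finally show ?thesis by simp
qed

lemma eigen_coef_combination:
  assumes sp: "box_spectral v n r e" and I: "I \<subseteq> {..<n}" and j: "j < n"
  shows "eigen_coef n e (\<lambda>k. \<Sum>i\<in>I. a i * e i k) j = (if j \<in> I then a j else 0)"
proof -
  have fin: "finite I" using I finite_subset by blast
  have "eigen_coef n e (\<lambda>k. \<Sum>i\<in>I. a i * e i k) j = (\<Sum>k\<in>{1..int n}. \<Sum>i\<in>I. a i * (e i k * e j k))"
    unfolding eigen_coef_def sum_distrib_right by (simp only: mult.assoc)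
  also have "\<dots> = (\<Sum>i\<in>I. a i * (\<Sum>k\<in>{1..int n}. e i k * e j k))"
    by (subst sum.swap) (simp add: sum_distrib_left)
  also have "\<dots> = (\<Sum>i\<in>I. if i = j then a i else 0)"
  proof (rule sum.cong[OF refl])
    fix i assume "i \<in> I"
    then have "(\<Sum>k\<in>{1..int n}. e i k * e j k) = (if i = j then 1 else 0)"
      using sp I j unfolding box_spectral_def by blast
    then show "a i * (\<Sum>k\<in>{1..int n}. e i k * e j k) = (if i = j then a i else 0)" by simp
  qed
  finally show ?thesis using fin by simp
qed

text \<open>A quantitative form of \<open>E\<close> lying outside the spectrum, in terms of finite
  sums only, so that it can be translated along the orbit and applied to vectors on a box. The range
  on the right is wider by one site at each end because the operator spreads the support.\<close>

definition energy_gap :: "(int \<Rightarrow> real) \<Rightarrow> real \<Rightarrow> real \<Rightarrow> bool" where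
  "energy_gap v E \<delta> \<longleftrightarrow> (\<forall>w a b. (\<forall>k. k \<notin> {a..b} \<longrightarrow> w k = 0) \<longrightarrow>
     \<delta>\<^sup>2 * (\<Sum>k\<in>{a..b}. (w k)\<^sup>2) \<le> (\<Sum>k\<in>{a - 1..b + 1}. (jacobi v E w k)\<^sup>2))"

text \<open>Three eigenvectors with energies this close to \<open>E\<close> would have a nonzero
  combination vanishing at both end sites of the box. Extended by zero it has no boundary error at
  \<open>0\<close> and \<open>n + 1\<close>, so the bound on the line contradicts the closeness of
  the energies.\<close>

lemma energy_gap_card_le:
  assumes sp: "box_spectral v n r e" and gap: "energy_gap v E \<delta>"
  shows "card {i\<in>{..<n}. \<bar>r i - E\<bar> < \<delta>} \<le> 2"
proof (rule ccontr)
  define I where "I = {i\<in>{..<n}. \<bar>r i - E\<bar> < \<delta>}"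
  assume "\<not> card {i\<in>{..<n}. \<bar>r i - E\<bar> < \<delta>} \<le> 2"
  moreover have "card {1, int n} \<le> 2" by (simp add: card_insert_if)
  ultimately have "card {1, int n} < card I" unfolding I_def by linarith
  moreover have I: "finite I" "I \<subseteq> {..<n}" by (auto simp: I_def)
  ultimately obtain a where a: "\<exists>i\<in>I. a i \<noteq> 0" "\<forall>s\<in>{1, int n}. (\<Sum>i\<in>I. a i * e i s) = 0"
    using homogeneous_system[of "{1, int n}" I "\<lambda>s i. e i s"] by auto
  define w where "w k = (\<Sum>i\<in>I. a i * e i k)" for k
  have w0: "w k = 0" if "k \<notin> {1..int n}" for k
  proof -
    have "e i k = 0" if "i \<in> I" for i using sp \<open>k \<notin> {1..int n}\<close> that I(2) unfolding box_spectral_def by blast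
    then show ?thesis by (simp add: w_def)
  qed
  have w1: "w 1 = 0" "w (int n) = 0" using a by (auto simp: w_def)
  have cw: "eigen_coef n e w j = (if j \<in> I then a j else 0)" if "j < n" for j
    unfolding w_def by (rule eigen_coef_combination[OF sp I(2) that])
  have cJ: "eigen_coef n e (jacobi v E w) j = (r j - E) * (if j \<in> I then a j else 0)" if "j < n" for j
    using eigen_coef_jacobi[OF sp _ _ that, of w E] w0 cw[OF that] by simp
  have "(\<Sum>k\<in>{1..int n}. (jacobi v E w k)\<^sup>2) = (\<Sum>j<n. if j \<in> I then (r j - E)\<^sup>2 * (a j)\<^sup>2 else 0)"
    unfolding power2_eq_square parseval[OF sp] by (intro sum.cong) (auto simp: cJ mult_ac)
  also have "\<dots> = (\<Sum>j\<in>I. (r j - E)\<^sup>2 * (a j)\<^sup>2)"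
    using I by (simp add: sum.inter_restrict[symmetric] Int_absorb1)
  also have "\<dots> < (\<Sum>j\<in>I. \<delta>\<^sup>2 * (a j)\<^sup>2)"
  proof (rule sum_strict_mono_ex1[OF I(1)])
    have sq: "(r j - E)\<^sup>2 < \<delta>\<^sup>2" if "j \<in> I" for j
      using that power_strict_mono[of "\<bar>r j - E\<bar>" \<delta> 2] by (simp add: I_def)
    show "\<forall>j\<in>I. (r j - E)\<^sup>2 * (a j)\<^sup>2 \<le> \<delta>\<^sup>2 * (a j)\<^sup>2"
      by (intro ballI mult_right_mono less_imp_le[OF sq]) auto
    obtain i where "i \<in> I" "a i \<noteq> 0" using a by blast
    then show "\<exists>j\<in>I. (r j - E)\<^sup>2 * (a j)\<^sup>2 < \<delta>\<^sup>2 * (a j)\<^sup>2"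
      using sq[of i] by (intro bexI[of _ i] mult_strict_right_mono) auto
  qed
  also have "\<dots> = \<delta>\<^sup>2 * (\<Sum>j<n. if j \<in> I then (a j)\<^sup>2 else 0)"
    using I by (simp add: sum_distrib_left sum.inter_restrict[symmetric] Int_absorb1)
  also have "\<dots> = \<delta>\<^sup>2 * (\<Sum>k\<in>{1..int n}. (w k)\<^sup>2)"
    unfolding power2_eq_square parseval[OF sp]
    by (intro arg_cong2[of _ _ _ _ "(*)"] sum.cong) (auto simp: cw)
  also have "\<dots> \<le> (\<Sum>k\<in>{1 - 1..int n + 1}. (jacobi v E w k)\<^sup>2)"
    using gap w0 unfolding energy_gap_def by blast
  also have "\<dots> = (\<Sum>k\<in>{1..int n}. (jacobi v E w k)\<^sup>2)"
  proof (rule sum.mono_neutral_right)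
    show "\<forall>k\<in>{1 - 1..int n + 1} - {1..int n}. (jacobi v E w k)\<^sup>2 = 0"
    proof
      fix k assume "k \<in> {1 - 1..int n + 1} - {1..int n}"
      then have "k = 0 \<or> k = int n + 1" by auto
      then show "(jacobi v E w k)\<^sup>2 = 0" using w0 w1 by (auto simp: jacobi_def)
    qed
  qed auto
  finally show False by simp
qed

lemma square_sum_disjoint:
  fixes f :: "'t \<Rightarrow> real"
  assumes "finite T" "\<And>s t. s \<in> T \<Longrightarrow> t \<in> T \<Longrightarrow> s \<noteq> t \<Longrightarrow> f s * f t = 0"
  shows "(\<Sum>t\<in>T. f t)\<^sup>2 = (\<Sum>t\<in>T. (f t)\<^sup>2)"
  using assms
proof (induction T)
  case (insert x T)
  have "f x * (\<Sum>t\<in>T. f t) = 0" unfolding sum_distrib_left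
    by (intro sum.neutral) (use insert in auto)
  then show ?case using insert by (simp add: power2_eq_square algebra_simps)
qed simp

text \<open>With fewer close eigenvalues than test vectors, some nonzero combination is orthogonal
  to all close eigenvectors, so the operator expands it by at least \<open>\<delta>\<close>.
  Disjoint supports make both square norms additive over \<open>T\<close>, which contradicts
  \<open>small\<close>.\<close>

lemma card_ge_test_vectors:
  assumes sp: "box_spectral v n r e" and T: "finite T"
    and supp: "\<And>t k. t \<in> T \<Longrightarrow> k \<notin> {1..int n} \<Longrightarrow> f t k = 0"
    and disj: "\<And>s t k. s \<in> T \<Longrightarrow> t \<in> T \<Longrightarrow> s \<noteq> t \<Longrightarrow> f s k * f t k = 0"
      "\<And>s t k. s \<in> T \<Longrightarrow> t \<in> T \<Longrightarrow> s \<noteq> t \<Longrightarrow> jacobi v E (f s) k * jacobi v E (f t) k = 0"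
    and small: "\<And>t. t \<in> T \<Longrightarrow> (\<Sum>k\<in>{1..int n}. (jacobi v E (f t) k)\<^sup>2) < \<delta>\<^sup>2 * (\<Sum>k\<in>{1..int n}. (f t k)\<^sup>2)"
    and \<delta>: "\<delta> > 0"
  shows "card T \<le> card {i\<in>{..<n}. \<bar>r i - E\<bar> < \<delta>}"
proof (rule ccontr)
  define I where "I = {i\<in>{..<n}. \<bar>r i - E\<bar> < \<delta>}"
  assume "\<not> card T \<le> card {i\<in>{..<n}. \<bar>r i - E\<bar> < \<delta>}"
  then have "card I < card T" by (simp add: I_def)
  moreover have I: "finite I" by (simp add: I_def)
  ultimately obtain c where c: "\<exists>t\<in>T. c t \<noteq> 0" "\<forall>i\<in>I. (\<Sum>t\<in>T. c t * eigen_coef n e (f t) i) = 0"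
    using homogeneous_system[of I T "\<lambda>i t. eigen_coef n e (f t) i"] T by auto
  define w where "w k = (\<Sum>t\<in>T. c t * f t k)" for k
  have cw: "eigen_coef n e w i = (\<Sum>t\<in>T. c t * eigen_coef n e (f t) i)" for i
    unfolding eigen_coef_def w_def sum_distrib_right sum_distrib_left
    by (subst sum.swap) (simp add: mult_ac)
  have w0: "w 0 = 0" "w (int n + 1) = 0" using supp by (auto simp: w_def)
  have 1: "(\<Sum>k\<in>{1..int n}. (w k)\<^sup>2) = (\<Sum>t\<in>T. (c t)\<^sup>2 * (\<Sum>k\<in>{1..int n}. (f t k)\<^sup>2))"
  proof -
    have "(w k)\<^sup>2 = (\<Sum>t\<in>T. (c t)\<^sup>2 * (f t k)\<^sup>2)" for k
      unfolding w_def power_mult_distrib[symmetric] by (rule square_sum_disjoint[OF T]) (use disj(1) in auto)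
    then show ?thesis unfolding sum_distrib_left by (simp add: sum.swap[of _ T])
  qed
  have 2: "(\<Sum>k\<in>{1..int n}. (jacobi v E w k)\<^sup>2) = (\<Sum>t\<in>T. (c t)\<^sup>2 * (\<Sum>k\<in>{1..int n}. (jacobi v E (f t) k)\<^sup>2))"
  proof -
    have "(jacobi v E w k)\<^sup>2 = (\<Sum>t\<in>T. (c t)\<^sup>2 * (jacobi v E (f t) k)\<^sup>2)" for k
      unfolding w_def jacobi_sum power_mult_distrib[symmetric] by (rule square_sum_disjoint[OF T]) (use disj(2) in auto)
    then show ?thesis unfolding sum_distrib_left by (simp add: sum.swap[of _ T])
  qed
  have "\<delta>\<^sup>2 * (\<Sum>k\<in>{1..int n}. (w k)\<^sup>2) \<le> (\<Sum>k\<in>{1..int n}. (jacobi v E w k)\<^sup>2)"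
    unfolding power2_eq_square[of "w _"] power2_eq_square[of "jacobi _ _ _ _"] parseval[OF sp] sum_distrib_left
  proof (rule sum_mono)
    fix i assume i: "i \<in> {..<n}"
    have eq: "eigen_coef n e (jacobi v E w) i * eigen_coef n e (jacobi v E w) i = (r i - E)\<^sup>2 * (eigen_coef n e w i * eigen_coef n e w i)"
      using eigen_coef_jacobi[OF sp w0, of i E] i by (simp add: power2_eq_square mult_ac)
    show "\<delta>\<^sup>2 * (eigen_coef n e w i * eigen_coef n e w i) \<le> eigen_coef n e (jacobi v E w) i * eigen_coef n e (jacobi v E w) i"
    proof (cases "i \<in> I")
      case True then show ?thesis using c cw by simp
    next
      case False
      then have "\<delta>\<^sup>2 \<le> (r i - E)\<^sup>2" using i \<delta> by (auto simp: I_def abs_le_square_iff[symmetric])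
      then show ?thesis unfolding eq by (intro mult_right_mono) auto
    qed
  qed
  moreover have "(\<Sum>t\<in>T. (c t)\<^sup>2 * (\<Sum>k\<in>{1..int n}. (jacobi v E (f t) k)\<^sup>2)) < (\<Sum>t\<in>T. (c t)\<^sup>2 * (\<delta>\<^sup>2 * (\<Sum>k\<in>{1..int n}. (f t k)\<^sup>2)))"
  proof (rule sum_strict_mono_ex1[OF T])
    show "\<forall>t\<in>T. (c t)\<^sup>2 * (\<Sum>k\<in>{1..int n}. (jacobi v E (f t) k)\<^sup>2) \<le> (c t)\<^sup>2 * (\<delta>\<^sup>2 * (\<Sum>k\<in>{1..int n}. (f t k)\<^sup>2))"
      by (intro ballI mult_left_mono less_imp_le[OF small]) auto
    obtain t where "t \<in> T" "c t \<noteq> 0" using c by blast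
    then show "\<exists>t\<in>T. (c t)\<^sup>2 * (\<Sum>k\<in>{1..int n}. (jacobi v E (f t) k)\<^sup>2) < (c t)\<^sup>2 * (\<delta>\<^sup>2 * (\<Sum>k\<in>{1..int n}. (f t k)\<^sup>2))"
      using small[of t] by (intro bexI[of _ t] mult_strict_left_mono) auto
  qed
  moreover have "(\<Sum>t\<in>T. (c t)\<^sup>2 * (\<delta>\<^sup>2 * (\<Sum>k\<in>{1..int n}. (f t k)\<^sup>2))) = \<delta>\<^sup>2 * (\<Sum>t\<in>T. (c t)\<^sup>2 * (\<Sum>k\<in>{1..int n}. (f t k)\<^sup>2))"
    by (simp add: sum_distrib_left mult_ac)
  ultimately show False unfolding 1 2 by simp
qed

lemma form_expansion:
  fixes a :: "nat \<Rightarrow> real"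
  assumes sp: "box_spectral v n r e" and I: "I \<subseteq> {..<n}"
  defines "w \<equiv> \<lambda>k. \<Sum>i\<in>I. a i * e i k"
  shows "(\<Sum>k\<in>{1..int n}. jacobi v E w k * w k) = (\<Sum>i\<in>I. (r i - E) * (a i)\<^sup>2)"
proof -
  have w0: "w 0 = 0" "w (int n + 1) = 0"
    unfolding w_def by (rule sum.neutral; use sp I in \<open>auto simp: box_spectral_def\<close>)+
  have cw: "eigen_coef n e w j = (if j \<in> I then a j else 0)" if "j < n" for j
    unfolding w_def by (rule eigen_coef_combination[OF sp I that])
  have "(\<Sum>k\<in>{1..int n}. jacobi v E w k * w k) = (\<Sum>j<n. if j \<in> I then (r j - E) * (a j)\<^sup>2 else 0)"
    unfolding parseval[OF sp] by (intro sum.cong) (auto simp: eigen_coef_jacobi[OF sp w0] cw power2_eq_square)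
  also have "\<dots> = (\<Sum>i\<in>I. (r i - E) * (a i)\<^sup>2)"
    using I by (simp add: sum.inter_restrict[symmetric] Int_absorb1)
  finally show ?thesis .
qed

lemma sum_box_split:
  fixes f :: "int \<Rightarrow> real"
  shows "(\<Sum>k\<in>{1..int (n + m)}. f k) = (\<Sum>k\<in>{1..int n}. f k) + (\<Sum>k\<in>{1..int m}. f (k + int n))"
proof -
  have "(\<Sum>k\<in>{1..int m}. f (k + int n)) = (\<Sum>k\<in>{int n + 1..int (n + m)}. f k)"
    by (rule sum.reindex_bij_witness[of _ "\<lambda>k. k - int n" "\<lambda>k. k + int n"]) auto
  moreover have "{1..int (n + m)} = {1..int n} \<union> {int n + 1..int (n + m)}" by auto
  ultimately show ?thesis by (simp add: sum.union_disjoint)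
qed

text \<open>Cutting the box after site \<open>n\<close> and imposing the single condition \<open>w n = 0\<close> decouples the two
  halves; comparing quadratic forms then bounds the number of eigenvalues on one side of \<open>E\<close>.
  The sign \<open>\<sigma>\<close> and the set \<open>Q\<close> cover the eigenvalues \<open>\<le> E\<close> and the eigenvalues \<open>> E\<close> at once.\<close>

lemma card_additive:
  assumes sp1: "box_spectral v n r1 e1" and sp2: "box_spectral (\<lambda>k. v (k + int n)) m r2 e2"
    and sp: "box_spectral v (n + m) r e"
    and Q: "\<And>x. x \<in> Q \<Longrightarrow> \<sigma> * (x - E) \<le> 0" "\<And>x. x \<notin> Q \<Longrightarrow> 0 \<le> \<sigma> * (x - E)"
    and strict: "(\<forall>x\<in>Q. \<sigma> * (x - E) < 0) \<or> (\<forall>x. x \<notin> Q \<longrightarrow> 0 < \<sigma> * (x - E))"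
  shows "card {i\<in>{..<n}. r1 i \<in> Q} + card {i\<in>{..<m}. r2 i \<in> Q} \<le> card {i\<in>{..<n + m}. r i \<in> Q} + 1"
proof (rule ccontr)
  define I1 I2 I where "I1 = {i\<in>{..<n}. r1 i \<in> Q}" and "I2 = {i\<in>{..<m}. r2 i \<in> Q}" and "I = {i\<in>{..<n + m}. r i \<in> Q}"
  have I: "I1 \<subseteq> {..<n}" "I2 \<subseteq> {..<m}" "I \<subseteq> {..<n + m}" by (auto simp: I1_def I2_def I_def)
  have fin: "finite I1" "finite I2" "finite I" by (auto simp: I1_def I2_def I_def)
  define \<psi> where "\<psi> t k = (case t of Inl i \<Rightarrow> e1 i k | Inr i \<Rightarrow> e2 i (k - int n))" for t k
  \<comment> \<open>The equation \<open>None\<close> is the condition \<open>w n = 0\<close> at the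
    cut; the equation \<open>Some j\<close> is orthogonality to the eigenvector \<open>j\<close> of
    the whole box.\<close>
  define c where "c s t = (case s of None \<Rightarrow> \<psi> t (int n) | Some j \<Rightarrow> eigen_coef (n + m) e (\<psi> t) j)" for s t
  assume "\<not> card {i\<in>{..<n}. r1 i \<in> Q} + card {i\<in>{..<m}. r2 i \<in> Q} \<le> card {i\<in>{..<n + m}. r i \<in> Q} + 1"
  then have "card (insert None (Some ` I)) < card (I1 <+> I2)"
    using fin by (simp add: I1_def I2_def I_def card_Plus card_insert_if card_image)
  then obtain a where a: "\<exists>t\<in>I1 <+> I2. a t \<noteq> 0" "\<forall>s\<in>insert None (Some ` I). (\<Sum>t\<in>I1 <+> I2. a t * c s t) = 0"
    using homogeneous_system[of "insert None (Some ` I)" "I1 <+> I2" c] fin by auto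
  define w1 w2 where "w1 k = (\<Sum>i\<in>I1. a (Inl i) * e1 i k)" and "w2 k = (\<Sum>i\<in>I2. a (Inr i) * e2 i k)" for k
  define w where "w k = (\<Sum>t\<in>I1 <+> I2. a t * \<psi> t k)" for k
  have w: "w k = w1 k + w2 (k - int n)" for k
    unfolding w_def w1_def w2_def using fin by (simp add: sum.Plus \<psi>_def)
  have w1out: "w1 k = 0" if "k \<notin> {1..int n}" for k
    unfolding w1_def by (rule sum.neutral) (use sp1 that I in \<open>auto simp: box_spectral_def\<close>)
  have w2out: "w2 k = 0" if "k \<notin> {1..int m}" for k
    unfolding w2_def by (rule sum.neutral) (use sp2 that I in \<open>auto simp: box_spectral_def\<close>)
  have wn: "w (int n) = 0"
    using a(2) by (simp add: w_def c_def)
  then have w1n: "w1 (int n) = 0" using w[of "int n"] w2out[of 0] by simp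
  have wout: "w 0 = 0" "w (int (n + m) + 1) = 0" using w w1out w2out by auto
  have coefI: "eigen_coef (n + m) e w j = 0" if "j \<in> I" for j
  proof -
    have "eigen_coef (n + m) e w j = (\<Sum>t\<in>I1 <+> I2. a t * eigen_coef (n + m) e (\<psi> t) j)"
      unfolding eigen_coef_def w_def sum_distrib_right sum_distrib_left by (subst sum.swap) (simp only: mult.assoc)
    then show ?thesis using a(2) that by (force simp: c_def)
  qed
  have form: "(\<Sum>k\<in>{1..int (n + m)}. jacobi v E w k * w k) = (\<Sum>i\<in>I1. (r1 i - E) * (a (Inl i))\<^sup>2) + (\<Sum>i\<in>I2. (r2 i - E) * (a (Inr i))\<^sup>2)"
  proof -
    have "(\<Sum>k\<in>{1..int n}. jacobi v E w k * w k) = (\<Sum>k\<in>{1..int n}. jacobi v E w1 k * w1 k)"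
    proof (rule sum.cong[OF refl])
      fix k assume k: "k \<in> {1..int n}"
      show "jacobi v E w k * w k = jacobi v E w1 k * w1 k"
      proof (cases "k = int n")
        case True then show ?thesis using wn w1n by simp
      next
        case False
        then have "w2 (k - int n) = 0" "w2 (k + 1 - int n) = 0" "w2 (k - 1 - int n) = 0" using k w2out by auto
        then show ?thesis by (simp add: jacobi_def w)
      qed
    qed
    moreover have "(\<Sum>k\<in>{1..int m}. jacobi v E w (k + int n) * w (k + int n)) = (\<Sum>k\<in>{1..int m}. jacobi (\<lambda>k. v (k + int n)) E w2 k * w2 k)"
    proof (rule sum.cong[OF refl])
      fix k assume k: "k \<in> {1..int m}"
      have "w1 (k + int n) = 0" "w1 (k + int n + 1) = 0" using k w1out by auto
      moreover have "w1 (k + int n - 1) = 0"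
      proof (cases "k = 1")
        case True then show ?thesis using w1n by simp
      next
        case False then show ?thesis using k w1out by auto
      qed
      ultimately show "jacobi v E w (k + int n) * w (k + int n) = jacobi (\<lambda>k. v (k + int n)) E w2 k * w2 k"
        by (simp add: jacobi_def w add_ac diff_add_eq)
    qed
    ultimately show ?thesis
      unfolding sum_box_split form_expansion[OF sp1 I(1), of E "\<lambda>i. a (Inl i)", folded w1_def]
        form_expansion[OF sp2 I(2), of E "\<lambda>i. a (Inr i)", folded w2_def] by simp
  qed
  have form2: "(\<Sum>k\<in>{1..int (n + m)}. jacobi v E w k * w k) = (\<Sum>j<n + m. (r j - E) * (eigen_coef (n + m) e w j)\<^sup>2)"
    unfolding parseval[OF sp] by (intro sum.cong) (auto simp: eigen_coef_jacobi[OF sp wout] power2_eq_square)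
  have le: "\<sigma> * (\<Sum>k\<in>{1..int (n + m)}. jacobi v E w k * w k) \<le> 0"
    unfolding form distrib_left sum_distrib_left mult.assoc[symmetric]
    by (intro add_nonpos_nonpos sum_nonpos mult_nonpos_nonneg Q) (auto simp: I1_def I2_def)
  have tm: "0 \<le> \<sigma> * ((r j - E) * (eigen_coef (n + m) e w j)\<^sup>2)" if "j < n + m" for j
  proof (cases "j \<in> I")
    case True then show ?thesis using coefI by simp
  next
    case False
    then have "0 \<le> \<sigma> * (r j - E)" using that by (intro Q) (auto simp: I_def)
    then show ?thesis unfolding mult.assoc[symmetric] by (rule mult_nonneg_nonneg) simp
  qed
  have ge: "0 \<le> \<sigma> * (\<Sum>k\<in>{1..int (n + m)}. jacobi v E w k * w k)"
    unfolding form2 sum_distrib_left by (intro sum_nonneg tm) auto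
  obtain t where t: "t \<in> I1 <+> I2" "a t \<noteq> 0" using a(1) by blast
  \<comment> \<open>\<open>\<sigma>\<close> times the quadratic form is at most 0 by the two halves
    and at least 0 by the whole box. Strictness on \<open>Q\<close> sharpens the first inequality,
    as some \<open>a t\<close> is nonzero; strictness off \<open>Q\<close> sharpens the second, as
    \<open>w\<close> is nonzero and orthogonal to the eigenvectors in \<open>I\<close>.\<close>
  show False
  proof (cases "\<forall>x\<in>Q. \<sigma> * (x - E) < 0")
    case True
    have "\<sigma> * (\<Sum>k\<in>{1..int (n + m)}. jacobi v E w k * w k) =
      (\<Sum>t\<in>I1 <+> I2. \<sigma> * ((case t of Inl i \<Rightarrow> r1 i | Inr i \<Rightarrow> r2 i) - E) * (a t)\<^sup>2)"
      unfolding form using fin by (simp add: sum.Plus sum_distrib_left distrib_left mult.assoc)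
    also have "\<dots> < (\<Sum>t\<in>I1 <+> I2. 0)"
    proof (rule sum_strict_mono_ex1)
      show "finite (I1 <+> I2)" using fin by simp
      show "\<forall>t\<in>I1 <+> I2. \<sigma> * ((case t of Inl i \<Rightarrow> r1 i | Inr i \<Rightarrow> r2 i) - E) * (a t)\<^sup>2 \<le> 0"
        by (intro ballI mult_nonpos_nonneg Q) (auto simp: I1_def I2_def)
      show "\<exists>t\<in>I1 <+> I2. \<sigma> * ((case t of Inl i \<Rightarrow> r1 i | Inr i \<Rightarrow> r2 i) - E) * (a t)\<^sup>2 < 0"
        by (rule bexI[OF _ t(1)], rule mult_neg_pos) (use True t in \<open>auto simp: I1_def I2_def\<close>)
    qed
    finally show False using ge by simp
  next
    case False
    then have st: "\<And>x. x \<notin> Q \<Longrightarrow> 0 < \<sigma> * (x - E)" using strict by blast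
    have "(\<Sum>k\<in>{1..int (n + m)}. w k * w k) > 0"
    proof -
      have nrm: "(\<Sum>k\<in>{1..int (n + m)}. w k * w k) = (\<Sum>k\<in>{1..int n}. w1 k * w1 k) + (\<Sum>k\<in>{1..int m}. w2 k * w2 k)"
        unfolding sum_box_split
        by (intro arg_cong2[of _ _ _ _ "(+)"] sum.cong refl) (use w w1out w2out in auto)
      have "(\<Sum>k\<in>{1..int n}. w1 k * w1 k) = (\<Sum>i<n. (if i \<in> I1 then a (Inl i) else 0)\<^sup>2)"
        unfolding parseval[OF sp1] w1_def power2_eq_square
        by (intro sum.cong refl) (simp add: eigen_coef_combination[OF sp1 I(1)])
      moreover have "(\<Sum>k\<in>{1..int m}. w2 k * w2 k) = (\<Sum>i<m. (if i \<in> I2 then a (Inr i) else 0)\<^sup>2)"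
        unfolding parseval[OF sp2] w2_def power2_eq_square
        by (intro sum.cong refl) (simp add: eigen_coef_combination[OF sp2 I(2)])
      moreover have "0 < (\<Sum>i<n. (if i \<in> I1 then a (Inl i) else 0)\<^sup>2) + (\<Sum>i<m. (if i \<in> I2 then a (Inr i) else 0)\<^sup>2)"
      proof (cases t)
        case (Inl i)
        then have "0 < (\<Sum>i<n. (if i \<in> I1 then a (Inl i) else 0)\<^sup>2)"
          using t I by (intro sum_pos2[of _ i]) auto
        then show ?thesis by (intro add_pos_nonneg sum_nonneg) auto
      next
        case (Inr i)
        then have "0 < (\<Sum>i<m. (if i \<in> I2 then a (Inr i) else 0)\<^sup>2)"
          using t I by (intro sum_pos2[of _ i]) auto
        then show ?thesis by (intro add_nonneg_pos sum_nonneg) auto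
      qed
      ultimately show ?thesis using nrm by simp
    qed
    then have "(\<Sum>j<n + m. eigen_coef (n + m) e w j * eigen_coef (n + m) e w j) > 0" unfolding parseval[OF sp] .
    moreover have "(\<Sum>j<n + m. eigen_coef (n + m) e w j * eigen_coef (n + m) e w j) = 0" if "\<forall>j<n + m. eigen_coef (n + m) e w j = 0"
      using that by simp
    ultimately obtain j where j: "j < n + m" "eigen_coef (n + m) e w j \<noteq> 0" by fastforce
    then have "j \<notin> I" using coefI by blast
    then have "0 < \<sigma> * (r j - E) * (eigen_coef (n + m) e w j)\<^sup>2"
      using j by (intro mult_pos_pos st) (auto simp: I_def)
    then have "0 < \<sigma> * ((r j - E) * (eigen_coef (n + m) e w j)\<^sup>2)" by (simp add: mult.assoc)
    then have "0 < \<sigma> * (\<Sum>k\<in>{1..int (n + m)}. jacobi v E w k * w k)"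
      unfolding form2 sum_distrib_left using j(1) tm by (intro sum_pos2[of _ j]) auto
    then show False using le by simp
  qed
qed

section \<open>The integrated density of states\<close>

lemma interlaces_inj:
  assumes "interlaces n r s" shows "inj_on r {..<n}"
proof -
  have "r i < r j" if "i < j" "j < n" for i j
  proof -
    have "r i < s (Suc i)" "s j < r j" using assms that by (auto simp: interlaces_def)
    moreover have "s (Suc i) \<le> s j"
      using interlaces_mono[OF assms, of "Suc i" j] that by (cases "Suc i = j") auto
    ultimately show ?thesis by linarith
  qed
  then show ?thesis by (intro inj_onI) (metis lessThan_iff less_irrefl linorder_neqE_nat)
qed

lemma fib_box_data:
  obtains r e where "inj_on r {..<n}" "box_spectral (fib_potential V w) n r e"
    "jacobi_poly (\<lambda>k. fib_potential V w (int k)) n = (\<Prod>i<n. [:- r i, 1:])"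
    "\<And>E. fib_count E w V 1 (int n) = card {i\<in>{..<n}. r i \<le> E}"
proof -
  obtain r s where rs: "jacobi_poly (\<lambda>k. fib_potential V w (int k)) n = (\<Prod>i<n. [:- r i, 1:])" "interlaces n r s"
    using jacobi_poly_roots by blast
  have inj: "inj_on r {..<n}" by (rule interlaces_inj[OF rs(2)])
  obtain e where e: "box_spectral (fib_potential V w) n r e" using box_spectral_exists[OF rs(1) inj] by blast
  show ?thesis using that[OF inj e rs(1)] fib_count_eq_card[OF rs(1) inj e] by blast
qed

lemma fib_potential_shift: "fib_potential V w (k + int n) = fib_potential V (w + real n * fib_alpha) k"
  by (simp add: fib_potential_def algebra_simps)

lemma fib_count_le: "fib_count E w V 1 (int n) \<le> n"
proof -
  obtain r e where "fib_count E w V 1 (int n) = card {i\<in>{..<n}. r i \<le> E}" using fib_box_data by metis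
  also have "\<dots> \<le> card {..<n}" by (intro card_mono) auto
  finally show ?thesis by simp
qed

lemma fib_count_mono: "E \<le> E' \<Longrightarrow> fib_count E w V 1 (int n) \<le> fib_count E' w V 1 (int n)"
proof -
  assume "E \<le> E'"
  obtain r e where r: "\<And>E. fib_count E w V 1 (int n) = card {i\<in>{..<n}. r i \<le> E}" using fib_box_data by metis
  show ?thesis unfolding r using \<open>E \<le> E'\<close> by (intro card_mono) auto
qed

text \<open>\<open>card_additive\<close> bounds the sum of the counts from one side only. Applied to
  the eigenvalues above \<open>E\<close> as well, and passing to complements, it bounds the sum from
  the other side.\<close>

lemma fib_count_additive:
  "\<bar>real (fib_count E w V 1 (int (n + m))) - real (fib_count E w V 1 (int n))
     - real (fib_count E (w + real n * fib_alpha) V 1 (int m))\<bar> \<le> 1"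
proof -
  obtain r1 e1 where 1: "box_spectral (fib_potential V w) n r1 e1"
    "\<And>E. fib_count E w V 1 (int n) = card {i\<in>{..<n}. r1 i \<le> E}" using fib_box_data by metis
  obtain r2 e2 where 2: "box_spectral (fib_potential V (w + real n * fib_alpha)) m r2 e2"
    "\<And>E. fib_count E (w + real n * fib_alpha) V 1 (int m) = card {i\<in>{..<m}. r2 i \<le> E}" using fib_box_data by metis
  obtain r e where 3: "box_spectral (fib_potential V w) (n + m) r e"
    "\<And>E. fib_count E w V 1 (int (n + m)) = card {i\<in>{..<n + m}. r i \<le> E}" using fib_box_data by metis
  have sp2: "box_spectral (\<lambda>k. fib_potential V w (k + int n)) m r2 e2"
    using 2(1) by (simp add: fib_potential_shift)
  have "card {i\<in>{..<n}. r1 i \<in> {..E}} + card {i\<in>{..<m}. r2 i \<in> {..E}} \<le> card {i\<in>{..<n + m}. r i \<in> {..E}} + 1"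
    by (rule card_additive[OF 1(1) sp2 3(1), where \<sigma> = "1" and E = E]) auto
  moreover have "card {i\<in>{..<n}. r1 i \<in> {E<..}} + card {i\<in>{..<m}. r2 i \<in> {E<..}} \<le> card {i\<in>{..<n + m}. r i \<in> {E<..}} + 1"
    by (rule card_additive[OF 1(1) sp2 3(1), where \<sigma> = "- 1" and E = E]) auto
  moreover have split: "card {i\<in>{..<l}. x i \<in> {E<..}} + card {i\<in>{..<l}. x i \<le> E} = l" for l and x :: "nat \<Rightarrow> real"
  proof -
    have "card {i\<in>{..<l}. x i \<in> {E<..}} + card {i\<in>{..<l}. x i \<le> E} = card ({i\<in>{..<l}. x i \<in> {E<..}} \<union> {i\<in>{..<l}. x i \<le> E})"
      by (rule card_Un_disjoint[symmetric]) (auto intro: finite_subset[of _ "{..<l}"])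
    also have "{i\<in>{..<l}. x i \<in> {E<..}} \<union> {i\<in>{..<l}. x i \<le> E} = {..<l}" by auto
    finally show ?thesis by simp
  qed
  ultimately show ?thesis
    using split[of n r1] split[of m r2] split[of "n + m" r] unfolding 1(2) 2(2) 3(2) atMost_iff by linarith
qed

section \<open>Local constancy of the potential in the phase, and existence of the density
  limit\<close>

lemma fib_potential_floor:
  "fib_potential V w k = V * of_int (\<lfloor>w + of_int (k + 1) * fib_alpha\<rfloor> - \<lfloor>w + of_int k * fib_alpha\<rfloor>)"
proof -
  have "frac fib_alpha = fib_alpha" "\<lfloor>fib_alpha\<rfloor> = 0" using fib_alpha_bounds by (auto simp: frac_eq floor_eq_iff)
  then show ?thesis
    using indicator_top_arc[of fib_alpha "of_int k * fib_alpha + w"]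
    unfolding fib_potential_def by (simp add: distrib_right add.commute add.left_commute)
qed

lemma fib_potential_frac: "fib_potential V (frac w) k = fib_potential V w k"
  by (simp add: fib_potential_def frac_add_simps)

lemma fib_potential_locally_constant:
  assumes "finite K"
  obtains d where "d > 0" "\<And>y k. x \<le> y \<Longrightarrow> y < x + d \<Longrightarrow> k \<in> K \<Longrightarrow> fib_potential V y k = fib_potential V x k"
    "\<And>y y' k. x - d < y \<Longrightarrow> y < x \<Longrightarrow> x - d < y' \<Longrightarrow> y' < x \<Longrightarrow> k \<in> K \<Longrightarrow> fib_potential V y k = fib_potential V y' k"
proof -
  define J where "J = (\<lambda>k. of_int k * fib_alpha) ` K \<union> (\<lambda>k. of_int (k + 1) * fib_alpha) ` K"
  have J: "finite J" using assms by (simp add: J_def)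
  have JK: "of_int k * fib_alpha \<in> J" "of_int (k + 1) * fib_alpha \<in> J" if "k \<in> K" for k
    using that unfolding J_def by blast+
  obtain d where d: "d > 0" "\<And>j y. j \<in> J \<Longrightarrow> x - d < y \<and> y < x \<Longrightarrow> \<lfloor>y + j\<rfloor> = \<lceil>x + j\<rceil> - 1"
    "\<And>j y. j \<in> J \<Longrightarrow> x \<le> y \<and> y < x + d \<Longrightarrow> \<lfloor>y + j\<rfloor> = \<lfloor>x + j\<rfloor>"
    using floor_left_right[OF J, of x] by blast
  show ?thesis
  proof (rule that[OF d(1)])
    fix y k assume "x \<le> y" "y < x + d" "k \<in> K"
    then show "fib_potential V y k = fib_potential V x k"
      unfolding fib_potential_floor using d(3)[OF JK(1), of k y] d(3)[OF JK(2), of k y] by simp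
  next
    fix y y' k assume "x - d < y" "y < x" "x - d < y'" "y' < x" "k \<in> K"
    then show "fib_potential V y k = fib_potential V y' k"
      unfolding fib_potential_floor
      using d(2)[OF JK(1), of k y] d(2)[OF JK(2), of k y] d(2)[OF JK(1), of k y'] d(2)[OF JK(2), of k y'] by simp
  qed
qed

text \<open>A function of finitely many potential values is a step function of the phase: it is
  constant on a short interval to the left of each point and on one to the right that includes the
  point.\<close>

lemma has_mean_window:
  fixes h :: "real \<Rightarrow> real"
  assumes "finite K" and h: "\<And>x y. (\<And>k. k \<in> K \<Longrightarrow> fib_potential V x k = fib_potential V y k) \<Longrightarrow> h x = h y"
  shows "\<exists>M. has_mean h M"
proof (rule has_mean_regulated)
  show "h (frac x) = h x" for x by (rule h) (rule fib_potential_frac)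
  fix x e :: real assume "e > 0"
  obtain d where d: "d > 0" "\<And>y k. x \<le> y \<Longrightarrow> y < x + d \<Longrightarrow> k \<in> K \<Longrightarrow> fib_potential V y k = fib_potential V x k"
    "\<And>y y' k. x - d < y \<Longrightarrow> y < x \<Longrightarrow> x - d < y' \<Longrightarrow> y' < x \<Longrightarrow> k \<in> K \<Longrightarrow> fib_potential V y k = fib_potential V y' k"
    by (rule fib_potential_locally_constant[OF assms(1), of x V]) blast
  have eq1: "h y = h (x - d / 2)" if "x - d < y \<and> y < x" for y
  proof (rule h)
    fix k assume k: "k \<in> K"
    show "fib_potential V y k = fib_potential V (x - d / 2) k"
      by (rule d(3)[OF _ _ _ _ k]) (use that d(1) in simp_all)
  qed
  have eq2: "h y = h x" if "x \<le> y \<and> y < x + d" for y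
    by (rule h, rule d(2)) (use that in simp_all)
  have "norm (h y - h (x - d / 2)) \<le> e" if "x - d < y \<and> y < x" for y
    unfolding eq1[OF that] using \<open>e > 0\<close> by simp
  moreover have "norm (h y - h x) \<le> e" if "x \<le> y \<and> y < x + d" for y
    unfolding eq2[OF that] using \<open>e > 0\<close> by simp
  ultimately show "\<exists>d>0. \<exists>c. (\<forall>y. x - d < y \<and> y < x \<longrightarrow> norm (h y - c) \<le> e) \<and>
                    (\<forall>y. x \<le> y \<and> y < x + d \<longrightarrow> norm (h y - h x) \<le> e)"
    using d(1) by blast
qed

lemma fib_count_cong:
  assumes "\<And>k. k \<in> {1..int n} \<Longrightarrow> fib_potential V x k = fib_potential V y k"
  shows "fib_count E x V 1 (int n) = fib_count E y V 1 (int n)"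
proof -
  have "fib_box V x 1 (int n) = fib_box V y 1 (int n)"
    unfolding fib_box_def
  proof (rule Matrix.cong_mat[OF refl refl])
    fix i j assume "i < nat (int n - 1 + 1)" "j < nat (int n - 1 + 1)"
    then have "fib_potential V x (1 + int i) = fib_potential V y (1 + int i)" by (intro assms) auto
    then show "(case (i, j) of (i, j) \<Rightarrow> fib_hamiltonian V x (\<lambda>k. if k = 1 + int j then 1 else 0) (1 + int i)) =
      (case (i, j) of (i, j) \<Rightarrow> fib_hamiltonian V y (\<lambda>k. if k = 1 + int j then 1 else 0) (1 + int i))"
      by (simp only: prod.case fib_hamiltonian_def)
  qed
  then show ?thesis by (simp add: fib_count_def)
qed

lemma sum_diff_shift:
  fixes F :: "nat \<Rightarrow> real"
  shows "(\<Sum>k<N. F (k + n) - F k) = (\<Sum>i<n. F (N + i) - F i)"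
proof (induction N)
  case (Suc N)
  have "(\<Sum>i<n. F (Suc N + i) - F i) - (\<Sum>i<n. F (N + i) - F i) = (\<Sum>i<n. F (N + Suc i) - F (N + i))"
    by (simp add: sum_subtractf)
  also have "\<dots> = F (N + n) - F N" by (subst sum_lessThan_telescope) simp
  finally show ?case using Suc by (simp add: add.commute)
qed simp

text \<open>By almost additivity, \<open>n\<close> times the count on a long box is the rotation sum of the counts on boxes of
  length \<open>n\<close>, which depend on finitely many potential values and hence have a mean.\<close>

lemma fib_count_density_approx:
  assumes n: "n > 0"
  shows "\<exists>x. \<exists>N0. \<forall>N\<ge>N0. \<forall>w. \<bar>real (fib_count E w V 1 (int N)) / real N - x\<bar> \<le> 3 / real n"
proof -
  define h where "h w = real (fib_count E w V 1 (int n))" for w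
  have "\<exists>M. has_mean h M"
  proof (rule has_mean_window)
    show "finite {1..int n}" by simp
    show "h x = h y" if "\<And>k. k \<in> {1..int n} \<Longrightarrow> fib_potential V x k = fib_potential V y k" for x y
      unfolding h_def by (simp only: fib_count_cong[OF that])
  qed
  then obtain M where M: "has_mean h M" ..
  have one: "(1::real) > 0" by simp
  obtain K0 where K0: "K0 > 0" "\<And>K w. K \<ge> K0 \<Longrightarrow> norm (rot_avg h K w - M) < 1"
    by (rule has_meanD[OF M one]) blast
  \<comment> \<open>\<open>K0\<close> brings the rotation average within 1 of \<open>M\<close>, and
    \<open>n * (2 * n + 1)\<close> absorbs the end terms of the exchanged sum. Together with almost
    additivity these are three errors of at most \<open>N\<close>, whence the 3.\<close>
  define N0 where "N0 = K0 + n * (2 * n + 1)"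
  have "\<bar>real (fib_count E w V 1 (int N)) / real N - M / real n\<bar> \<le> 3 / real n" if N: "N \<ge> N0" for N w
  proof -
    define F where "F k = real (fib_count E w V 1 (int k))" for k
    have Npos: "N > 0" using N K0(1) by (simp add: N0_def)
    have add: "\<bar>F (k + m) - F k - real (fib_count E (w + real k * fib_alpha) V 1 (int m))\<bar> \<le> 1" for k m
      unfolding F_def by (rule fib_count_additive)
    have Fb: "\<bar>F (N + i) - F i - F N\<bar> \<le> 2 * real n + 1" if "i < n" for i
    proof -
      have "real (fib_count E (w + real N * fib_alpha) V 1 (int i)) \<le> real n" "F i \<le> real n" "F i \<ge> 0"
        using fib_count_le[of E "w + real N * fib_alpha" V i] fib_count_le[of E w V i] that by (simp_all add: F_def)
      moreover have "real (fib_count E (w + real N * fib_alpha) V 1 (int i)) \<ge> 0" by simp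
      ultimately show ?thesis using add[of N i] by linarith
    qed
    have "\<bar>(\<Sum>k<N. h (w + real k * fib_alpha)) - (\<Sum>k<N. F (k + n) - F k)\<bar> \<le> (\<Sum>k<N. 1)"
      unfolding sum_subtractf[symmetric] using add[of _ n]
      by (intro order_trans[OF sum_abs] sum_mono) (simp add: h_def abs_minus_commute)
    moreover have "\<bar>(\<Sum>i<n. F (N + i) - F i) - real n * F N\<bar> \<le> (\<Sum>i<n. 2 * real n + 1)"
    proof -
      have "(\<Sum>i<n. F (N + i) - F i) - real n * F N = (\<Sum>i<n. F (N + i) - F i - F N)" by (simp add: sum_subtractf)
      then show ?thesis using Fb by (simp only:) (intro order_trans[OF sum_abs] sum_mono, simp)
    qed
    ultimately have 1: "\<bar>(\<Sum>k<N. h (w + real k * fib_alpha)) - real n * F N\<bar> \<le> real N + real n * (2 * real n + 1)"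
      unfolding sum_diff_shift by simp
    have "real (n * (2 * n + 1)) \<le> real N" using N by (intro of_nat_mono) (simp add: N0_def)
    then have 2: "real n * (2 * real n + 1) \<le> real N" by (simp add: algebra_simps)
    have "real N * rot_avg h N w = (\<Sum>k<N. h (w + real k * fib_alpha))" using Npos by (simp add: rot_avg_def)
    then have "\<bar>real N * rot_avg h N w - real n * F N\<bar> \<le> 2 * real N" using 1 2 by linarith
    moreover have "\<bar>real N * rot_avg h N w - real N * M\<bar> \<le> real N"
    proof -
      have "\<bar>rot_avg h N w - M\<bar> \<le> 1" using K0(2)[of N w] N by (simp add: N0_def)
      then have "real N * \<bar>rot_avg h N w - M\<bar> \<le> real N * 1" by (intro mult_left_mono) auto
      then show ?thesis by (simp add: abs_mult right_diff_distrib[symmetric])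
    qed
    ultimately have "\<bar>real n * F N - real N * M\<bar> \<le> 3 * real N" by linarith
    moreover have "F N / real N - M / real n = (real n * F N - real N * M) / (real n * real N)"
      using n Npos by (simp add: field_simps)
    ultimately show ?thesis using n Npos
      by (simp add: F_def[symmetric] abs_divide abs_mult divide_le_eq field_simps)
  qed
  then show ?thesis by blast
qed

text \<open>The approximations are uniform in the phase, so the densities are Cauchy and all phases
  share the limit found at phase 0.\<close>

lemma fib_ids_exists: "\<exists>L. \<forall>w. (\<lambda>n. real (fib_count E w V 1 (int n)) / real n) \<longlonglongrightarrow> L"
proof -
  define a where "a w N = real (fib_count E w V 1 (int N)) / real N" for w N
  have ap: "\<exists>x N0. \<forall>N\<ge>N0. \<forall>w. \<bar>a w N - x\<bar> < e" if "e > 0" for e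
  proof -
    obtain n :: nat where n: "3 / e < real n" using reals_Archimedean2 by blast
    moreover have "3 / e > 0" using that by simp
    ultimately have n0: "n > 0" by (metis less_trans of_nat_0_less_iff)
    have "3 / real n < e" using n n0 that by (simp add: field_simps)
    then show ?thesis using fib_count_density_approx[OF n0, of E V] unfolding a_def[symmetric] by (meson le_less_trans)
  qed
  have "Cauchy (a 0)"
  proof (rule CauchyI)
    fix e :: real assume "e > 0"
    then obtain x N0 where "\<forall>N\<ge>N0. \<forall>w. \<bar>a w N - x\<bar> < e / 2" using ap[of "e/2"] by auto
    then have "norm (a 0 m - a 0 n) < e" if "m \<ge> N0" "n \<ge> N0" for m n
      using that unfolding real_norm_def by (smt (verit) field_sum_of_halves)
    then show "\<exists>M. \<forall>m\<ge>M. \<forall>n\<ge>M. norm (a 0 m - a 0 n) < e" by blast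
  qed
  then obtain L where L: "a 0 \<longlonglongrightarrow> L" using convergent_eq_Cauchy by blast
  have "a w \<longlonglongrightarrow> L" for w
  proof (rule LIMSEQ_I)
    fix e :: real assume e: "e > 0"
    then obtain x N0 where x: "\<forall>N\<ge>N0. \<forall>w. \<bar>a w N - x\<bar> < e / 3" using ap[of "e/3"] by auto
    obtain N1 where N1: "\<forall>N\<ge>N1. norm (a 0 N - L) < e / 3" using LIMSEQ_D[OF L, of "e/3"] e by auto
    have "norm (a w N - L) < e" if "N \<ge> max N0 N1" for N
    proof -
      have "\<bar>a w N - x\<bar> < e / 3" "\<bar>a 0 N - x\<bar> < e / 3" "\<bar>a 0 N - L\<bar> < e / 3" using x N1 that by auto
      then show ?thesis unfolding real_norm_def by linarith
    qed
    then show "\<exists>no. \<forall>N\<ge>no. norm (a w N - L) < e" by blast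
  qed
  then show ?thesis unfolding a_def by blast
qed

lemma fib_ids_limit: "(\<lambda>n. real (fib_count E w V 1 (int n)) / real n) \<longlonglongrightarrow> fib_ids E V"
proof -
  obtain L where L: "\<And>w. (\<lambda>n. real (fib_count E w V 1 (int n)) / real n) \<longlonglongrightarrow> L"
    using fib_ids_exists by blast
  have "fib_ids E V = L" unfolding fib_ids_def
    by (rule the_equality) (use L LIMSEQ_unique in blast)+
  then show ?thesis using L by simp
qed

lemma fib_ids_mono: "E \<le> E' \<Longrightarrow> fib_ids E V \<le> fib_ids E' V"
  by (rule LIMSEQ_le[OF fib_ids_limit[of _ 0] fib_ids_limit[of _ 0]])
     (auto intro!: exI[of _ 0] divide_right_mono fib_count_mono)

text \<open>Every box has at most two eigenvalues within \<open>\<delta>\<close> of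
  \<open>E\<close>, so the counts at \<open>E1\<close> and \<open>E2\<close> differ by at most 2,
  which disappears after division by \<open>n\<close>.\<close>

lemma fib_ids_locally_constant:
  assumes gap: "energy_gap (fib_potential V w) E \<delta>" and E: "\<bar>E1 - E\<bar> < \<delta>" "\<bar>E2 - E\<bar> < \<delta>" "E1 \<le> E2"
  shows "fib_ids E1 V = fib_ids E2 V"
proof (rule antisym)
  show "fib_ids E1 V \<le> fib_ids E2 V" by (rule fib_ids_mono[OF E(3)])
  have le: "real (fib_count E2 w V 1 (int n)) / real n \<le> real (fib_count E1 w V 1 (int n)) / real n + 2 / real n" for n
  proof -
    obtain r e where r: "box_spectral (fib_potential V w) n r e" "\<And>E. fib_count E w V 1 (int n) = card {i\<in>{..<n}. r i \<le> E}"
      using fib_box_data by metis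
    have "{i\<in>{..<n}. r i \<le> E2} \<subseteq> {i\<in>{..<n}. r i \<le> E1} \<union> {i\<in>{..<n}. \<bar>r i - E\<bar> < \<delta>}" using E by auto
    then have "card {i\<in>{..<n}. r i \<le> E2} \<le> card {i\<in>{..<n}. r i \<le> E1} + card {i\<in>{..<n}. \<bar>r i - E\<bar> < \<delta>}"
      by (intro order_trans[OF card_mono card_Un_le]) auto
    also have "card {i\<in>{..<n}. \<bar>r i - E\<bar> < \<delta>} \<le> 2" by (rule energy_gap_card_le[OF r(1) gap])
    finally have "real (fib_count E2 w V 1 (int n)) \<le> real (fib_count E1 w V 1 (int n)) + 2" unfolding r(2) by simp
    then show ?thesis unfolding add_divide_distrib[symmetric] by (rule divide_right_mono) simp
  qed
  have "(\<lambda>n. real (fib_count E1 w V 1 (int n)) / real n + 2 / real n) \<longlonglongrightarrow> fib_ids E1 V + 0"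
    by (intro tendsto_add fib_ids_limit lim_const_over_n)
  then show "fib_ids E2 V \<le> fib_ids E1 V"
    using LIMSEQ_le[OF fib_ids_limit[of E2 w V]] le by fastforce
qed

text \<open>The number of visits is a rotation sum of the indicator. Half of the mean leaves room
  for the averaging error, and \<open>C\<close> covers orbits too short for averaging.\<close>

lemma arc_visits:
  assumes "0 \<le> a" "a < b" "b \<le> 1"
  shows "\<exists>C. \<forall>K w. real (card {t\<in>{..<K}. frac (w + real t * fib_alpha) \<in> {a..<b}}) \<ge> real K * ((b - a) / 2) - C"
proof -
  define h where "h x = (indicator {a..<b} (frac x) :: real)" for x
  have M: "has_mean h (b - a)" unfolding h_def by (rule has_mean_arc) (use assms in auto)
  have p: "(b - a) / 2 > 0" using assms by simp
  obtain K0 where K0: "K0 > 0" "\<And>K w. K \<ge> K0 \<Longrightarrow> norm (rot_avg h K w - (b - a)) < (b - a) / 2"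
    by (rule has_meanD[OF M p]) blast
  have "real (card {t\<in>{..<K}. frac (w + real t * fib_alpha) \<in> {a..<b}}) \<ge> real K * ((b - a) / 2) - real K0" for K w
  proof -
    have card: "real (card {t\<in>{..<K}. frac (w + real t * fib_alpha) \<in> {a..<b}}) = (\<Sum>t<K. h (w + real t * fib_alpha))"
    proof -
      have "{t\<in>{..<K}. frac (w + real t * fib_alpha) \<in> {a..<b}} = {..<K} \<inter> {t. frac (w + real t * fib_alpha) \<in> {a..<b}}" by blast
      then show ?thesis unfolding h_def indicator_def by (simp add: sum.If_cases del: atLeastLessThan_iff)
    qed
    show ?thesis
    proof (cases "K \<ge> K0")
      case True
      then have "rot_avg h K w \<ge> (b - a) / 2" using K0(2)[OF True, of w] unfolding real_norm_def abs_less_iff by (simp add: field_simps)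
      then have "real K * ((b - a) / 2) \<le> real K * rot_avg h K w" by (intro mult_left_mono) auto
      also have "\<dots> = (\<Sum>t<K. h (w + real t * fib_alpha))" using True K0(1) by (simp add: rot_avg_def)
      finally show ?thesis unfolding card by simp
    next
      case False
      have "real K * ((b - a) / 2) \<le> real K0 * 1" using False assms by (intro mult_mono) auto
      then show ?thesis by simp
    qed
  qed
  then show ?thesis by blast
qed

lemma frac_alpha_multiple: "j > 0 \<Longrightarrow> 0 < frac (real j * fib_alpha)"
  using frac_label(1)[of "int j"] by simp

text \<open>\<open>d\<close> is at most the distance of \<open>j * fib_alpha\<close> to the integers
  for all \<open>1 \<le> j \<le> L\<close>, so an orbit needs more than \<open>L\<close> steps to
  return to an arc of length \<open>d\<close>. This keeps copies of a finitely supported vector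
  apart.\<close>

lemma arc_return_time:
  fixes L :: nat
  obtains d where "d > 0" "\<And>s t w a. s < t \<Longrightarrow> t - s \<le> L \<Longrightarrow> frac (w + real s * fib_alpha) \<in> {a..<a + d} \<Longrightarrow>
    frac (w + real t * fib_alpha) \<in> {a..<a + d} \<Longrightarrow> False"
proof -
  define D where "D = insert 1 ((\<lambda>j. min (frac (real j * fib_alpha)) (1 - frac (real j * fib_alpha))) ` {1..L})"
  define d where "d = Min D"
  have D: "finite D" "D \<noteq> {}" by (auto simp: D_def)
  have "\<forall>x\<in>D. 0 < x" using frac_alpha_multiple frac_lt_1 by (auto simp: D_def)
  then have "d > 0" unfolding d_def using D by simp
  moreover have False
    if st: "s < t" "t - s \<le> L" and s: "frac (w + real s * fib_alpha) \<in> {a..<a + d}" and t: "frac (w + real t * fib_alpha) \<in> {a..<a + d}"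
    for s t w a
  proof -
    define j where "j = t - s"
    have "j \<in> {1..L}" using st by (auto simp: j_def)
    then have "min (frac (real j * fib_alpha)) (1 - frac (real j * fib_alpha)) \<in> D" by (simp add: D_def)
    then have "d \<le> min (frac (real j * fib_alpha)) (1 - frac (real j * fib_alpha))" unfolding d_def using D by (intro Min_le)
    then have dj: "d \<le> frac (real j * fib_alpha)" "d \<le> 1 - frac (real j * fib_alpha)" by auto
    have "real t = real s + real j" using st by (simp add: j_def of_nat_diff)
    then have "w + real t * fib_alpha = (w + real s * fib_alpha) + real j * fib_alpha" by (simp add: algebra_simps)
    then have "frac (w + real t * fib_alpha) = (if frac (w + real s * fib_alpha) + frac (real j * fib_alpha) < 1
      then frac (w + real s * fib_alpha) + frac (real j * fib_alpha) else frac (w + real s * fib_alpha) + frac (real j * fib_alpha) - 1)"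
      by (simp only: frac_add)
    then show False using s t dj by (auto split: if_splits)
  qed
  ultimately show ?thesis using that by blast
qed

lemma sum_shift_int:
  fixes f :: "int \<Rightarrow> real"
  assumes "{a + c..b + c} \<subseteq> {p..q}" "\<And>k. k \<notin> {a..b} \<Longrightarrow> f k = 0"
  shows "(\<Sum>k\<in>{p..q}. f (k - c)) = (\<Sum>k\<in>{a..b}. f k)"
proof -
  have "(\<Sum>k\<in>{a..b}. f k) = (\<Sum>k\<in>{a + c..b + c}. f (k - c))"
    by (rule sum.reindex_bij_witness[of _ "\<lambda>k. k - c" "\<lambda>k. k + c"]) auto
  also have "\<dots> = (\<Sum>k\<in>{p..q}. f (k - c))"
  proof (rule sum.mono_neutral_left)
    show "\<forall>k\<in>{p..q} - {a + c..b + c}. f (k - c) = 0" using assms(2) by auto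
  qed (use assms(1) in auto)
  finally show ?thesis by simp
qed

text \<open>An approximate eigenvector recurs with positive frequency at well separated places, and each
  copy forces an eigenvalue near \<open>E\<close>.\<close>

lemma fib_ids_increases:
  assumes no: "\<not> energy_gap (fib_potential V w) E \<delta>" and \<delta>: "\<delta> > 0"
  shows "fib_ids (E - \<delta>) V < fib_ids (E + \<delta>) V"
proof -
  define v where "v = fib_potential V w"
  obtain \<psi> a b where out: "\<And>k. k \<notin> {a..b} \<Longrightarrow> \<psi> k = 0"
    and lt: "(\<Sum>k\<in>{a - 1..b + 1}. (jacobi v E \<psi> k)\<^sup>2) < \<delta>\<^sup>2 * (\<Sum>k\<in>{a..b}. (\<psi> k)\<^sup>2)"
    using no unfolding energy_gap_def v_def by (auto simp: not_le)
  obtain d1 where d1: "d1 > 0" "\<And>y k. frac w \<le> y \<Longrightarrow> y < frac w + d1 \<Longrightarrow> k \<in> {a - 1..b + 1} \<Longrightarrow> fib_potential V y k = fib_potential V (frac w) k"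
    by (rule fib_potential_locally_constant[OF finite_atLeastAtMost_int[of "a - 1" "b + 1"], of "frac w" V]) blast
  \<comment> \<open>Two translates of the window \<open>{a - 1..b + 1}\<close> can meet only if they
    are at most \<open>b - a + 2\<close> apart.\<close>
  define L where "L = nat (b - a + 4)"
  obtain d2 where d2: "d2 > 0" "\<And>s t w a. s < t \<Longrightarrow> t - s \<le> L \<Longrightarrow> frac (w + real s * fib_alpha) \<in> {a..<a + d2} \<Longrightarrow>
    frac (w + real t * fib_alpha) \<in> {a..<a + d2} \<Longrightarrow> False"
    by (rule arc_return_time[of L]) blast
  \<comment> \<open>The arc starts at \<open>frac w\<close> because the potential is right
    continuous in the phase. \<open>d1\<close> preserves the potential on the window,
    \<open>d2\<close> separates the visits, and the last bound keeps the arc inside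
    \<open>[0,1)\<close>.\<close>
  define d where "d = min (min d1 d2) (1 - frac w)"
  have d: "d > 0" "d \<le> d1" "d \<le> d2" "frac w + d \<le> 1" using d1 d2 frac_lt_1[of w] by (auto simp: d_def)
  \<comment> \<open>Margins that keep every translated window, including its two extra sites, inside
    the box.\<close>
  define t0 t1 where "t0 = nat \<bar>a\<bar> + 2" and "t1 = nat \<bar>b\<bar> + 2"
  have d0: "0 \<le> frac w" "frac w < frac w + d" using d(1) by auto
  obtain C where C: "\<And>K w'. real (card {t\<in>{..<K}. frac (w' + real t * fib_alpha) \<in> {frac w..<frac w + d}})
      \<ge> real K * ((frac w + d - frac w) / 2) - C"
    using arc_visits[OF d0 d(4)] by blast
  have main: "real (fib_count (E + \<delta>) w V 1 (int n)) - real (fib_count (E - \<delta>) w V 1 (int n)) \<ge> real (n - (t0 + t1)) * (d / 2) - C" for n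
  proof -
    obtain r e where r: "box_spectral v n r e" "\<And>E. fib_count E w V 1 (int n) = card {i\<in>{..<n}. r i \<le> E}"
      using fib_box_data unfolding v_def by metis
    define T where "T = {t. t0 \<le> t \<and> t + t1 < n \<and> frac (w + real t * fib_alpha) \<in> {frac w..<frac w + d}}"
    have Tfin: "finite T" by (rule finite_subset[of _ "{..<n}"]) (auto simp: T_def)
    have "{t\<in>{..<n - (t0 + t1)}. frac ((w + real t0 * fib_alpha) + real t * fib_alpha) \<in> {frac w..<frac w + d}} = (\<lambda>t. t - t0) ` T"
    proof (intro equalityI subsetI)
      fix t assume "t \<in> {t\<in>{..<n - (t0 + t1)}. frac ((w + real t0 * fib_alpha) + real t * fib_alpha) \<in> {frac w..<frac w + d}}"
      then have "t + t0 \<in> T" by (auto simp: T_def algebra_simps)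
      then show "t \<in> (\<lambda>t. t - t0) ` T" by (intro image_eqI[of _ _ "t + t0"]) auto
    next
      fix t assume "t \<in> (\<lambda>t. t - t0) ` T"
      then obtain u where u: "u \<in> T" "t = u - t0" by blast
      then have "real u = real t0 + real t" by (auto simp: T_def)
      then have eq: "(w + real t0 * fib_alpha) + real t * fib_alpha = w + real u * fib_alpha" by (simp add: algebra_simps)
      have "t \<in> {..<n - (t0 + t1)}" "frac (w + real u * fib_alpha) \<in> {frac w..<frac w + d}" using u by (auto simp: T_def)
      then show "t \<in> {t\<in>{..<n - (t0 + t1)}. frac ((w + real t0 * fib_alpha) + real t * fib_alpha) \<in> {frac w..<frac w + d}}"
        unfolding mem_Collect_eq eq by blast
    qed
    then have "real (n - (t0 + t1)) * (d / 2) - C \<le> real (card ((\<lambda>t. t - t0) ` T))"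
      using C[where K = "n - (t0 + t1)" and w' = "w + real t0 * fib_alpha"] by simp
    also have "\<dots> \<le> real (card T)" using card_image_le[OF Tfin] by simp
    also have "card T \<le> card {i\<in>{..<n}. \<bar>r i - E\<bar> < \<delta>}"
    proof (rule card_ge_test_vectors[where f = "\<lambda>t k. \<psi> (k - int t)", OF r(1) Tfin _ _ _ _ \<delta>])
      fix t k assume t: "t \<in> T" and k: "k \<notin> {1..int n}"
      show "\<psi> (k - int t) = 0" by (rule out) (use t k in \<open>auto simp: T_def t0_def t1_def\<close>)
    next
      have far: "k - int s \<notin> {a - 1..b + 1} \<or> k - int t \<notin> {a - 1..b + 1}" if "s \<in> T" "t \<in> T" "s < t" for s t k
      proof (rule ccontr)
        assume "\<not> ?thesis"
        then have "t - s \<le> L" using that by (auto simp: L_def)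
        moreover have "frac (w + real s * fib_alpha) \<in> {frac w..<frac w + d2}" "frac (w + real t * fib_alpha) \<in> {frac w..<frac w + d2}"
          using that d(3) by (auto simp: T_def)
        ultimately show False using d2(2) that(3) by blast
      qed
      then have far: "k - int s \<notin> {a - 1..b + 1} \<or> k - int t \<notin> {a - 1..b + 1}" if "s \<in> T" "t \<in> T" "s \<noteq> t" for s t k
        using that by (metis linorder_neqE_nat)
      have outJ: "jacobi v E (\<lambda>k. \<psi> (k - int t)) k = 0" if "k - int t \<notin> {a - 1..b + 1}" for t k
      proof -
        have "\<psi> (k - int t) = 0" "\<psi> (k + 1 - int t) = 0" "\<psi> (k - 1 - int t) = 0" using that by (auto intro!: out)
        then show ?thesis by (simp add: jacobi_def)
      qed
      fix s t k assume st: "s \<in> T" "t \<in> T" "s \<noteq> t"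
      show "jacobi v E (\<lambda>k. \<psi> (k - int s)) k * jacobi v E (\<lambda>k. \<psi> (k - int t)) k = 0"
        using far[OF st, of k] outJ by auto
      have "\<psi> (k - int t) = 0" if "k - int t \<notin> {a - 1..b + 1}" for t using that by (auto intro!: out)
      then show "\<psi> (k - int s) * \<psi> (k - int t) = 0" using far[OF st, of k] by auto
    next
      fix t assume t: "t \<in> T"
      have pot: "v (k + int t) = v k" if "k \<in> {a - 1..b + 1}" for k
      proof -
        have "v (k + int t) = fib_potential V (frac (w + real t * fib_alpha)) k"
          unfolding v_def fib_potential_shift fib_potential_frac ..
        also have "\<dots> = fib_potential V (frac w) k"
          by (rule d1(2)[OF _ _ that]) (use t d(2) in \<open>auto simp: T_def\<close>)
        finally show ?thesis by (simp add: v_def fib_potential_frac)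
      qed
      have outJ: "jacobi v E \<psi> k = 0" if "k \<notin> {a - 1..b + 1}" for k
      proof -
        have "\<psi> k = 0" "\<psi> (k + 1) = 0" "\<psi> (k - 1) = 0" using that by (auto intro!: out)
        then show ?thesis by (simp add: jacobi_def)
      qed
      have J: "jacobi v E (\<lambda>k. \<psi> (k - int t)) k = jacobi v E \<psi> (k - int t)" for k
      proof (cases "k - int t \<in> {a - 1..b + 1}")
        case True
        have "v k = v (k - int t)" using pot[OF True] by simp
        moreover have "k + 1 - int t = k - int t + 1" "k - 1 - int t = k - int t - 1" by simp_all
        ultimately show ?thesis unfolding jacobi_def by (simp only:)
      next
        case False
        then have "\<psi> (k - int t) = 0" "\<psi> (k + 1 - int t) = 0" "\<psi> (k - 1 - int t) = 0" by (auto intro!: out)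
        then have "jacobi v E (\<lambda>k. \<psi> (k - int t)) k = 0" by (simp add: jacobi_def)
        then show ?thesis using outJ[OF False] by simp
      qed
      have sub: "{a - 1 + int t..b + 1 + int t} \<subseteq> {1..int n}" "{a + int t..b + int t} \<subseteq> {1..int n}"
        using t by (auto simp: T_def t0_def t1_def)
      have "(\<Sum>k\<in>{1..int n}. (jacobi v E (\<lambda>k. \<psi> (k - int t)) k)\<^sup>2) = (\<Sum>k\<in>{a - 1..b + 1}. (jacobi v E \<psi> k)\<^sup>2)"
        unfolding J by (rule sum_shift_int[OF sub(1), of "\<lambda>k. (jacobi v E \<psi> k)\<^sup>2"]) (simp add: outJ)
      moreover have "(\<Sum>k\<in>{1..int n}. (\<psi> (k - int t))\<^sup>2) = (\<Sum>k\<in>{a..b}. (\<psi> k)\<^sup>2)"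
        by (rule sum_shift_int[OF sub(2), of "\<lambda>k. (\<psi> k)\<^sup>2"]) (simp add: out)
      ultimately show "(\<Sum>k\<in>{1..int n}. (jacobi v E (\<lambda>k. \<psi> (k - int t)) k)\<^sup>2) < \<delta>\<^sup>2 * (\<Sum>k\<in>{1..int n}. (\<psi> (k - int t))\<^sup>2)"
        using lt by simp
    qed
    also have "card {i\<in>{..<n}. \<bar>r i - E\<bar> < \<delta>} \<le> card ({i\<in>{..<n}. r i \<le> E + \<delta>} - {i\<in>{..<n}. r i \<le> E - \<delta>})"
      by (rule card_mono) auto
    also have "\<dots> = card {i\<in>{..<n}. r i \<le> E + \<delta>} - card {i\<in>{..<n}. r i \<le> E - \<delta>}"
      by (rule card_Diff_subset) (use \<delta> in auto)
    finally have fin: "real (n - (t0 + t1)) * (d / 2) - C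
      \<le> real (card {i\<in>{..<n}. r i \<le> E + \<delta>} - card {i\<in>{..<n}. r i \<le> E - \<delta>})" by simp
    have "card {i\<in>{..<n}. r i \<le> E - \<delta>} \<le> card {i\<in>{..<n}. r i \<le> E + \<delta>}"
      by (rule card_mono) (use \<delta> in auto)
    then show ?thesis using fin unfolding r(2) by (simp only: of_nat_diff)
  qed
  have "(\<lambda>n. real (fib_count (E + \<delta>) w V 1 (int n)) / real n - real (fib_count (E - \<delta>) w V 1 (int n)) / real n)
      \<longlonglongrightarrow> fib_ids (E + \<delta>) V - fib_ids (E - \<delta>) V"
    by (intro tendsto_diff fib_ids_limit)
  moreover have "(\<lambda>n. d / 2 - (real (t0 + t1) * (d / 2) + C) / real n) \<longlonglongrightarrow> d / 2 - 0"
    by (intro tendsto_diff tendsto_const lim_const_over_n)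
  moreover have "\<exists>N. \<forall>n\<ge>N. d / 2 - (real (t0 + t1) * (d / 2) + C) / real n
      \<le> real (fib_count (E + \<delta>) w V 1 (int n)) / real n - real (fib_count (E - \<delta>) w V 1 (int n)) / real n"
  proof (intro exI allI impI)
    fix n assume n: "n \<ge> t0 + t1 + 1"
    have "d / 2 - (real (t0 + t1) * (d / 2) + C) / real n = (real (n - (t0 + t1)) * (d / 2) - C) / real n"
      using n by (simp add: field_simps of_nat_diff)
    also have "\<dots> \<le> (real (fib_count (E + \<delta>) w V 1 (int n)) - real (fib_count (E - \<delta>) w V 1 (int n))) / real n"
      by (rule divide_right_mono[OF main]) simp
    finally show "d / 2 - (real (t0 + t1) * (d / 2) + C) / real n
      \<le> real (fib_count (E + \<delta>) w V 1 (int n)) / real n - real (fib_count (E - \<delta>) w V 1 (int n)) / real n"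
      by (simp add: diff_divide_distrib)
  qed
  ultimately have "d / 2 - 0 \<le> fib_ids (E + \<delta>) V - fib_ids (E - \<delta>) V" by (intro LIMSEQ_le)
  then show ?thesis using d(1) by simp
qed

section \<open>Oscillation theory near the free energies\<close>

lemma sign_prod_card:
  fixes E :: real and n :: nat and r :: "nat \<Rightarrow> real"
  assumes "(\<Prod>i<n. E - r i) \<noteq> 0"
  shows "0 < (- 1) ^ card {i\<in>{..<n}. E < r i} * (\<Prod>i<n. E - r i)"
  using assms
proof (induction n)
  case (Suc n)
  then have IH: "0 < (- 1) ^ card {i\<in>{..<n}. E < r i} * (\<Prod>i<n. E - r i)" and ne: "E \<noteq> r n" by auto
  have split: "{i\<in>{..<Suc n}. E < r i} = (if E < r n then insert n {i\<in>{..<n}. E < r i} else {i\<in>{..<n}. E < r i})"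
    by (auto simp: less_Suc_eq)
  show ?case
  proof (cases "E < r n")
    case True
    then have "0 < ((- 1) ^ card {i\<in>{..<n}. E < r i} * (\<Prod>i<n. E - r i)) * (r n - E)"
      using mult_pos_pos[OF IH, of "r n - E"] by simp
    moreover have "card {i\<in>{..<Suc n}. E < r i} = Suc (card {i\<in>{..<n}. E < r i})"
      unfolding split using True by simp
    ultimately show ?thesis by (simp add: algebra_simps)
  next
    case False
    then have "0 < ((- 1) ^ card {i\<in>{..<n}. E < r i} * (\<Prod>i<n. E - r i)) * (E - r n)"
      using mult_pos_pos[OF IH, of "E - r n"] ne by simp
    then show ?thesis unfolding split using False by (simp add: mult.assoc)
  qed
qed simp

lemma fib_count_roots:
  assumes "jacobi_poly (\<lambda>k. fib_potential V w (int k)) n = (\<Prod>i<n. [:- r i, 1:])" and "inj_on r {..<n}"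
  shows "fib_count E w V 1 (int n) + card {i\<in>{..<n}. E < r i} = n"
proof -
  obtain e where "box_spectral (fib_potential V w) n r e" using box_spectral_exists[OF assms] by blast
  then have "fib_count E w V 1 (int n) = card {i\<in>{..<n}. r i \<le> E}" by (rule fib_count_eq_card[OF assms])
  moreover have "card {i\<in>{..<n}. r i \<le> E} + card {i\<in>{..<n}. E < r i} = card ({i\<in>{..<n}. r i \<le> E} \<union> {i\<in>{..<n}. E < r i})"
    by (rule card_Un_disjoint[symmetric]) (auto intro: finite_subset[of _ "{..<n}"])
  moreover have "{i\<in>{..<n}. r i \<le> E} \<union> {i\<in>{..<n}. E < r i} = {..<n}" by auto
  ultimately show ?thesis by simp
qed

text \<open>A root \<open>r i\<close> above \<open>E\<close> forces \<open>s (Suc i)\<close> above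
  \<open>E\<close>; conversely \<open>s i\<close> above \<open>E\<close> with \<open>i < n\<close>
  forces \<open>r i\<close> above \<open>E\<close>, so that only \<open>s n\<close> can be
  additional.\<close>

lemma interlaces_card:
  fixes E :: real
  assumes "interlaces n r s"
  shows "card {i\<in>{..<n}. E < r i} \<le> card {i\<in>{..<Suc n}. E < s i}"
    "card {i\<in>{..<Suc n}. E < s i} \<le> Suc (card {i\<in>{..<n}. E < r i})"
proof -
  have "Suc ` {i\<in>{..<n}. E < r i} \<subseteq> {i\<in>{..<Suc n}. E < s i}"
    using assms by (auto simp: interlaces_def intro: less_trans)
  then have "card (Suc ` {i\<in>{..<n}. E < r i}) \<le> card {i\<in>{..<Suc n}. E < s i}" by (intro card_mono) auto
  then show "card {i\<in>{..<n}. E < r i} \<le> card {i\<in>{..<Suc n}. E < s i}" by (simp add: card_image)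
  have "{i\<in>{..<Suc n}. E < s i} \<subseteq> insert n {i\<in>{..<n}. E < r i}"
    using assms by (auto simp: interlaces_def less_Suc_eq intro: less_trans)
  then have "card {i\<in>{..<Suc n}. E < s i} \<le> card (insert n {i\<in>{..<n}. E < r i})" by (intro card_mono) auto
  then show "card {i\<in>{..<Suc n}. E < s i} \<le> Suc (card {i\<in>{..<n}. E < r i})"
    using card_insert_le_m1 by (simp add: card_insert_if split: if_splits)
qed

text \<open>Eigenvalues above \<open>E\<close>, rather than below, because the parity of their
  number is the sign of the monic characteristic polynomial at \<open>E\<close>. The subtraction
  loses nothing, by \<open>fib_count_le\<close>.\<close>

definition above_count :: "real \<Rightarrow> real \<Rightarrow> real \<Rightarrow> nat \<Rightarrow> nat" where
  "above_count E w V n = n - fib_count E w V 1 (int n)"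

lemma above_count_roots:
  assumes "jacobi_poly (\<lambda>k. fib_potential V w (int k)) n = (\<Prod>i<n. [:- r i, 1:])" and "inj_on r {..<n}"
  shows "above_count E w V n = card {i\<in>{..<n}. E < r i}"
  using fib_count_roots[OF assms, of E] by (simp add: above_count_def)

lemma above_count_step:
  "above_count E w V n \<le> above_count E w V (Suc n)" "above_count E w V (Suc n) \<le> Suc (above_count E w V n)"
proof -
  obtain r s where rs: "jacobi_poly (\<lambda>k. fib_potential V w (int k)) n = (\<Prod>i<n. [:- r i, 1:])"
    "jacobi_poly (\<lambda>k. fib_potential V w (int k)) (Suc n) = (\<Prod>i<Suc n. [:- s i, 1:])" "interlaces n r s"
    using jacobi_poly_roots by blast
  have "inj_on s {..<Suc n}"
  proof (rule inj_onI)
    fix i j assume "i \<in> {..<Suc n}" "j \<in> {..<Suc n}" "s i = s j"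
    then show "i = j" using interlaces_mono[OF rs(3), of i j] interlaces_mono[OF rs(3), of j i]
      by (cases i j rule: linorder_cases) auto
  qed
  then show "above_count E w V n \<le> above_count E w V (Suc n)" "above_count E w V (Suc n) \<le> Suc (above_count E w V n)"
    unfolding above_count_roots[OF rs(1) interlaces_inj[OF rs(3)]] above_count_roots[OF rs(2) \<open>inj_on s {..<Suc n}\<close>]
    using interlaces_card[OF rs(3)] by blast+
qed

lemma above_count_sign:
  assumes "poly (jacobi_poly (\<lambda>k. fib_potential V w (int k)) n) E \<noteq> 0"
  shows "0 < (- 1) ^ above_count E w V n * poly (jacobi_poly (\<lambda>k. fib_potential V w (int k)) n) E"
proof -
  obtain r s where rs: "jacobi_poly (\<lambda>k. fib_potential V w (int k)) n = (\<Prod>i<n. [:- r i, 1:])" "interlaces n r s"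
    using jacobi_poly_roots by blast
  have "poly (jacobi_poly (\<lambda>k. fib_potential V w (int k)) n) E = (\<Prod>i<n. E - r i)" unfolding rs(1) poly_prod by simp
  then show ?thesis using assms sign_prod_card[where n = n and E = E and r = r] above_count_roots[OF rs(1) interlaces_inj[OF rs(2)], of E] by simp
qed

text \<open>\<open>D\<close> and the integer part of \<open>Y\<close> advance by at most one per step and have the same parity, so they
  agree; steps at which \<open>Y\<close> is an integer carry no sign information and are skipped.\<close>

lemma rotation_count:
  fixes D :: "nat \<Rightarrow> int" and Y :: "nat \<Rightarrow> real"
  assumes D0: "D 0 = 0" and Y1: "0 < Y 1" "Y 1 < 1"
    and Y: "\<And>n. 0 < Y (Suc n) - Y n" "\<And>n. Y (Suc n) - Y n < 1"
    and D: "\<And>n. D n \<le> D (Suc n)" "\<And>n. D (Suc n) \<le> D n + 1"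
    and par: "\<And>n. Y (Suc n) \<notin> \<int> \<Longrightarrow> even (D n - \<lfloor>Y (Suc n)\<rfloor>)"
  shows "\<bar>of_int (D n) - Y (Suc n)\<bar> \<le> 2"
proof -
  have nint: "y \<notin> \<int>" if "of_int j < y" "y < of_int (j + 1)" for y :: real and j
    using that by (auto elim!: Ints_cases)
  have fl: "\<lfloor>y\<rfloor> = j" if "of_int j \<le> y" "y < of_int (j + 1)" for y :: real and j
    using that by (intro floor_unique) auto
  have main: "Y (Suc n) \<notin> \<int> \<longrightarrow> D n = \<lfloor>Y (Suc n)\<rfloor>" for n
  proof (induction n rule: less_induct)
    case (less n)
    show ?case
    proof (intro impI)
      assume ni: "Y (Suc n) \<notin> \<int>"
      show "D n = \<lfloor>Y (Suc n)\<rfloor>"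
      proof (cases n)
        case 0 then show ?thesis using Y1 D0 fl[of 0 "Y 1"] by simp
      next
        case (Suc k)
        show ?thesis
        proof (cases "Y (Suc k) \<in> \<int>")
          case False
          define f where "f = \<lfloor>Y (Suc k)\<rfloor>"
          have "D k = f" using less.IH[of k] Suc False by (simp add: f_def)
          then have Df: "D n = f \<or> D n = f + 1" using D[of k] Suc by auto
          have "of_int f < Y (Suc n)" "Y (Suc n) < of_int f + 2"
            using Y[of "Suc k"] Suc of_int_floor_le[of "Y (Suc k)"] real_of_int_floor_add_one_gt[of "Y (Suc k)"]
            unfolding f_def Suc by linarith+
          then have "\<lfloor>Y (Suc n)\<rfloor> = f \<or> \<lfloor>Y (Suc n)\<rfloor> = f + 1"
            using fl[of f "Y (Suc n)"] fl[of "f + 1" "Y (Suc n)"] by (cases "Y (Suc n) < of_int (f + 1)") auto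
          then show ?thesis using Df par[OF ni] by auto
        next
          case True
          then obtain j where j: "Y (Suc k) = of_int j" by (auto elim: Ints_cases)
          have "k \<noteq> 0"
          proof
            assume "k = 0"
            then show False using Y1 nint[of 0 "Y 1"] True by simp
          qed
          then obtain l where l: "k = Suc l" by (cases k) auto
          \<comment> \<open>Steps are positive and shorter than 1, so one step before the integer
            \<open>j\<close> the value lies strictly between \<open>j - 1\<close> and
            \<open>j\<close>, where the induction hypothesis applies.\<close>
          have Yl: "of_int (j - 1) < Y (Suc l)" "Y (Suc l) < of_int (j - 1 + 1)" using Y[of "Suc l"] j l by auto
          have "D l = j - 1" using less.IH[of l] Suc l nint[OF Yl] fl[of "j - 1" "Y (Suc l)"] Yl by auto
          then have "D n = j - 1 \<or> D n = j \<or> D n = j + 1" using D[of l] D[of k] Suc l by auto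
          moreover have "\<lfloor>Y (Suc n)\<rfloor> = j" by (rule fl) (use Y[of "Suc k"] j Suc in auto)
          ultimately show ?thesis using par[OF ni] by auto
        qed
      qed
    qed
  qed
  show ?thesis
  proof (cases "Y (Suc n) \<in> \<int>")
    case False
    then have "D n = \<lfloor>Y (Suc n)\<rfloor>" using main by blast
    then show ?thesis using of_int_floor_le[of "Y (Suc n)"] real_of_int_floor_add_one_gt[of "Y (Suc n)"] by linarith
  next
    case True
    then obtain j where j: "Y (Suc n) = of_int j" by (auto elim: Ints_cases)
    have "n \<noteq> 0"
    proof
      assume "n = 0"
      then show False using Y1 nint[of 0 "Y 1"] True by simp
    qed
    then obtain l where l: "n = Suc l" by (cases n) auto
    have Yl: "of_int (j - 1) < Y (Suc l)" "Y (Suc l) < of_int (j - 1 + 1)" using Y[of "Suc l"] j l by auto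
    have "D l = j - 1" using main[of l] nint[OF Yl] fl[of "j - 1" "Y (Suc l)"] Yl by auto
    then have "D n = j - 1 \<or> D n = j" using D[of l] l by auto
    then show ?thesis using j by auto
  qed
qed

lemma sin_pi_floor_sign:
  assumes "y \<notin> \<int>" shows "0 < (if even \<lfloor>y\<rfloor> then 1 else - 1) * sin (pi * y)"
proof -
  define f where "f = \<lfloor>y\<rfloor>"
  define t where "t = y - of_int f"
  have "y \<noteq> of_int f" using assms by auto
  then have t: "0 < t" "t < 1"
    using of_int_floor_le[of y] real_of_int_floor_add_one_gt[of y] unfolding t_def f_def by linarith+
  have s: "0 < sin (pi * t)" using t by (intro sin_gt_zero) auto
  have "pi * y = pi * t + of_int f * pi" by (simp add: t_def algebra_simps)
  then have "sin (pi * y) = (if even f then 1 else - 1) * sin (pi * t)"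
  proof -
    have "sin (of_int f * pi) = 0" by (simp add: sin_zero_iff_int2)
    moreover have "cos (of_int f * pi) = (if even f then 1 else - 1)"
      using cos_npi_int[of f] by (simp add: mult.commute)
    ultimately show ?thesis unfolding \<open>pi * y = pi * t + of_int f * pi\<close> sin_add by simp
  qed
  then show ?thesis using s by (auto simp: f_def)
qed

text \<open>\<open>u (Suc n)\<close> is the characteristic polynomial of the box at \<open>E\<close>
  and a positive multiple of \<open>sin (X (Suc n))\<close>. Phase steps are smaller than
  \<open>th\<close> and \<open>pi - th\<close>, so \<open>Y = X / pi\<close> advances by an amount
  in \<open>(0,1)\<close> per site, while the count above \<open>E\<close> grows by 0 or 1 and has
  the matching parity. The error 3 is the 2 of \<open>rotation_count\<close> plus the contribution
  \<open>1 - \<beta>\<close> of the extra site.\<close>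

lemma fib_count_phase:
  assumes m: "m \<noteq> 0" and V: "V > 0"
    and small: "2 * (V * (\<bar>lam\<bar> + 1) / sin (label_angle m)) < min (label_angle m) (pi - label_angle m)"
      "V * (\<bar>lam\<bar> + 1) / sin (label_angle m) \<le> 1/2"
  shows "\<bar>real (fib_count (2 * cos (label_angle m) + lam * V) 0 V 1 (int n))
     - (real n * frac (of_int m * fib_alpha) - fib_phase m lam V (Suc n) / pi)\<bar> \<le> 3"
proof -
  define th E d where "th = label_angle m" and "E = 2 * cos th + lam * V" and "d = V * (\<bar>lam\<bar> + 1) / sin th"
  have th: "0 < th" "th < pi" "sin th > 0" using label_angle_bounds[OF m] by (auto simp: th_def)
  define q where "q = jacobi_poly (\<lambda>k. fib_potential V 0 (int k))"
  define u where "u n = (case n of 0 \<Rightarrow> 0 | Suc k \<Rightarrow> poly (q k) E)" for n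
  have vg: "lam * V - fib_potential V 0 (int k) = V * fib_g lam k" for k
    by (simp add: fib_potential_def fib_g_def algebra_simps)
  have rec: "u (Suc (Suc n)) = (2 * cos th + V * fib_g lam (Suc n)) * u (Suc n) - u n" for n
  proof -
    have "2 * cos th + V * fib_g lam (Suc n) = E - fib_potential V 0 (int (Suc n))"
      using vg[of "Suc n"] by (simp add: E_def)
    then show ?thesis unfolding \<open>2 * cos th + V * fib_g lam (Suc n) = E - fib_potential V 0 (int (Suc n))\<close>
      by (cases n) (simp_all add: u_def q_def left_diff_distrib)
  qed
  have u01: "u 0 = 0" "u (Suc 0) = 1" by (simp_all add: u_def q_def)
  have sol: "u n = Im (prufer th V (fib_g lam) n * cis (th * real n))" for n
    by (rule prufer_solution[OF _ u01 rec]) (use th in simp)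
  have gb: "\<bar>fib_g lam n\<bar> \<le> \<bar>lam\<bar> + 1" for n by (rule fib_g_bound)
  have d2: "d \<le> 1/2" using small by (simp add: d_def th_def)
  note ctx = th(3) V gb d_def d2
  define X where "X n = th * real n + fib_phase m lam V n" for n
  have pz0: "prufer th V (fib_g lam) n \<noteq> 0" for n by (rule prufer_nonzero[OF ctx])
  have uX: "u n = norm (prufer th V (fib_g lam) n) * sin (X n)" for n
  proof -
    have "prufer th V (fib_g lam) n = of_real (norm (prufer th V (fib_g lam) n)) * cis (fib_phase m lam V n)"
      using prufer_polar[OF ctx] by (simp add: th_def)
    then have "prufer th V (fib_g lam) n * cis (th * real n)
        = (of_real (norm (prufer th V (fib_g lam) n)) * cis (fib_phase m lam V n)) * cis (th * real n)" by (rule arg_cong)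
    also have "\<dots> = of_real (norm (prufer th V (fib_g lam) n)) * cis (X n)"
      by (simp only: X_def mult.assoc cis_mult add.commute)
    finally show ?thesis unfolding sol by simp
  qed
  have step: "\<bar>fib_phase m lam V (Suc n) - fib_phase m lam V n\<bar> \<le> 2 * d" for n
    using prufer_phase_step[OF ctx] by (simp add: th_def)
  have dth: "2 * d < th" "2 * d < pi - th" using small by (simp_all add: d_def th_def)
  define Y where "Y n = X n / pi" for n
  have Xstep: "0 < X (Suc n) - X n" "X (Suc n) - X n < pi" for n
    using step[of n] dth by (auto simp: X_def algebra_simps abs_le_iff)
  have Y: "0 < Y (Suc n) - Y n" "Y (Suc n) - Y n < 1" for n
    using Xstep[of n] by (simp_all add: Y_def diff_divide_distrib[symmetric])
  have Y0: "Y 0 = 0" by (simp add: Y_def X_def prufer_phase_def)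
  have main: "\<bar>real_of_int (int (above_count E 0 V n)) - Y (Suc n)\<bar> \<le> 2"
  proof (rule rotation_count[where D = "\<lambda>n. int (above_count E 0 V n)" and Y = Y])
    show "0 < Y (Suc n) - Y n" "Y (Suc n) - Y n < 1" for n using Y by blast+
    show "int (above_count E 0 V 0) = 0" by (simp add: above_count_def)
    show "0 < Y 1" "Y 1 < 1" using Y[of 0] Y0 by simp_all
    show "int (above_count E 0 V n) \<le> int (above_count E 0 V (Suc n))" for n using above_count_step(1)[of E 0 V n] by simp
    show "int (above_count E 0 V (Suc n)) \<le> int (above_count E 0 V n) + 1" for n using above_count_step(2)[of E 0 V n] by simp
    fix n assume ni: "Y (Suc n) \<notin> \<int>"
    have XY: "X (Suc n) = pi * Y (Suc n)" by (simp add: Y_def)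
    have s: "0 < (if even \<lfloor>Y (Suc n)\<rfloor> then 1 else - 1) * sin (X (Suc n))"
      unfolding XY by (rule sin_pi_floor_sign[OF ni])
    then have "sin (X (Suc n)) \<noteq> 0" by auto
    then have "u (Suc n) \<noteq> 0" using uX pz0 by simp
    then have "0 < (- 1) ^ above_count E 0 V n * u (Suc n)"
      using above_count_sign[of V 0 n E] by (simp add: u_def q_def)
    then have "0 < norm (prufer th V (fib_g lam) (Suc n)) * ((- 1) ^ above_count E 0 V n * sin (X (Suc n)))"
      unfolding uX by (simp only: mult.left_commute)
    then have "0 < (- 1) ^ above_count E 0 V n * sin (X (Suc n))"
      by (rule zero_less_mult_pos) (use pz0 in simp)
    then show "even (int (above_count E 0 V n) - \<lfloor>Y (Suc n)\<rfloor>)"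
      using s by (cases "even (above_count E 0 V n)"; cases "even \<lfloor>Y (Suc n)\<rfloor>") auto
  qed
  have D: "real (above_count E 0 V n) = real n - real (fib_count E 0 V 1 (int n))"
    using fib_count_le[of E 0 V n] by (simp add: above_count_def of_nat_diff)
  define \<beta> where "\<beta> = frac (of_int m * fib_alpha)"
  have "th * real (Suc n) / pi = real (Suc n) * (1 - \<beta>)" by (simp add: th_def label_angle_def \<beta>_def)
  then have Y': "Y (Suc n) = real n - real n * \<beta> + (1 - \<beta>) + fib_phase m lam V (Suc n) / pi"
    unfolding Y_def X_def add_divide_distrib by (simp add: algebra_simps)
  have "0 < \<beta>" "\<beta> < 1" using frac_label[OF m] by (simp_all add: \<beta>_def)
  then have "\<bar>real (fib_count E 0 V 1 (int n)) - (real n * \<beta> - fib_phase m lam V (Suc n) / pi)\<bar> \<le> 3"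
    using main D Y' unfolding of_int_of_nat_eq by linarith
  then show ?thesis by (simp only: E_def th_def \<beta>_def)
qed

lemma fib_count_phase_eventually:
  assumes m: "m \<noteq> 0"
  shows "\<exists>V0>0. \<forall>V. 0 < V \<and> V < V0 \<longrightarrow> (\<forall>n. \<bar>real (fib_count (2 * cos (label_angle m) + lam * V) 0 V 1 (int n))
     - (real n * frac (of_int m * fib_alpha) - fib_phase m lam V (Suc n) / pi)\<bar> \<le> 3)"
proof -
  define s G l where "s = sin (label_angle m)" and "G = \<bar>lam\<bar> + 1" and "l = min (min (label_angle m) (pi - label_angle m)) 1"
  have p: "s > 0" "G > 0" "l > 0" using label_angle_bounds[OF m] by (auto simp: s_def G_def l_def add_nonneg_pos)
  define V0 where "V0 = l * s / (2 * G)"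
  have V0: "V0 > 0" using p by (simp add: V0_def)
  have "\<bar>real (fib_count (2 * cos (label_angle m) + lam * V) 0 V 1 (int n))
     - (real n * frac (of_int m * fib_alpha) - fib_phase m lam V (Suc n) / pi)\<bar> \<le> 3" if V: "0 < V" "V < V0" for V n
  proof (rule fib_count_phase[OF m V(1)])
    have "2 * (V * G / s) < l" using V(2) p by (simp add: V0_def field_simps)
    then have "2 * (V * G / s) < min (label_angle m) (pi - label_angle m)" "V * G / s \<le> 1/2"
      unfolding l_def by linarith+
    then show "2 * (V * (\<bar>lam\<bar> + 1) / sin (label_angle m)) < min (label_angle m) (pi - label_angle m)"
      "V * (\<bar>lam\<bar> + 1) / sin (label_angle m) \<le> 1/2" unfolding G_def s_def by blast+
  qed
  then show ?thesis using V0 by blast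
qed

lemma fib_ids_in_gap:
  assumes m: "m \<noteq> 0" and hyp: "\<bar>lam - fib_alpha\<bar> < norm (fib_mode m)"
  shows "\<exists>V0>0. \<forall>V. 0 < V \<and> V < V0 \<longrightarrow> fib_ids (2 * cos (label_angle m) + lam * V) V = frac (of_int m * fib_alpha)"
proof -
  define \<beta> where "\<beta> = frac (of_int m * fib_alpha)"
  obtain V1 where V1: "V1 > 0" "\<And>V n. 0 < V \<Longrightarrow> V < V1 \<Longrightarrow> \<bar>real (fib_count (2 * cos (label_angle m) + lam * V) 0 V 1 (int n))
     - (real n * \<beta> - fib_phase m lam V (Suc n) / pi)\<bar> \<le> 3"
    using fib_count_phase_eventually[OF m, of lam] unfolding \<beta>_def by blast
  obtain V2 where V2: "V2 > 0" "\<And>V. 0 < V \<Longrightarrow> V < V2 \<Longrightarrow> \<exists>M. \<forall>n. \<bar>fib_phase m lam V n\<bar> \<le> M"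
    using fib_phase_bounded[OF m hyp] by blast
  have "fib_ids (2 * cos (label_angle m) + lam * V) V = \<beta>" if V: "0 < V" "V < min V1 V2" for V
  proof -
    define f where "f n = real (fib_count (2 * cos (label_angle m) + lam * V) 0 V 1 (int n))" for n
    obtain M where M: "\<And>n. \<bar>fib_phase m lam V n\<bar> \<le> M" using V2(2) V by auto
    have bd: "\<bar>f n - real n * \<beta>\<bar> \<le> 3 + M / pi" for n
    proof -
      have "\<bar>fib_phase m lam V (Suc n) / pi\<bar> \<le> M / pi" using M[of "Suc n"] by (simp add: divide_right_mono)
      then show ?thesis using V1(2)[of V n] V unfolding f_def[symmetric] by linarith
    qed
    have "(\<lambda>n. f n / real n - \<beta>) \<longlonglongrightarrow> 0"
    proof (rule Lim_null_comparison)
      show "eventually (\<lambda>n. norm (f n / real n - \<beta>) \<le> (3 + M / pi) / real n) sequentially"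
        unfolding eventually_sequentially
      proof (intro exI[of _ 1] allI impI)
        fix n :: nat assume n: "1 \<le> n"
        have "f n / real n - \<beta> = (f n - real n * \<beta>) / real n" using n by (simp add: field_simps)
        then have "norm (f n / real n - \<beta>) = \<bar>f n - real n * \<beta>\<bar> / real n" by simp
        also have "\<dots> \<le> (3 + M / pi) / real n" by (rule divide_right_mono[OF bd]) simp
        finally show "norm (f n / real n - \<beta>) \<le> (3 + M / pi) / real n" .
      qed
    qed (rule lim_const_over_n)
    then have "(\<lambda>n. f n / real n) \<longlonglongrightarrow> \<beta>" by (rule LIM_zero_cancel)
    then show ?thesis using fib_ids_limit[of _ 0 V] LIMSEQ_unique unfolding f_def by blast
  qed
  then show ?thesis using V1(1) V2(1) unfolding \<beta>_def by (intro exI[of _ "min V1 V2"]) auto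
qed

text \<open>A phase moving against \<open>\<sigma>\<close> at rate at least
  \<open>\<epsilon>\<close> shifts \<open>\<sigma>\<close> times the eigenvalue density by at least
  \<open>\<epsilon> / pi\<close>, while the bounded errors vanish after division by
  \<open>n\<close>.\<close>

lemma fib_ids_off_gap:
  assumes m: "m \<noteq> 0" and sg: "\<sigma> = 1 \<or> \<sigma> = - 1" and ell: "\<sigma> * (lam - fib_alpha) > norm (fib_mode m)"
  shows "\<exists>V0>0. \<forall>V. 0 < V \<and> V < V0 \<longrightarrow> \<sigma> * fib_ids (2 * cos (label_angle m) + lam * V) V > \<sigma> * frac (of_int m * fib_alpha)"
proof -
  define \<beta> where "\<beta> = frac (of_int m * fib_alpha)"
  obtain V1 where V1: "V1 > 0" "\<And>V n. 0 < V \<Longrightarrow> V < V1 \<Longrightarrow> \<bar>real (fib_count (2 * cos (label_angle m) + lam * V) 0 V 1 (int n))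
     - (real n * \<beta> - fib_phase m lam V (Suc n) / pi)\<bar> \<le> 3"
    using fib_count_phase_eventually[OF m, of lam] unfolding \<beta>_def by blast
  obtain V2 where V2: "V2 > 0" "\<And>V. 0 < V \<Longrightarrow> V < V2 \<Longrightarrow> \<exists>\<epsilon>>0. \<exists>C. \<forall>n. \<sigma> * fib_phase m lam V n \<le> C - \<epsilon> * real n"
    using fib_phase_drifts[OF m sg ell] by blast
  have "\<sigma> * fib_ids (2 * cos (label_angle m) + lam * V) V > \<sigma> * \<beta>" if V: "0 < V" "V < min V1 V2" for V
  proof -
    define f where "f n = real (fib_count (2 * cos (label_angle m) + lam * V) 0 V 1 (int n))" for n
    obtain \<epsilon> C where \<epsilon>: "\<epsilon> > 0" "\<And>n. \<sigma> * fib_phase m lam V n \<le> C - \<epsilon> * real n" using V2(2)[of V] V by auto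
    have bd: "\<sigma> * \<beta> + \<epsilon> / pi - (3 + C / pi) / real n \<le> \<sigma> * (f n / real n)" if n: "n \<ge> 1" for n
    proof -
      have "\<sigma> * fib_phase m lam V (Suc n) \<le> C - \<epsilon> * real n" using \<epsilon>(2)[of "Suc n"] \<epsilon>(1) by (simp add: algebra_simps)
      then have "\<sigma> * fib_phase m lam V (Suc n) / pi \<le> (C - \<epsilon> * real n) / pi" by (simp add: divide_right_mono)
      then have "\<sigma> * (real n * \<beta>) + \<epsilon> / pi * real n - (3 + C / pi) \<le> \<sigma> * f n"
        using V1(2)[of V n] V sg unfolding f_def[symmetric] by (auto simp: diff_divide_distrib)
      then have "(\<sigma> * (real n * \<beta>) + \<epsilon> / pi * real n - (3 + C / pi)) / real n \<le> \<sigma> * f n / real n"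
        by (rule divide_right_mono) simp
      then show ?thesis using n by (simp add: add_divide_distrib diff_divide_distrib)
    qed
    have "(\<lambda>n. \<sigma> * \<beta> + \<epsilon> / pi - (3 + C / pi) / real n) \<longlonglongrightarrow> \<sigma> * \<beta> + \<epsilon> / pi - 0"
      by (intro tendsto_diff tendsto_const lim_const_over_n)
    moreover have "(\<lambda>n. \<sigma> * (f n / real n)) \<longlonglongrightarrow> \<sigma> * fib_ids (2 * cos (label_angle m) + lam * V) V"
      unfolding f_def by (intro tendsto_mult_left fib_ids_limit)
    ultimately have "\<sigma> * \<beta> + \<epsilon> / pi - 0 \<le> \<sigma> * fib_ids (2 * cos (label_angle m) + lam * V) V"
      by (rule LIMSEQ_le) (use bd in blast)
    moreover have "\<epsilon> / pi > 0" using \<epsilon> by simp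
    ultimately show ?thesis by linarith
  qed
  then show ?thesis using V1(1) V2(1) unfolding \<beta>_def by (intro exI[of _ "min V1 V2"]) auto
qed

section \<open>The spectrum\<close>

lemma ell2_L2_set_le:
  assumes "\<psi> \<in> ell2" "finite F" shows "L2_set (\<lambda>n. cmod (\<psi> n)) F \<le> ell2_norm \<psi>"
  unfolding L2_set_def ell2_norm_def
  using assms by (intro real_sqrt_le_mono finite_sum_le_infsum) (auto simp: ell2_def)

text \<open>Membership and norm bound both follow from bounds on finite sets. In this way the
  inequalities for \<open>L2_set\<close>, in particular Minkowski's, carry over to
  \<open>ell2\<close>.\<close>

lemma ell2_boundI:
  assumes "\<And>F. finite F \<Longrightarrow> L2_set (\<lambda>n. cmod (\<psi> n)) F \<le> K"
  shows "\<psi> \<in> ell2" "ell2_norm \<psi> \<le> K"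
proof -
  have K: "0 \<le> K" using assms[of "{}"] by simp
  have bd: "(\<Sum>n\<in>F. (cmod (\<psi> n))\<^sup>2) \<le> K\<^sup>2" if "finite F" for F
    using assms[OF that] real_sqrt_le_iff[of _ "K\<^sup>2"] K by (simp add: L2_set_def sqrt_le_D)
  have sm: "(\<lambda>n. (cmod (\<psi> n))\<^sup>2) summable_on UNIV"
    by (rule nonneg_bdd_above_summable_on) (auto intro!: bdd_aboveI2[where M = "K\<^sup>2"] bd)
  then show "\<psi> \<in> ell2" by (simp add: ell2_def)
  have "(\<Sum>\<^sub>\<infinity>n. (cmod (\<psi> n))\<^sup>2) \<le> K\<^sup>2"
    by (rule infsum_le_finite_sums[OF sm]) (use bd in auto)
  then show "ell2_norm \<psi> \<le> K" unfolding ell2_norm_def using K by (simp add: real_le_lsqrt infsum_nonneg)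
qed

lemma ell2_norm_nonneg: "0 \<le> ell2_norm \<psi>"
  by (simp add: ell2_norm_def infsum_nonneg)

lemma ell2_norm_square: "(ell2_norm \<psi>)\<^sup>2 = (\<Sum>\<^sub>\<infinity>n. (cmod (\<psi> n))\<^sup>2)"
  by (simp add: ell2_norm_def infsum_nonneg)

lemma ell2_add:
  assumes "\<psi> \<in> ell2" "\<phi> \<in> ell2"
  shows "(\<lambda>n. \<psi> n + \<phi> n) \<in> ell2" "ell2_norm (\<lambda>n. \<psi> n + \<phi> n) \<le> ell2_norm \<psi> + ell2_norm \<phi>"
proof -
  have "L2_set (\<lambda>n. cmod (\<psi> n + \<phi> n)) F \<le> ell2_norm \<psi> + ell2_norm \<phi>" if "finite F" for F
  proof -
    have "L2_set (\<lambda>n. cmod (\<psi> n + \<phi> n)) F \<le> L2_set (\<lambda>n. cmod (\<psi> n) + cmod (\<phi> n)) F"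
      by (intro L2_set_mono norm_triangle_ineq) auto
    also have "\<dots> \<le> L2_set (\<lambda>n. cmod (\<psi> n)) F + L2_set (\<lambda>n. cmod (\<phi> n)) F" by (rule L2_set_triangle_ineq)
    also have "\<dots> \<le> ell2_norm \<psi> + ell2_norm \<phi>" using assms that by (intro add_mono ell2_L2_set_le)
    finally show ?thesis .
  qed
  from ell2_boundI[OF this] show "(\<lambda>n. \<psi> n + \<phi> n) \<in> ell2" "ell2_norm (\<lambda>n. \<psi> n + \<phi> n) \<le> ell2_norm \<psi> + ell2_norm \<phi>" by blast+
qed

lemma ell2_multiplier:
  assumes "\<psi> \<in> ell2" "\<And>n. cmod (b n) \<le> B"
  shows "(\<lambda>n. b n * \<psi> n) \<in> ell2" "ell2_norm (\<lambda>n. b n * \<psi> n) \<le> B * ell2_norm \<psi>"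
proof -
  have B: "0 \<le> B" using assms(2)[of 0] norm_ge_zero order_trans by blast
  have "L2_set (\<lambda>n. cmod (b n * \<psi> n)) F \<le> B * ell2_norm \<psi>" if "finite F" for F
  proof -
    have "L2_set (\<lambda>n. cmod (b n * \<psi> n)) F \<le> L2_set (\<lambda>n. B * cmod (\<psi> n)) F"
      unfolding norm_mult using assms(2) by (intro L2_set_mono mult_right_mono) auto
    also have "\<dots> = B * L2_set (\<lambda>n. cmod (\<psi> n)) F" by (rule L2_set_right_distrib[OF B, symmetric])
    also have "\<dots> \<le> B * ell2_norm \<psi>" by (rule mult_left_mono[OF ell2_L2_set_le[OF assms(1) that] B])
    finally show ?thesis .
  qed
  from ell2_boundI[OF this] show "(\<lambda>n. b n * \<psi> n) \<in> ell2" "ell2_norm (\<lambda>n. b n * \<psi> n) \<le> B * ell2_norm \<psi>" by blast+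
qed

lemma ell2_scale:
  assumes "\<psi> \<in> ell2"
  shows "(\<lambda>n. c * \<psi> n) \<in> ell2" "ell2_norm (\<lambda>n. c * \<psi> n) \<le> cmod c * ell2_norm \<psi>"
  using ell2_multiplier[OF assms, of "\<lambda>_. c" "cmod c"] by simp_all

lemma ell2_shift:
  assumes "\<psi> \<in> ell2"
  shows "(\<lambda>n. \<psi> (n + k)) \<in> ell2" "ell2_norm (\<lambda>n. \<psi> (n + k)) \<le> ell2_norm \<psi>"
proof -
  have "L2_set (\<lambda>n. cmod (\<psi> (n + k))) F \<le> ell2_norm \<psi>" if "finite F" for F
  proof -
    have "L2_set (\<lambda>n. cmod (\<psi> (n + k))) F = L2_set (\<lambda>n. cmod (\<psi> n)) ((\<lambda>n. n + k) ` F)"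
      unfolding L2_set_def by (subst sum.reindex) auto
    then show ?thesis using ell2_L2_set_le[OF assms] that by simp
  qed
  from ell2_boundI[OF this] show "(\<lambda>n. \<psi> (n + k)) \<in> ell2" "ell2_norm (\<lambda>n. \<psi> (n + k)) \<le> ell2_norm \<psi>" by blast+
qed

lemma ell2_diff:
  assumes "\<psi> \<in> ell2" "\<phi> \<in> ell2" shows "(\<lambda>n. \<psi> n - \<phi> n) \<in> ell2"
  using ell2_add(1)[OF assms(1) ell2_scale(1)[OF assms(2), of "- 1"]] by simp

text \<open>The real part of the inner product carries the norm expansions and the adjoint relation
  between the parameters \<open>z\<close> and \<open>cnj z\<close>.\<close>

definition re_inner :: "(int \<Rightarrow> complex) \<Rightarrow> (int \<Rightarrow> complex) \<Rightarrow> real" where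
  "re_inner u w = (\<Sum>\<^sub>\<infinity>n. Re (u n * cnj (w n)))"

lemma re_inner_summable:
  assumes "u \<in> ell2" "w \<in> ell2" shows "(\<lambda>n. Re (u n * cnj (w n))) summable_on UNIV"
proof (rule abs_summable_summable, rule Infinite_Sum.abs_summable_on_comparison_test')
  show "(\<lambda>n. (cmod (u n))\<^sup>2 + (cmod (w n))\<^sup>2) summable_on UNIV"
    using assms by (intro summable_on_add) (auto simp: ell2_def)
  show "norm (Re (u n * cnj (w n))) \<le> (cmod (u n))\<^sup>2 + (cmod (w n))\<^sup>2" for n
  proof -
    have "norm (Re (u n * cnj (w n))) \<le> cmod (u n) * cmod (w n)"
      using abs_Re_le_cmod[of "u n * cnj (w n)"] by (simp add: norm_mult)
    moreover have "0 \<le> (cmod (u n) - cmod (w n))\<^sup>2" by simp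
    then have "2 * (cmod (u n) * cmod (w n)) \<le> (cmod (u n))\<^sup>2 + (cmod (w n))\<^sup>2" by (simp add: power2_diff)
    moreover have "0 \<le> cmod (u n) * cmod (w n)" by simp
    ultimately show ?thesis by linarith
  qed
qed

lemma re_inner_add_left:
  assumes "u \<in> ell2" "u' \<in> ell2" "w \<in> ell2" shows "re_inner (\<lambda>n. u n + u' n) w = re_inner u w + re_inner u' w"
  unfolding re_inner_def distrib_right plus_complex.sel using assms by (intro infsum_add re_inner_summable)

lemma re_inner_commute: "re_inner u w = re_inner w u"
  unfolding re_inner_def by (simp add: mult.commute)

lemma re_inner_add_right:
  assumes "u \<in> ell2" "w \<in> ell2" "w' \<in> ell2" shows "re_inner u (\<lambda>n. w n + w' n) = re_inner u w + re_inner u w'"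
  using re_inner_add_left[OF assms(2,3,1)] by (simp add: re_inner_commute)

lemma re_inner_scale_left: "re_inner (\<lambda>n. of_real c * u n) w = c * re_inner u w"
  unfolding re_inner_def infsum_cmult_right'[symmetric] by (intro infsum_cong) (simp add: algebra_simps)

lemma re_inner_self: "re_inner u u = (ell2_norm u)\<^sup>2"
  unfolding re_inner_def ell2_norm_square by (intro infsum_cong) (simp add: complex_norm_square[symmetric] complex_mult_cnj cmod_power2)

lemma re_inner_shift: "re_inner (\<lambda>n. u (n + k)) w = re_inner u (\<lambda>n. w (n - k))"
  unfolding re_inner_def
  by (rule infsum_reindex_bij_witness[of _ "\<lambda>n. n - k" "\<lambda>n. n + k"]) auto

definition fib_op :: "real \<Rightarrow> real \<Rightarrow> complex \<Rightarrow> (int \<Rightarrow> complex) \<Rightarrow> int \<Rightarrow> complex" where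
  "fib_op V w z \<psi> n = fib_hamiltonian V w \<psi> n - z * \<psi> n"

lemma fib_op_alt: "fib_op V w z \<psi> = (\<lambda>n. (\<psi> (n + 1) + \<psi> (n + - 1)) + (of_real (fib_potential V w n) - z) * \<psi> n)"
  by (simp add: fun_eq_iff fib_op_def fib_hamiltonian_def algebra_simps)

lemma fib_potential_bound: "\<bar>fib_potential V w n\<bar> \<le> \<bar>V\<bar>"
  by (auto simp: fib_potential_def indicator_def)

lemma fib_op_ell2:
  assumes "\<psi> \<in> ell2"
  shows "fib_op V w z \<psi> \<in> ell2" "ell2_norm (fib_op V w z \<psi>) \<le> (2 + \<bar>V\<bar> + cmod z) * ell2_norm \<psi>"
proof -
  have b: "cmod (of_real (fib_potential V w n) - z) \<le> \<bar>V\<bar> + cmod z" for n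
    using norm_triangle_ineq4[of "of_real (fib_potential V w n)" z] fib_potential_bound[of V w n] by simp
  note 1 = ell2_shift[OF assms, of 1] and 2 = ell2_shift[OF assms, of "- 1"] and 3 = ell2_multiplier[where b = "\<lambda>n. of_real (fib_potential V w n) - z", OF assms b]
  note 4 = ell2_add[OF 1(1) 2(1)]
  show "fib_op V w z \<psi> \<in> ell2" unfolding fib_op_alt by (rule ell2_add(1)[OF 4(1) 3(1)])
  have "ell2_norm (fib_op V w z \<psi>) \<le> (ell2_norm \<psi> + ell2_norm \<psi>) + (\<bar>V\<bar> + cmod z) * ell2_norm \<psi>"
    unfolding fib_op_alt using ell2_add(2)[OF 4(1) 3(1)] 4(2) 1(2) 2(2) 3(2) by linarith
  then show "ell2_norm (fib_op V w z \<psi>) \<le> (2 + \<bar>V\<bar> + cmod z) * ell2_norm \<psi>" by (simp add: algebra_simps)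
qed

lemma fib_op_adjoint:
  assumes u: "u \<in> ell2" and x: "x \<in> ell2"
  shows "re_inner (fib_op V w z u) x = re_inner u (fib_op V w (cnj z) x)"
proof -
  have b: "cmod (of_real (fib_potential V w n) - z) \<le> \<bar>V\<bar> + cmod z" for z n
    using norm_triangle_ineq4[of "of_real (fib_potential V w n)" z] fib_potential_bound[of V w n] by simp
  have mult: "(\<lambda>n. (of_real (fib_potential V w n) - z) * y n) \<in> ell2" if "y \<in> ell2" for y z
    by (rule ell2_multiplier(1)[OF that b])
  have "re_inner (\<lambda>n. (of_real (fib_potential V w n) - z) * u n) x = re_inner u (\<lambda>n. (of_real (fib_potential V w n) - cnj z) * x n)"
    unfolding re_inner_def by (intro infsum_cong) (simp add: mult_ac)
  moreover have "re_inner (\<lambda>n. u (n + 1)) x = re_inner u (\<lambda>n. x (n + - 1))" "re_inner (\<lambda>n. u (n + - 1)) x = re_inner u (\<lambda>n. x (n + 1))"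
    using re_inner_shift[of u 1 x] re_inner_shift[of u "- 1" x] by simp_all
  ultimately show ?thesis
    unfolding fib_op_alt
    using re_inner_add_left[OF ell2_add(1)[OF ell2_shift(1)[OF u, of 1] ell2_shift(1)[OF u, of "- 1"]] mult[OF u, of z] x]
      re_inner_add_left[OF ell2_shift(1)[OF u, of 1] ell2_shift(1)[OF u, of "- 1"] x]
      re_inner_add_right[OF u ell2_add(1)[OF ell2_shift(1)[OF x, of 1] ell2_shift(1)[OF x, of "- 1"]] mult[OF x, of "cnj z"]]
      re_inner_add_right[OF u ell2_shift(1)[OF x, of 1] ell2_shift(1)[OF x, of "- 1"]]
    by (simp only:)
qed

lemma ell2_norm_add_square:
  assumes "u \<in> ell2" "x \<in> ell2"
  shows "(ell2_norm (\<lambda>n. u n + of_real c * x n))\<^sup>2 = (ell2_norm u)\<^sup>2 + 2 * c * re_inner x u + c\<^sup>2 * (ell2_norm x)\<^sup>2"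
proof -
  have cx: "(\<lambda>n. of_real c * x n) \<in> ell2" by (rule ell2_scale(1)[OF assms(2)])
  have s: "(\<lambda>n. u n + of_real c * x n) \<in> ell2" by (rule ell2_add(1)[OF assms(1) cx])
  have "re_inner (\<lambda>n. u n + of_real c * x n) (\<lambda>n. u n + of_real c * x n)
      = re_inner u u + re_inner u (\<lambda>n. of_real c * x n) + (re_inner (\<lambda>n. of_real c * x n) u + re_inner (\<lambda>n. of_real c * x n) (\<lambda>n. of_real c * x n))"
    using assms cx s by (simp add: re_inner_add_left re_inner_add_right)
  also have "re_inner u (\<lambda>n. of_real c * x n) = c * re_inner x u" by (subst re_inner_commute) (rule re_inner_scale_left)
  also have "re_inner (\<lambda>n. of_real c * x n) u = c * re_inner x u" by (rule re_inner_scale_left)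
  also have "re_inner (\<lambda>n. of_real c * x n) (\<lambda>n. of_real c * x n) = c\<^sup>2 * re_inner x x"
    unfolding re_inner_scale_left by (subst re_inner_commute) (simp add: re_inner_scale_left power2_eq_square)
  finally show ?thesis unfolding re_inner_self by simp
qed

lemma ell2_norm_eq_0:
  assumes "u \<in> ell2" "ell2_norm u \<le> 0" shows "u n = 0"
proof -
  have "cmod (u n) \<le> ell2_norm u" using ell2_L2_set_le[OF assms(1), of "{n}"] by (simp add: L2_set_def)
  then have "cmod (u n) \<le> 0" using assms(2) by (rule order_trans)
  then show ?thesis by simp
qed

text \<open>Two-sided lower bounds make \<open>T T*\<close> coercive, so \<open>1 - t T T*\<close> is a contraction for
  \<open>t = 1 / C\<^sup>2\<close> and the Neumann series inverts \<open>T T*\<close>.\<close>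

lemma resolvent_if_lower_bounds:
  assumes c: "c > 0" and lo: "\<And>u. u \<in> ell2 \<Longrightarrow> c * ell2_norm u \<le> ell2_norm (fib_op V w z u)"
    and lo': "\<And>u. u \<in> ell2 \<Longrightarrow> c * ell2_norm u \<le> ell2_norm (fib_op V w (cnj z) u)"
  shows "z \<in> ell2_resolvent_set (fib_hamiltonian V w)"
proof -
  \<comment> \<open>\<open>C\<close> bounds the norms of both operators below; the summand
    \<open>c\<close> ensures \<open>t * c\<^sup>2 \<le> 1\<close>, so that \<open>\<rho>\<close> is
    the root of a nonnegative number.\<close>
  define C where "C = 2 + \<bar>V\<bar> + cmod z + c"
  define t where "t = 1 / C\<^sup>2"
  define T S where "T = fib_op V w z" and "S = fib_op V w (cnj z)"
  have C: "C > 0" "c \<le> C" using c by (auto simp: C_def add_nonneg_pos)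
  have t: "t > 0" using C by (simp add: t_def)
  have Te: "T u \<in> ell2" "S u \<in> ell2" "ell2_norm (T u) \<le> C * ell2_norm u" "ell2_norm (S u) \<le> C * ell2_norm u" if "u \<in> ell2" for u
  proof -
    have "(2 + \<bar>V\<bar> + cmod z) * ell2_norm u \<le> C * ell2_norm u"
      by (rule mult_right_mono) (use c ell2_norm_nonneg in \<open>auto simp: C_def\<close>)
    then show "T u \<in> ell2" "S u \<in> ell2" "ell2_norm (T u) \<le> C * ell2_norm u" "ell2_norm (S u) \<le> C * ell2_norm u"
      using fib_op_ell2[OF that, of V w z] fib_op_ell2[OF that, of V w "cnj z"] by (auto simp: T_def S_def)
  qed
  define B where "B u = (\<lambda>n. u n + of_real (- t) * T (S u) n)" for u
  have Be: "B u \<in> ell2" if "u \<in> ell2" for u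
    unfolding B_def by (intro ell2_add(1) ell2_scale(1) Te that)
  define \<rho> where "\<rho> = sqrt (1 - t * c\<^sup>2)"
  have tc: "0 < t * c\<^sup>2" "t * c\<^sup>2 \<le> 1"
  proof -
    show "0 < t * c\<^sup>2" using t c by simp
    have "c\<^sup>2 \<le> C\<^sup>2" using C c by (intro power_mono) auto
    then show "t * c\<^sup>2 \<le> 1" using C by (simp add: t_def)
  qed
  have \<rho>: "0 \<le> \<rho>" "\<rho> < 1" using tc by (auto simp: \<rho>_def real_sqrt_lt_1_iff)
  \<comment> \<open>Since \<open>t * C\<^sup>2 = 1\<close>, the second order term
    \<open>t\<^sup>2 * d\<^sup>2\<close> eats at most half of the first order gain
    \<open>2 * t * b\<^sup>2\<close>; the other half is at least
    \<open>t * c\<^sup>2 * a\<^sup>2\<close>.\<close>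
  have Bn: "ell2_norm (B u) \<le> \<rho> * ell2_norm u" if u: "u \<in> ell2" for u
  proof -
    define a b d where "a = ell2_norm u" and "b = ell2_norm (S u)" and "d = ell2_norm (T (S u))"
    have nn: "0 \<le> a" "0 \<le> b" "0 \<le> d" by (simp_all add: a_def b_def d_def ell2_norm_nonneg)
    have "re_inner (T (S u)) u = re_inner (S u) (S u)"
      unfolding T_def using fib_op_adjoint[OF Te(2)[OF u] u, of V w z] by (simp only: S_def)
    then have re_inner: "re_inner (T (S u)) u = b\<^sup>2" by (simp only: re_inner_self b_def)
    have 1: "(ell2_norm (B u))\<^sup>2 = a\<^sup>2 + 2 * (- t) * b\<^sup>2 + (- t)\<^sup>2 * d\<^sup>2"
      using ell2_norm_add_square[OF u Te(1)[OF Te(2)[OF u]], of "- t"] unfolding re_inner by (simp only: B_def a_def d_def)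
    have "d \<le> C * b" unfolding d_def b_def by (rule Te(3)[OF Te(2)[OF u]])
    then have "d\<^sup>2 \<le> (C * b)\<^sup>2" using nn by (intro power_mono)
    then have "t * d\<^sup>2 \<le> t * (C * b)\<^sup>2" by (rule mult_left_mono) (use t in simp)
    also have "t * (C * b)\<^sup>2 = b\<^sup>2" using C by (simp add: t_def power_mult_distrib)
    finally have "t * (t * d\<^sup>2) \<le> t * b\<^sup>2" by (rule mult_left_mono) (use t in simp)
    then have 2: "(- t)\<^sup>2 * d\<^sup>2 \<le> t * b\<^sup>2" by (simp add: power2_eq_square mult.assoc)
    have "c * a \<le> b" unfolding a_def b_def S_def by (rule lo'[OF u])
    then have "(c * a)\<^sup>2 \<le> b\<^sup>2" using c nn by (intro power_mono) auto
    then have 3: "t * (c * a)\<^sup>2 \<le> t * b\<^sup>2" by (rule mult_left_mono) (use t in simp)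
    have "\<rho>\<^sup>2 = 1 - t * c\<^sup>2" using tc by (simp add: \<rho>_def)
    then have "(\<rho> * a)\<^sup>2 = a\<^sup>2 - t * (c * a)\<^sup>2" unfolding power_mult_distrib by (simp add: left_diff_distrib)
    then have "(ell2_norm (B u))\<^sup>2 \<le> (\<rho> * a)\<^sup>2" using 1 2 3 by linarith
    then have "ell2_norm (B u) \<le> \<rho> * a" by (rule power2_le_imp_le) (use \<rho> nn in simp)
    then show ?thesis by (simp only: a_def)
  qed
  have Bk: "(B ^^ k) f \<in> ell2" "ell2_norm ((B ^^ k) f) \<le> \<rho> ^ k * ell2_norm f" if "f \<in> ell2" for f k
  proof -
    have "(B ^^ k) f \<in> ell2 \<and> ell2_norm ((B ^^ k) f) \<le> \<rho> ^ k * ell2_norm f"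
    proof (induction k)
      case (Suc k)
      have "ell2_norm (B ((B ^^ k) f)) \<le> \<rho> * (\<rho> ^ k * ell2_norm f)"
        using Bn[of "(B ^^ k) f"] Suc mult_left_mono[OF _ \<rho>(1)] order_trans by blast
      then show ?case using Suc Be by simp
    qed (use that in simp)
    then show "(B ^^ k) f \<in> ell2" "ell2_norm ((B ^^ k) f) \<le> \<rho> ^ k * ell2_norm f" by blast+
  qed
  define N where "N f n = of_real t * (\<Sum>k. (B ^^ k) f n)" for f n
  have sm: "summable (\<lambda>k. (B ^^ k) f n)" if f: "f \<in> ell2" for f n
  proof (rule summable_comparison_test')
    show "summable (\<lambda>k. \<rho> ^ k * ell2_norm f)" using \<rho> by (intro summable_mult2 summable_geometric) auto
    show "norm ((B ^^ k) f n) \<le> \<rho> ^ k * ell2_norm f" for k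
      using ell2_L2_set_le[OF Bk(1)[OF f], of "{n}" k] Bk(2)[OF f, of k] by (simp add: L2_set_def)
  qed
  have geo: "(\<Sum>k<K. \<rho> ^ k) \<le> 1 / (1 - \<rho>)" for K
    using sum_le_suminf[of "\<lambda>k. \<rho> ^ k" "{..<K}"] \<rho> by (simp add: suminf_geometric summable_geometric)
  have Ne: "N f \<in> ell2" "ell2_norm (N f) \<le> t / (1 - \<rho>) * ell2_norm f" if f: "f \<in> ell2" for f
  proof -
    have part: "(\<lambda>n. \<Sum>k<K. (B ^^ k) f n) \<in> ell2 \<and> ell2_norm (\<lambda>n. \<Sum>k<K. (B ^^ k) f n) \<le> (\<Sum>k<K. \<rho> ^ k) * ell2_norm f" for K
    proof (induction K)
      case 0 show ?case by (simp add: ell2_def ell2_norm_def)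
    next
      case (Suc K)
      then show ?case using ell2_add[of "\<lambda>n. \<Sum>k<K. (B ^^ k) f n" "(B ^^ K) f"] Bk[OF f, of K]
        by (auto simp: distrib_right intro: order_trans)
    qed
    \<comment> \<open>The series is defined pointwise; the norm bound of the partial sums passes to
      it on finite sets \<open>F\<close>.\<close>
    have "L2_set (\<lambda>n. cmod (\<Sum>k. (B ^^ k) f n)) F \<le> 1 / (1 - \<rho>) * ell2_norm f" if F: "finite F" for F
    proof (rule LIMSEQ_le_const2)
      show "(\<lambda>K. L2_set (\<lambda>n. cmod (\<Sum>k<K. (B ^^ k) f n)) F) \<longlonglongrightarrow> L2_set (\<lambda>n. cmod (\<Sum>k. (B ^^ k) f n)) F"
        unfolding L2_set_def by (intro tendsto_intros summable_LIMSEQ sm f)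
      have "L2_set (\<lambda>n. cmod (\<Sum>k<K. (B ^^ k) f n)) F \<le> 1 / (1 - \<rho>) * ell2_norm f" for K
      proof -
        have "L2_set (\<lambda>n. cmod (\<Sum>k<K. (B ^^ k) f n)) F \<le> (\<Sum>k<K. \<rho> ^ k) * ell2_norm f"
          using ell2_L2_set_le[OF _ F] part[of K] order_trans by blast
        also have "\<dots> \<le> 1 / (1 - \<rho>) * ell2_norm f" by (rule mult_right_mono[OF geo ell2_norm_nonneg])
        finally show ?thesis .
      qed
      then show "\<exists>N. \<forall>K\<ge>N. L2_set (\<lambda>n. cmod (\<Sum>k<K. (B ^^ k) f n)) F \<le> 1 / (1 - \<rho>) * ell2_norm f" by blast
    qed
    note 1 = ell2_boundI[OF this]
    have tt: "cmod (of_real t) = t" using t by simp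
    show "N f \<in> ell2" using ell2_scale(1)[OF 1(1), of "of_real t"] by (simp add: N_def[abs_def])
    have "ell2_norm (N f) \<le> t * ell2_norm (\<lambda>n. \<Sum>k. (B ^^ k) f n)"
      using ell2_scale(2)[OF 1(1), of "of_real t"] tt by (simp add: N_def[abs_def])
    also have "\<dots> \<le> t * (1 / (1 - \<rho>) * ell2_norm f)" by (rule mult_left_mono[OF 1(2) less_imp_le[OF t]])
    finally show "ell2_norm (N f) \<le> t / (1 - \<rho>) * ell2_norm f" by simp
  qed
  \<comment> \<open>The operator involves three sites only and hence commutes with pointwise
    convergent series.\<close>
  have ops: "fib_op V w y (\<lambda>n. of_real t * (\<Sum>k. g k n)) = (\<lambda>n. of_real t * (\<Sum>k. fib_op V w y (g k) n))"
    "summable (\<lambda>k. fib_op V w y (g k) n)"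
    if "\<And>n. summable (\<lambda>k. g k n)" for y n and g :: "nat \<Rightarrow> int \<Rightarrow> complex"
  proof -
    note s = that
    show "summable (\<lambda>k. fib_op V w y (g k) n)" unfolding fib_op_alt by (intro summable_add summable_mult s)
    have E: "(\<Sum>k. fib_op V w y (g k) n) = ((\<Sum>k. g k (n + 1)) + (\<Sum>k. g k (n + - 1))) + (of_real (fib_potential V w n) - y) * (\<Sum>k. g k n)" for n
    proof -
      have 1: "(\<Sum>k. g k (n + 1)) + (\<Sum>k. g k (n + - 1)) = (\<Sum>k. g k (n + 1) + g k (n + - 1))"
        by (rule suminf_add[OF s s])
      have 2: "(of_real (fib_potential V w n) - y) * (\<Sum>k. g k n) = (\<Sum>k. (of_real (fib_potential V w n) - y) * g k n)"
        by (rule suminf_mult[OF s, symmetric])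
      show ?thesis unfolding 1 2 fib_op_alt
        by (rule suminf_add[OF summable_add[OF s s] summable_mult[OF s], symmetric])
    qed
    show "fib_op V w y (\<lambda>n. of_real t * (\<Sum>k. g k n)) = (\<lambda>n. of_real t * (\<Sum>k. fib_op V w y (g k) n))"
    proof
      fix n
      show "fib_op V w y (\<lambda>n. of_real t * (\<Sum>k. g k n)) n = of_real t * (\<Sum>k. fib_op V w y (g k) n)"
        unfolding E unfolding fib_op_alt by (simp add: algebra_simps)
    qed
  qed
  have TSN: "T (S (N f)) = f" if f: "f \<in> ell2" for f
  proof
    fix n
    have s1: "summable (\<lambda>k. (B ^^ k) f n)" for n by (rule sm[OF f])
    have SN: "S (N f) = (\<lambda>n. of_real t * (\<Sum>k. S ((B ^^ k) f) n))"
      unfolding S_def N_def[abs_def] by (rule ops(1)) (rule s1)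
    have s2: "summable (\<lambda>k. S ((B ^^ k) f) n)" for n unfolding S_def by (rule ops(2)) (rule s1)
    have TSN: "T (S (N f)) = (\<lambda>n. of_real t * (\<Sum>k. T (S ((B ^^ k) f)) n))"
      unfolding SN unfolding T_def by (rule ops(1)) (rule s2)
    have s3: "summable (\<lambda>k. T (S ((B ^^ k) f)) n)" unfolding T_def by (rule ops(2)) (rule s2)
    have "of_real t * T (S ((B ^^ k) f)) n = (B ^^ k) f n - (B ^^ Suc k) f n" for k
      by (simp add: B_def)
    then have "(\<lambda>k. of_real t * T (S ((B ^^ k) f)) n) sums ((B ^^ 0) f n - 0)"
      using telescope_sums'[OF summable_LIMSEQ_zero[OF s1]] by simp
    then have "(\<Sum>k. of_real t * T (S ((B ^^ k) f)) n) = f n" by (simp add: sums_iff)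
    then show "T (S (N f)) n = f n" unfolding TSN using suminf_mult[OF s3] by simp
  qed
  define R where "R f = S (N f)" for f
  have Rb: "ell2_norm (R f) \<le> (C * (t / (1 - \<rho>))) * ell2_norm f" if f: "f \<in> ell2" for f
  proof -
    have "ell2_norm (R f) \<le> C * ell2_norm (N f)" unfolding R_def by (rule Te(4)[OF Ne(1)[OF f]])
    also have "\<dots> \<le> C * (t / (1 - \<rho>) * ell2_norm f)" using Ne(2)[OF f] C by (intro mult_left_mono) auto
    finally show ?thesis by (simp add: mult.assoc)
  qed
  \<comment> \<open>\<open>R\<close> is a right inverse of \<open>T\<close>, and \<open>T\<close> is
    injective on \<open>ell2\<close> by the lower bound \<open>lo\<close>; so \<open>R\<close> is a
    left inverse too.\<close>
  have RT: "R (T u) = u" if u: "u \<in> ell2" for u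
  proof -
    have Re: "R (T u) \<in> ell2" unfolding R_def by (intro Te Ne u)
    define x where "x n = R (T u) n + (- 1) * u n" for n
    have xe: "x \<in> ell2" unfolding x_def[abs_def] by (intro ell2_add(1) ell2_scale(1) Re u)
    have "T (R (T u)) = T u" unfolding R_def by (rule TSN[OF Te(1)[OF u]])
    then have eq: "T (R (T u)) n = T u n" for n by simp
    have "T x n = T (R (T u)) n - T u n" for n
      unfolding T_def fib_op_alt x_def by (simp add: algebra_simps)
    then have "T x = (\<lambda>n. 0)" using eq by auto
    then have "ell2_norm (T x) = 0" by (simp add: ell2_norm_def)
    then have "c * ell2_norm x \<le> 0" using lo[OF xe] by (simp add: T_def)
    then have "ell2_norm x \<le> 0" using c by (simp add: mult_le_0_iff)
    then have "x n = 0" for n by (rule ell2_norm_eq_0[OF xe])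
    then show ?thesis by (auto simp: x_def)
  qed
  show ?thesis unfolding ell2_resolvent_set_def
  proof (intro CollectI exI[of _ R] conjI ballI exI[of _ "C * (t / (1 - \<rho>))"])
    fix \<psi> assume \<psi>: "\<psi> \<in> ell2"
    show "R \<psi> \<in> ell2" unfolding R_def by (intro Te Ne \<psi>)
    show "ell2_norm (R \<psi>) \<le> C * (t / (1 - \<rho>)) * ell2_norm \<psi>" by (rule Rb[OF \<psi>])
    show "R (\<lambda>n. fib_hamiltonian V w \<psi> n - z * \<psi> n) = \<psi>" using RT[OF \<psi>] by (simp add: T_def fib_op_def[abs_def])
    show "(\<lambda>n. fib_hamiltonian V w (R \<psi>) n - z * R \<psi> n) = \<psi>"
      using TSN[OF \<psi>] by (simp add: R_def T_def fib_op_def[abs_def])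
  qed
qed

lemma ell2_finite_support:
  assumes "\<And>k. k \<notin> {a..b} \<Longrightarrow> \<psi> k = 0"
  shows "\<psi> \<in> ell2" "(ell2_norm \<psi>)\<^sup>2 = (\<Sum>k\<in>{a..b}. (cmod (\<psi> k))\<^sup>2)"
proof -
  have "(\<lambda>k. (cmod (\<psi> k))\<^sup>2) summable_on {a..b}" by simp
  moreover have "(\<lambda>k. (cmod (\<psi> k))\<^sup>2) summable_on UNIV \<longleftrightarrow> (\<lambda>k. (cmod (\<psi> k))\<^sup>2) summable_on {a..b}"
    by (rule summable_on_cong_neutral) (use assms in auto)
  ultimately show "\<psi> \<in> ell2" by (simp add: ell2_def)
  have "(\<Sum>\<^sub>\<infinity>k. (cmod (\<psi> k))\<^sup>2) = (\<Sum>\<^sub>\<infinity>k\<in>{a..b}. (cmod (\<psi> k))\<^sup>2)"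
    by (rule infsum_cong_neutral) (use assms in auto)
  then show "(ell2_norm \<psi>)\<^sup>2 = (\<Sum>k\<in>{a..b}. (cmod (\<psi> k))\<^sup>2)" by (simp add: ell2_norm_square)
qed

lemma fib_op_jacobi:
  "Re (fib_op V w (of_real E) \<psi> k) = jacobi (fib_potential V w) E (\<lambda>k. Re (\<psi> k)) k"
  "Im (fib_op V w (of_real E) \<psi> k) = jacobi (fib_potential V w) E (\<lambda>k. Im (\<psi> k)) k"
  by (simp_all add: fib_op_def fib_hamiltonian_def jacobi_def algebra_simps)

lemma jacobi_vanish:
  assumes "\<And>k. k \<notin> {a..b} \<Longrightarrow> \<psi> k = 0" "k \<notin> {a - 1..b + 1}" shows "jacobi v E \<psi> k = 0"
proof -
  have "\<psi> k = 0" "\<psi> (k + 1) = 0" "\<psi> (k - 1) = 0" by (rule assms(1), use assms(2) in auto)+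
  then show ?thesis by (simp add: jacobi_def)
qed

text \<open>Potential and energy are real, so the operator acts on real and imaginary parts
  separately and the real bound applies to each.\<close>

lemma energy_gap_lower_bound_finite:
  assumes gap: "energy_gap (fib_potential V w) E \<delta>" and out: "\<And>k. k \<notin> {a..b} \<Longrightarrow> \<psi> k = 0" and \<delta>: "\<delta> > 0"
  shows "\<delta> * ell2_norm \<psi> \<le> ell2_norm (fib_op V w (of_real E) \<psi>)"
proof -
  define J where "J = fib_op V w (of_real E) \<psi>"
  have outJ: "J k = 0" if "k \<notin> {a - 1..b + 1}" for k
    using jacobi_vanish[of a b "\<lambda>k. Re (\<psi> k)" k] jacobi_vanish[of a b "\<lambda>k. Im (\<psi> k)" k] that out
    unfolding J_def complex_eq_iff fib_op_jacobi by simp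
  have "\<delta>\<^sup>2 * (\<Sum>k\<in>{a..b}. (Re (\<psi> k))\<^sup>2) \<le> (\<Sum>k\<in>{a - 1..b + 1}. (Re (J k))\<^sup>2)"
    "\<delta>\<^sup>2 * (\<Sum>k\<in>{a..b}. (Im (\<psi> k))\<^sup>2) \<le> (\<Sum>k\<in>{a - 1..b + 1}. (Im (J k))\<^sup>2)"
    unfolding J_def fib_op_jacobi using gap out unfolding energy_gap_def by auto
  then have "\<delta>\<^sup>2 * (\<Sum>k\<in>{a..b}. (cmod (\<psi> k))\<^sup>2) \<le> (\<Sum>k\<in>{a - 1..b + 1}. (cmod (J k))\<^sup>2)"
    by (simp add: cmod_power2 sum.distrib distrib_left)
  then have "(\<delta> * ell2_norm \<psi>)\<^sup>2 \<le> (ell2_norm J)\<^sup>2"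
    using ell2_finite_support(2)[of a b \<psi>] ell2_finite_support(2)[of "a - 1" "b + 1" J] out outJ
    by (simp add: power_mult_distrib)
  then show ?thesis unfolding J_def by (rule power2_le_imp_le) (rule ell2_norm_nonneg)
qed

lemma ell2_truncation:
  assumes u: "u \<in> ell2" and e: "e > 0"
  obtains N :: int where "ell2_norm (\<lambda>k. u k - (if k \<in> {- N..N} then u k else 0)) \<le> e"
proof -
  have sm: "(\<lambda>n. (cmod (u n))\<^sup>2) summable_on UNIV" using u by (simp add: ell2_def)
  then have hs: "((\<lambda>n. (cmod (u n))\<^sup>2) has_sum (ell2_norm u)\<^sup>2) UNIV" unfolding ell2_norm_square by simp
  have "0 < e\<^sup>2" using e by simp
  from has_sum_finite_approximation[OF hs this]
  obtain F where F0: "finite F" "dist (\<Sum>n\<in>F. (cmod (u n))\<^sup>2) ((ell2_norm u)\<^sup>2) \<le> e\<^sup>2" by blast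
  then have F: "finite F" "(ell2_norm u)\<^sup>2 - e\<^sup>2 \<le> (\<Sum>n\<in>F. (cmod (u n))\<^sup>2)"
    unfolding dist_real_def by linarith+
  define N where "N = Max (insert 0 ((\<lambda>k. \<bar>k\<bar>) ` F))"
  have FN: "F \<subseteq> {- N..N}"
  proof
    fix k assume "k \<in> F"
    then have "\<bar>k\<bar> \<le> N" unfolding N_def using F by (intro Max_ge) auto
    then show "k \<in> {- N..N}" by auto
  qed
  have bd: "L2_set (\<lambda>k. cmod (u k - (if k \<in> {- N..N} then u k else 0))) G \<le> e" if G: "finite G" for G
  proof -
    have "(\<Sum>k\<in>G. (cmod (u k - (if k \<in> {- N..N} then u k else 0)))\<^sup>2) = (\<Sum>k\<in>G - {- N..N}. (cmod (u k))\<^sup>2)"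
      using G by (intro sum.mono_neutral_cong_right) auto
    moreover have "(\<Sum>k\<in>G - {- N..N}. (cmod (u k))\<^sup>2) + (\<Sum>n\<in>F. (cmod (u n))\<^sup>2) = (\<Sum>k\<in>(G - {- N..N}) \<union> F. (cmod (u k))\<^sup>2)"
      using G F FN by (intro sum.union_disjoint[symmetric]) auto
    moreover have "(\<Sum>k\<in>(G - {- N..N}) \<union> F. (cmod (u k))\<^sup>2) \<le> (ell2_norm u)\<^sup>2"
      unfolding ell2_norm_square using G F by (intro finite_sum_le_infsum sm) auto
    ultimately have "(\<Sum>k\<in>G. (cmod (u k - (if k \<in> {- N..N} then u k else 0)))\<^sup>2) \<le> e\<^sup>2" using F(2) by linarith
    then show ?thesis unfolding L2_set_def by (rule real_le_lsqrt[rotated]) (use e in auto)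
  qed
  show ?thesis by (rule that[of N]) (rule ell2_boundI(2)[OF bd])
qed

text \<open>Truncations are dense in \<open>ell2\<close> and the operator is bounded, so the bound
  extends from finite support.\<close>

lemma energy_gap_lower_bound:
  assumes gap: "energy_gap (fib_potential V w) E \<delta>" and \<delta>: "\<delta> > 0" and u: "u \<in> ell2"
  shows "\<delta> * ell2_norm u \<le> ell2_norm (fib_op V w (of_real E) u)"
proof (rule field_le_epsilon)
  fix e :: real assume e: "e > 0"
  define C where "C = 2 + \<bar>V\<bar> + \<bar>E\<bar>"
  \<comment> \<open>The truncation error \<open>e'\<close> enters once with the factor
    \<open>\<delta>\<close> and once with the operator bound \<open>C\<close>.\<close>
  define e' where "e' = e / (\<delta> + C)"
  have C: "C > 0" by (simp add: C_def add_pos_nonneg)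
  have e': "e' > 0" using e \<delta> C by (simp add: e'_def)
  obtain N where N: "ell2_norm (\<lambda>k. u k - (if k \<in> {- N..N} then u k else 0)) \<le> e'"
    using ell2_truncation[OF u e'] by blast
  define p r where "p k = (if k \<in> {- N..N} then u k else 0)" and "r k = u k - p k" for k
  have p: "p \<in> ell2" by (rule ell2_finite_support(1)[of "- N" N]) (auto simp: p_def)
  have r: "r \<in> ell2" unfolding r_def[abs_def] by (rule ell2_diff[OF u p])
  have rN: "ell2_norm r \<le> e'" using N by (simp add: r_def[abs_def] p_def)
  have up: "u = (\<lambda>k. p k + r k)" by (simp add: r_def)
  have 1: "ell2_norm u \<le> ell2_norm p + e'" using ell2_add(2)[OF p r] rN up by simp
  have "fib_op V w (of_real E) p = (\<lambda>k. fib_op V w (of_real E) u k + (- 1) * fib_op V w (of_real E) r k)"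
    by (simp add: fun_eq_iff fib_op_def fib_hamiltonian_def r_def algebra_simps)
  then have "ell2_norm (fib_op V w (of_real E) p) \<le> ell2_norm (fib_op V w (of_real E) u) + ell2_norm (\<lambda>k. (- 1) * fib_op V w (of_real E) r k)"
    using ell2_add(2)[OF fib_op_ell2(1)[OF u] ell2_scale(1)[OF fib_op_ell2(1)[OF r]], of V w "of_real E" "- 1" V w "of_real E"]
    by (simp only:)
  also have "ell2_norm (\<lambda>k. (- 1) * fib_op V w (of_real E) r k) \<le> C * e'"
  proof -
    have "ell2_norm (\<lambda>k. (- 1) * fib_op V w (of_real E) r k) \<le> ell2_norm (fib_op V w (of_real E) r)"
      using ell2_scale(2)[OF fib_op_ell2(1)[OF r], of "- 1" V w "of_real E"] by simp
    also have "\<dots> \<le> C * ell2_norm r" using fib_op_ell2(2)[OF r, of V w "of_real E"] by (simp add: C_def)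
    also have "\<dots> \<le> C * e'" using rN C by simp
    finally show ?thesis .
  qed
  finally have 2: "ell2_norm (fib_op V w (of_real E) p) \<le> ell2_norm (fib_op V w (of_real E) u) + C * e'" by simp
  have "\<delta> * ell2_norm p \<le> ell2_norm (fib_op V w (of_real E) p)"
    by (rule energy_gap_lower_bound_finite[OF gap _ \<delta>, of "- N" N]) (auto simp: p_def)
  moreover have "\<delta> * ell2_norm u \<le> \<delta> * ell2_norm p + \<delta> * e'" using mult_left_mono[OF 1, of \<delta>] \<delta> by (simp add: distrib_left)
  ultimately have "\<delta> * ell2_norm u \<le> ell2_norm (fib_op V w (of_real E) u) + (\<delta> + C) * e'"
    using 2 by (simp add: distrib_right)
  also have "(\<delta> + C) * e' = e" using \<delta> C by (simp add: e'_def)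
  finally show "\<delta> * ell2_norm u \<le> ell2_norm (fib_op V w (of_real E) u) + e" .
qed

text \<open>For real energies \<open>z\<close> and \<open>cnj z\<close> agree, so one lower bound
  provides both hypotheses of \<open>resolvent_if_lower_bounds\<close>. Conversely a resolvent
  bounded by \<open>K\<close> gives the lower bound \<open>1 / K\<close>, with \<open>K\<close>
  raised to at least 1 to keep it positive.\<close>

lemma real_resolvent_iff:
  "complex_of_real E \<in> ell2_resolvent_set (fib_hamiltonian V w) \<longleftrightarrow> (\<exists>\<delta>>0. energy_gap (fib_potential V w) E \<delta>)"
proof
  assume "\<exists>\<delta>>0. energy_gap (fib_potential V w) E \<delta>"
  then obtain \<delta> where "\<delta> > 0" "energy_gap (fib_potential V w) E \<delta>" by blast
  then show "complex_of_real E \<in> ell2_resolvent_set (fib_hamiltonian V w)"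
    using energy_gap_lower_bound by (intro resolvent_if_lower_bounds[of \<delta>]) auto
next
  assume "complex_of_real E \<in> ell2_resolvent_set (fib_hamiltonian V w)"
  then obtain R K where R: "\<And>\<psi>. \<psi> \<in> ell2 \<Longrightarrow> ell2_norm (R \<psi>) \<le> K * ell2_norm \<psi>"
    "\<And>\<psi>. \<psi> \<in> ell2 \<Longrightarrow> R (fib_op V w (of_real E) \<psi>) = \<psi>"
    unfolding ell2_resolvent_set_def fib_op_def[abs_def] by blast
  define K' where "K' = max K 1"
  have K': "K' > 0" by (simp add: K'_def)
  have "energy_gap (fib_potential V w) E (1 / K')"
    unfolding energy_gap_def
  proof (intro allI impI)
    fix x :: "int \<Rightarrow> real" and a b assume out: "\<forall>k. k \<notin> {a..b} \<longrightarrow> x k = 0"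
    define \<psi> where "\<psi> k = complex_of_real (x k)" for k
    define J where "J = fib_op V w (of_real E) \<psi>"
    have J: "J k = of_real (jacobi (fib_potential V w) E x k)" for k
      unfolding J_def complex_eq_iff fib_op_jacobi by (simp add: \<psi>_def jacobi_def)
    have outJ: "J k = 0" if "k \<notin> {a - 1..b + 1}" for k
      unfolding J using jacobi_vanish[of a b x k] out that by simp
    have \<psi>: "\<psi> \<in> ell2" "(ell2_norm \<psi>)\<^sup>2 = (\<Sum>k\<in>{a..b}. (cmod (\<psi> k))\<^sup>2)"
      using ell2_finite_support[of a b \<psi>] out by (auto simp: \<psi>_def)
    have Je: "J \<in> ell2" "(ell2_norm J)\<^sup>2 = (\<Sum>k\<in>{a - 1..b + 1}. (cmod (J k))\<^sup>2)"
      using ell2_finite_support[of "a - 1" "b + 1" J] outJ by blast+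
    have "ell2_norm \<psi> \<le> K * ell2_norm J" using R(1)[OF Je(1)] R(2)[OF \<psi>(1)] by (simp add: J_def)
    also have "\<dots> \<le> K' * ell2_norm J" by (rule mult_right_mono) (auto simp: K'_def ell2_norm_nonneg)
    finally have "1 / K' * ell2_norm \<psi> \<le> ell2_norm J" using K' by (simp add: field_simps)
    then have "(1 / K' * ell2_norm \<psi>)\<^sup>2 \<le> (ell2_norm J)\<^sup>2"
      using K' ell2_norm_nonneg by (intro power_mono) auto
    then show "(1 / K')\<^sup>2 * (\<Sum>k\<in>{a..b}. (x k)\<^sup>2) \<le> (\<Sum>k\<in>{a - 1..b + 1}. (jacobi (fib_potential V w) E x k)\<^sup>2)"
      unfolding power_mult_distrib \<psi>(2) Je(2) by (simp add: \<psi>_def J)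
  qed
  then show "\<exists>\<delta>>0. energy_gap (fib_potential V w) E \<delta>" using K' by (intro exI[of _ "1 / K'"]) auto
qed

text \<open>By self-adjointness at real energy, the vectors \<open>D\<close> and
  \<open>x = - i u\<close> are orthogonal for \<open>re_inner\<close>, so the imaginary part of the
  parameter adds in the sense of Pythagoras.\<close>

lemma fib_op_imaginary_part:
  assumes u: "u \<in> ell2"
  shows "\<bar>\<eta>\<bar> * ell2_norm u \<le> ell2_norm (fib_op V w (Complex E \<eta>) u)"
proof -
  define D where "D = fib_op V w (of_real E) u"
  define x where "x n = - (\<i> * u n)" for n
  have De: "D \<in> ell2" unfolding D_def by (rule fib_op_ell2(1)[OF u])
  have xe: "x \<in> ell2" using ell2_scale(1)[OF u, of "- \<i>"] by (simp add: x_def[abs_def])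
  have xn: "(ell2_norm x)\<^sup>2 = (ell2_norm u)\<^sup>2" unfolding ell2_norm_square x_def by (simp add: norm_mult)
  have eq: "fib_op V w (Complex E \<eta>) u = (\<lambda>n. D n + of_real \<eta> * x n)"
    by (simp add: fun_eq_iff fib_op_def D_def x_def Complex_eq algebra_simps)
  have "re_inner x D = re_inner (fib_op V w (of_real E) x) u"
    unfolding D_def using fib_op_adjoint[OF xe u, of V w "of_real E"] by simp
  also have "fib_op V w (of_real E) x = (\<lambda>n. - (\<i> * D n))"
    by (simp add: fun_eq_iff fib_op_def fib_hamiltonian_def D_def x_def algebra_simps)
  also have "re_inner (\<lambda>n. - (\<i> * D n)) u = re_inner D (\<lambda>n. \<i> * u n)"
    unfolding re_inner_def by (intro infsum_cong) (simp add: algebra_simps)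
  also have "\<dots> = - re_inner x D"
    unfolding re_inner_def infsum_uminus[symmetric] by (intro infsum_cong) (simp add: x_def algebra_simps)
  finally have z: "re_inner x D = 0" by simp
  have "(ell2_norm (fib_op V w (Complex E \<eta>) u))\<^sup>2 = (ell2_norm D)\<^sup>2 + \<eta>\<^sup>2 * (ell2_norm u)\<^sup>2"
    unfolding eq ell2_norm_add_square[OF De xe] z xn by simp
  then have "(\<bar>\<eta>\<bar> * ell2_norm u)\<^sup>2 \<le> (ell2_norm (fib_op V w (Complex E \<eta>) u))\<^sup>2"
    by (simp add: power_mult_distrib)
  then show ?thesis by (rule power2_le_imp_le) (rule ell2_norm_nonneg)
qed

lemma nonreal_resolvent:
  assumes "Im z \<noteq> 0" shows "z \<in> ell2_resolvent_set (fib_hamiltonian V w)"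
proof (rule resolvent_if_lower_bounds[of "\<bar>Im z\<bar>"])
  fix u assume u: "u \<in> ell2"
  show "\<bar>Im z\<bar> * ell2_norm u \<le> ell2_norm (fib_op V w z u)"
    using fib_op_imaginary_part[OF u, of "Im z" V w "Re z"] by (simp add: complex_surj)
  have "cnj z = Complex (Re z) (- Im z)" by (simp add: complex_eq_iff)
  then show "\<bar>Im z\<bar> * ell2_norm u \<le> ell2_norm (fib_op V w (cnj z) u)"
    using fib_op_imaginary_part[OF u, of "- Im z" V w "Re z"] by simp
qed (use assms in simp)

text \<open>A test sequence sees the potential of phase \<open>w'\<close> on a finite window only.
  The orbit of \<open>w\<close> visits every arc to the right of \<open>frac w'\<close>, so this
  pattern occurs somewhere in the potential of phase \<open>w\<close>, and the test sequence is
  translated there.\<close>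

lemma energy_gap_phase_independent:
  assumes gap: "energy_gap (fib_potential V w) E \<delta>"
  shows "energy_gap (fib_potential V w') E \<delta>"
  unfolding energy_gap_def
proof (intro allI impI)
  fix \<psi> :: "int \<Rightarrow> real" and a b assume out: "\<forall>k. k \<notin> {a..b} \<longrightarrow> \<psi> k = 0"
  obtain d1 where d1: "d1 > 0" "\<And>y k. frac w' \<le> y \<Longrightarrow> y < frac w' + d1 \<Longrightarrow> k \<in> {a - 1..b + 1} \<Longrightarrow> fib_potential V y k = fib_potential V (frac w') k"
    by (rule fib_potential_locally_constant[OF finite_atLeastAtMost_int[of "a - 1" "b + 1"], of "frac w'" V]) blast
  define d where "d = min d1 (1 - frac w')"
  have d: "d > 0" "d \<le> d1" "frac w' + d \<le> 1" using d1 frac_lt_1[of w'] by (auto simp: d_def)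
  have d0: "0 \<le> frac w'" "frac w' < frac w' + d" using d(1) by auto
  obtain C where C: "\<And>K w''. real (card {t\<in>{..<K}. frac (w'' + real t * fib_alpha) \<in> {frac w'..<frac w' + d}})
      \<ge> real K * ((frac w' + d - frac w') / 2) - C"
    using arc_visits[OF d0 d(3)] by blast
  obtain K :: nat where "C / (d / 2) < real K" using reals_Archimedean2 by blast
  then have "0 < real K * (d / 2) - C" using d(1) by (simp add: field_simps)
  also have "\<dots> \<le> real (card {t\<in>{..<K}. frac (w + real t * fib_alpha) \<in> {frac w'..<frac w' + d}})"
    using C[where K = K and w'' = w] by simp
  finally have "{t\<in>{..<K}. frac (w + real t * fib_alpha) \<in> {frac w'..<frac w' + d}} \<noteq> {}"
    by (metis card.empty less_irrefl of_nat_0)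
  then obtain t where t: "frac (w + real t * fib_alpha) \<in> {frac w'..<frac w' + d}" by blast
  define v v' where "v = fib_potential V w" and "v' = fib_potential V w'"
  have pot: "v (k + int t) = v' k" if "k \<in> {a - 1..b + 1}" for k
  proof -
    have "v (k + int t) = fib_potential V (frac (w + real t * fib_alpha)) k"
      unfolding v_def fib_potential_shift fib_potential_frac ..
    also have "\<dots> = fib_potential V (frac w') k"
      by (rule d1(2)[OF _ _ that]) (use t d(2) in auto)
    finally show ?thesis by (simp add: v'_def fib_potential_frac)
  qed
  define f where "f k = \<psi> (k - int t)" for k
  have "\<delta>\<^sup>2 * (\<Sum>k\<in>{a + int t..b + int t}. (f k)\<^sup>2) \<le> (\<Sum>k\<in>{a + int t - 1..b + int t + 1}. (jacobi v E f k)\<^sup>2)"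
  proof -
    have "\<forall>k. k \<notin> {a + int t..b + int t} \<longrightarrow> f k = 0"
    proof (intro allI impI)
      fix k assume "k \<notin> {a + int t..b + int t}"
      then have "k - int t \<notin> {a..b}" by auto
      then show "f k = 0" unfolding f_def using out by blast
    qed
    then show ?thesis using gap unfolding energy_gap_def v_def by blast
  qed
  also have "(\<Sum>k\<in>{a + int t - 1..b + int t + 1}. (jacobi v E f k)\<^sup>2) = (\<Sum>k\<in>{a - 1..b + 1}. (jacobi v' E \<psi> k)\<^sup>2)"
  proof (rule sum.reindex_bij_witness[of _ "\<lambda>k. k + int t" "\<lambda>k. k - int t"])
    fix k assume k: "k \<in> {a + int t - 1..b + int t + 1}"
    then have "k - int t \<in> {a - 1..b + 1}" by auto
    from pot[OF this] have "v k = v' (k - int t)" by simp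
    moreover have "k + 1 - int t = k - int t + 1" "k - 1 - int t = k - int t - 1" by simp_all
    ultimately show "(jacobi v' E \<psi> (k - int t))\<^sup>2 = (jacobi v E f k)\<^sup>2" unfolding jacobi_def f_def by (simp only:)
  qed auto
  also have "(\<Sum>k\<in>{a + int t..b + int t}. (f k)\<^sup>2) = (\<Sum>k\<in>{a..b}. (\<psi> k)\<^sup>2)"
    by (rule sum.reindex_bij_witness[of _ "\<lambda>k. k + int t" "\<lambda>k. k - int t"]) (auto simp: f_def)
  finally show "\<delta>\<^sup>2 * (\<Sum>k\<in>{a..b}. (\<psi> k)\<^sup>2) \<le> (\<Sum>k\<in>{a - 1..b + 1}. (jacobi (fib_potential V w') E \<psi> k)\<^sup>2)"
    by (simp add: v'_def)
qed

text \<open>Nonreal points belong to the resolvent set and real ones are decided by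
  \<open>energy_gap\<close> independently of the phase. As \<open>complex_of_real\<close> is
  injective, the definite description has exactly one candidate.\<close>

lemma fib_spectrum_eq: "fib_spectrum V = {E. \<not> (\<exists>\<delta>>0. energy_gap (fib_potential V 0) E \<delta>)}"
proof -
  define S where "S = {E. \<not> (\<exists>\<delta>>0. energy_gap (fib_potential V 0) E \<delta>)}"
  have spec: "ell2_spectrum (fib_hamiltonian V w) = complex_of_real ` S" for w
  proof (intro Set.set_eqI iffI)
    fix z assume z: "z \<in> ell2_spectrum (fib_hamiltonian V w)"
    then have "z \<notin> ell2_resolvent_set (fib_hamiltonian V w)" unfolding ell2_spectrum_def by blast
    then have "Im z = 0" using nonreal_resolvent by blast
    then have zr: "z = of_real (Re z)" by (simp add: complex_eq_iff)
    then have "of_real (Re z) \<notin> ell2_resolvent_set (fib_hamiltonian V w)" using z unfolding ell2_spectrum_def by simp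
    then have "Re z \<in> S" unfolding real_resolvent_iff S_def using energy_gap_phase_independent by blast
    then show "z \<in> complex_of_real ` S" using zr by blast
  next
    fix z assume "z \<in> complex_of_real ` S"
    then obtain E where "z = of_real E" "E \<in> S" by blast
    then show "z \<in> ell2_spectrum (fib_hamiltonian V w)"
      unfolding ell2_spectrum_def S_def using real_resolvent_iff energy_gap_phase_independent by blast
  qed
  have "fib_spectrum V = S" unfolding fib_spectrum_def
  proof (rule the_equality)
    fix S' assume "\<forall>w. ell2_spectrum (fib_hamiltonian V w) = complex_of_real ` S'"
    then have "complex_of_real ` S' = complex_of_real ` S" using spec by metis
    moreover have "inj complex_of_real" by (rule inj_of_real)
    ultimately show "S' = S" by (simp only: inj_image_eq_iff)
  qed (use spec in blast)
  then show ?thesis by (simp add: S_def)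
qed

section \<open>Gaps\<close>

lemma fib_spectrum_iff: "E \<notin> fib_spectrum V \<longleftrightarrow> (\<exists>\<delta>>0. energy_gap (fib_potential V 0) E \<delta>)"
  by (simp add: fib_spectrum_eq)

text \<open>By monotonicity the integrated density of states is constant between \<open>p\<close>
  and \<open>q\<close>; without an energy gap at \<open>E\<close> it would increase strictly across
  \<open>E\<close> by \<open>fib_ids_increases\<close>.\<close>

lemma not_in_fib_spectrum:
  assumes "p < E" "E < q" "fib_ids p V = fib_ids q V" shows "E \<notin> fib_spectrum V"
proof -
  define \<delta> where "\<delta> = min (E - p) (q - E)"
  have \<delta>: "\<delta> > 0" "p \<le> E - \<delta>" "E + \<delta> \<le> q" using assms by (auto simp: \<delta>_def)
  then have "fib_ids p V \<le> fib_ids (E - \<delta>) V" "fib_ids (E + \<delta>) V \<le> fib_ids q V"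
    by (auto intro: fib_ids_mono)
  then have "energy_gap (fib_potential V 0) E \<delta>"
    using fib_ids_increases[of V 0 E \<delta>] \<delta>(1) assms(3) by fastforce
  then show ?thesis using \<delta>(1) by (auto simp: fib_spectrum_iff)
qed

text \<open>Openness is read off the integrated density of states: an energy gap of size
  \<open>\<delta>\<close> makes it constant within \<open>\<delta>\<close> of \<open>E\<close>, and
  constancy on both sides of a point keeps that point out of the spectrum.\<close>

lemma open_fib_resolvent: "open (- fib_spectrum V)"
  unfolding open_dist
proof
  fix E assume "E \<in> - fib_spectrum V"
  then obtain \<delta> where \<delta>: "\<delta> > 0" "energy_gap (fib_potential V 0) E \<delta>" by (auto simp: fib_spectrum_iff)
  have "E' \<in> - fib_spectrum V" if "dist E' E < \<delta>" for E'
  proof -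
    define h where "h = (\<delta> - \<bar>E' - E\<bar>) / 2"
    have h: "h > 0" "\<bar>E' - h - E\<bar> < \<delta>" "\<bar>E' + h - E\<bar> < \<delta>" using that by (auto simp: h_def dist_real_def abs_if field_simps split: if_splits)
    have "fib_ids (E' - h) V = fib_ids (E' + h) V"
      by (rule fib_ids_locally_constant[OF \<delta>(2) h(2,3)]) (use h in simp)
    then show ?thesis using not_in_fib_spectrum[of "E' - h" E' "E' + h" V] h(1) by simp
  qed
  then show "\<exists>e>0. \<forall>y. dist y E < e \<longrightarrow> y \<in> - fib_spectrum V" using \<delta>(1) by blast
qed

lemma fib_ids_constant_on:
  assumes "p \<le> q" "{p..q} \<subseteq> - fib_spectrum V" shows "fib_ids p V = fib_ids q V"
proof -
  define P where "P a b \<longleftrightarrow> (a \<le> b \<longrightarrow> fib_ids a V = fib_ids b V)" for a b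
  have "P p q"
  proof (rule Bolzano[OF assms(1)])
    fix x assume "p \<le> x" "x \<le> q"
    then have "x \<notin> fib_spectrum V" using assms(2) by auto
    then obtain \<delta> where \<delta>: "\<delta> > 0" "energy_gap (fib_potential V 0) x \<delta>" unfolding fib_spectrum_iff by blast
    have "P a b" if "a \<le> x \<and> x \<le> b \<and> b - a < \<delta>" for a b
      unfolding P_def
    proof
      assume "a \<le> b"
      then show "fib_ids a V = fib_ids b V"
        by (rule fib_ids_locally_constant[OF \<delta>(2), rotated 2]) (use that in auto)
    qed
    then show "\<exists>d>0. \<forall>a b. a \<le> x \<and> x \<le> b \<and> b - a < d \<longrightarrow> P a b" using \<delta>(1) by blast
  qed (auto simp: P_def)
  then show ?thesis using assms(1) by (simp add: P_def)
qed

text \<open>Equal values at \<open>e1\<close> and \<open>e2\<close> produce the gap, a component on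
  which the integrated density of states keeps this value; the values at \<open>o1\<close> and
  \<open>o2\<close> confine it by monotonicity. This also establishes that the gap with label
  \<open>m\<close> exists.\<close>

lemma fib_gap_between:
  assumes in1: "fib_ids e1 V = frac (of_int m * fib_alpha)" and in2: "fib_ids e2 V = frac (of_int m * fib_alpha)"
    and out1: "fib_ids o1 V < frac (of_int m * fib_alpha)" and out2: "frac (of_int m * fib_alpha) < fib_ids o2 V"
    and e: "e1 < e2"
  shows "open (fib_gap m V)" "{e1<..<e2} \<subseteq> fib_gap m V" "fib_gap m V \<subseteq> {o1..o2}"
proof -
  define \<beta> where "\<beta> = frac (of_int m * fib_alpha)"
  define S where "S = - fib_spectrum V"
  define x where "x = (e1 + e2) / 2"
  define U where "U = connected_component_set S x"
  have inS: "{e1<..<e2} \<subseteq> S" using not_in_fib_spectrum[of e1 _ e2 V] in1 in2 by (auto simp: S_def)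
  have x: "x \<in> {e1<..<e2}" using e by (simp add: x_def)
  have sub: "{e1<..<e2} \<subseteq> U" unfolding U_def by (rule connected_component_maximal[OF x _ inS]) simp
  have xS: "x \<in> S" using inS x by blast
  have USub: "U \<subseteq> S" unfolding U_def by (rule connected_component_subset)
  have Ucomp: "U \<in> components S" unfolding U_def using xS by (simp add: componentsI)
  have Uint: "is_interval U" unfolding U_def is_interval_connected_1 by (rule connected_connected_component)
  have idsx: "fib_ids x V = \<beta>"
    using fib_ids_mono[of e1 x V] fib_ids_mono[of x e2 V] x in1 in2 by (simp add: \<beta>_def)
  have idsU: "fib_ids y V = \<beta>" if y: "y \<in> U" for y
  proof (cases "x \<le> y")
    case True
    have "{x..y} \<subseteq> U" using Uint y x sub unfolding is_interval_1 by (meson atLeastAtMost_iff subsetD subsetI)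
    then show ?thesis using fib_ids_constant_on[OF True] USub idsx by (auto simp: S_def)
  next
    case False
    then have le: "y \<le> x" by simp
    have "{y..x} \<subseteq> U" using Uint y x sub unfolding is_interval_1 by (meson atLeastAtMost_iff subsetD subsetI)
    then show ?thesis using fib_ids_constant_on[OF le] USub idsx by (auto simp: S_def)
  qed
  have Uout: "U \<subseteq> {o1..o2}"
  proof
    fix y assume "y \<in> U"
    then have "fib_ids y V = \<beta>" by (rule idsU)
    then show "y \<in> {o1..o2}"
      using fib_ids_mono[of y o1 V] fib_ids_mono[of o2 y V] out1 out2 unfolding \<beta>_def by fastforce
  qed
  have Ugap: "U \<in> fib_gaps V"
    unfolding fib_gaps_def using Ucomp bounded_subset[OF bounded_closed_interval Uout] by (simp add: S_def)
  have uniq: "U' = U" if U': "U' \<in> fib_gaps V" "\<forall>E\<in>U'. fib_ids E V = \<beta>" for U'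
  proof -
    have comp: "U' \<in> components S" using U'(1) by (simp add: fib_gaps_def S_def)
    then obtain y where y: "y \<in> U'" using in_components_nonempty by blast
    then have yS: "y \<in> S" using comp in_components_subset by blast
    have idsy: "fib_ids y V = \<beta>" using U'(2) y by blast
    define p q where "p = min x y" and "q = max x y"
    \<comment> \<open>A second gap with the same label would be joined to \<open>U\<close> by an
      interval on which the integrated density of states is constant, so no spectrum separates the
      two.\<close>
    have pq: "fib_ids p V = fib_ids q V" unfolding p_def q_def using idsx idsy by (simp add: min_def max_def)
    have "p \<in> S" "q \<in> S" using xS yS by (simp_all add: p_def q_def min_def max_def)
    moreover have "E \<in> S" if "p < E" "E < q" for E using not_in_fib_spectrum[OF that pq] by (simp add: S_def)
    ultimately have "{p..q} \<subseteq> S" by (metis atLeastAtMost_iff order_le_less subsetI)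
    moreover have "x \<in> {p..q}" "y \<in> {p..q}" by (auto simp: p_def q_def)
    ultimately have "y \<in> U" unfolding U_def using connected_component_maximal[of x "{p..q}" S] by auto
    then have "U \<inter> U' \<noteq> {}" using y by blast
    then show ?thesis using components_nonoverlap[OF Ucomp comp] by blast
  qed
  have gap: "fib_gap m V = U"
    unfolding fib_gap_def
  proof (rule the_equality)
    show "U \<in> fib_gaps V \<and> (\<forall>E\<in>U. fib_ids E V = frac (real_of_int m * fib_alpha))" using Ugap idsU by (simp add: \<beta>_def)
  qed (use uniq in \<open>auto simp: \<beta>_def\<close>)
  show "open (fib_gap m V)" unfolding gap by (rule open_components[OF _ Ucomp]) (simp only: S_def open_fib_resolvent)
  show "{e1<..<e2} \<subseteq> fib_gap m V" "fib_gap m V \<subseteq> {o1..o2}" unfolding gap by (rule sub, rule Uout)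
qed

text \<open>The four energies at distance \<open>c - \<epsilon>\<close> and
  \<open>c + \<epsilon>\<close> on either side of \<open>lam = fib_alpha\<close> enclose the gap
  from inside and from outside; \<open>V0\<close> serves all four at once.\<close>

lemma fib_gap_measure:
  assumes m: "m \<noteq> 0" and \<epsilon>: "0 < \<epsilon>" "\<epsilon> < norm (fib_mode m)"
  shows "\<exists>V0>0. \<forall>V. 0 < V \<and> V < V0 \<longrightarrow>
    2 * (norm (fib_mode m) - \<epsilon>) \<le> measure lborel (fib_gap m V) / V \<and> measure lborel (fib_gap m V) / V \<le> 2 * (norm (fib_mode m) + \<epsilon>)"
proof -
  define c where "c = norm (fib_mode m)"
  define E where "E lam V = 2 * cos (label_angle m) + lam * V" for lam V
  define \<beta> where "\<beta> = frac (of_int m * fib_alpha)"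
  have a: "\<bar>(fib_alpha - (c - \<epsilon>)) - fib_alpha\<bar> < norm (fib_mode m)" "\<bar>(fib_alpha + (c - \<epsilon>)) - fib_alpha\<bar> < norm (fib_mode m)"
    "- 1 * ((fib_alpha - (c + \<epsilon>)) - fib_alpha) > norm (fib_mode m)" "1 * ((fib_alpha + (c + \<epsilon>)) - fib_alpha) > norm (fib_mode m)"
    using \<epsilon> by (auto simp: c_def)
  obtain V1 where V1: "V1 > 0" "\<And>V. 0 < V \<and> V < V1 \<Longrightarrow> fib_ids (E (fib_alpha - (c - \<epsilon>)) V) V = \<beta>"
    using fib_ids_in_gap[OF m a(1)] unfolding E_def \<beta>_def by blast
  obtain V2 where V2: "V2 > 0" "\<And>V. 0 < V \<and> V < V2 \<Longrightarrow> fib_ids (E (fib_alpha + (c - \<epsilon>)) V) V = \<beta>"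
    using fib_ids_in_gap[OF m a(2)] unfolding E_def \<beta>_def by blast
  obtain V3 where V3: "V3 > 0" "\<And>V. 0 < V \<and> V < V3 \<Longrightarrow> - 1 * fib_ids (E (fib_alpha - (c + \<epsilon>)) V) V > - 1 * \<beta>"
    using fib_ids_off_gap[OF m _ a(3)] unfolding E_def \<beta>_def by blast
  obtain V4 where V4: "V4 > 0" "\<And>V. 0 < V \<and> V < V4 \<Longrightarrow> 1 * fib_ids (E (fib_alpha + (c + \<epsilon>)) V) V > 1 * \<beta>"
    using fib_ids_off_gap[OF m _ a(4)] unfolding E_def \<beta>_def by blast
  define V0 where "V0 = min (min V1 V2) (min V3 V4)"
  have "2 * (c - \<epsilon>) \<le> measure lborel (fib_gap m V) / V \<and> measure lborel (fib_gap m V) / V \<le> 2 * (c + \<epsilon>)"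
    if V: "0 < V" "V < V0" for V
  proof -
    have ids: "fib_ids (E (fib_alpha - (c - \<epsilon>)) V) V = \<beta>" "fib_ids (E (fib_alpha + (c - \<epsilon>)) V) V = \<beta>"
      "fib_ids (E (fib_alpha - (c + \<epsilon>)) V) V < \<beta>" "\<beta> < fib_ids (E (fib_alpha + (c + \<epsilon>)) V) V"
      using V1(2)[of V] V2(2)[of V] V3(2)[of V] V4(2)[of V] V by (auto simp: V0_def)
    have len: "E (fib_alpha + l) V - E (fib_alpha - l) V = 2 * l * V" for l by (simp add: E_def algebra_simps)
    have "0 < 2 * (c - \<epsilon>) * V" using V \<epsilon> by (simp add: c_def)
    then have lt: "E (fib_alpha - (c - \<epsilon>)) V < E (fib_alpha + (c - \<epsilon>)) V" using len[of "c - \<epsilon>"] by linarith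
    note gap = fib_gap_between[OF ids[unfolded \<beta>_def] lt]
    have meas: "fib_gap m V \<in> sets lborel" using gap(1) by simp
    have fm: "{E (fib_alpha - (c + \<epsilon>)) V..E (fib_alpha + (c + \<epsilon>)) V} \<in> fmeasurable lborel"
      by (intro fmeasurable_compact) simp
    have fm2: "fib_gap m V \<in> fmeasurable lborel" by (rule fmeasurableI2[OF fm gap(3) meas])
    have "measure lborel {E (fib_alpha - (c - \<epsilon>)) V<..<E (fib_alpha + (c - \<epsilon>)) V} \<le> measure lborel (fib_gap m V)"
      by (rule measure_mono_fmeasurable[OF gap(2) _ fm2]) simp
    then have lo: "2 * (c - \<epsilon>) * V \<le> measure lborel (fib_gap m V)" using lt len[of "c - \<epsilon>"] by simp
    have "measure lborel (fib_gap m V) \<le> measure lborel {E (fib_alpha - (c + \<epsilon>)) V..E (fib_alpha + (c + \<epsilon>)) V}"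
      by (rule measure_mono_fmeasurable[OF gap(3) meas fm])
    moreover have "0 < 2 * (c + \<epsilon>) * V" using V \<epsilon> by (simp add: c_def)
    ultimately have "measure lborel (fib_gap m V) \<le> 2 * (c + \<epsilon>) * V" using len[of "c + \<epsilon>"] by simp
    with lo show ?thesis using V(1) by (simp add: field_simps)
  qed
  moreover have "V0 > 0" using V1(1) V2(1) V3(1) V4(1) by (simp add: V0_def)
  ultimately show ?thesis unfolding c_def by blast
qed

theorem theorem1p6:
  "\<exists>Cstar::real. \<forall>m::int. m \<noteq> 0 \<longrightarrow>
     (\<exists>C\<in>{0<..<Cstar}.
        ((\<lambda>V::real. measure lborel (fib_gap m V) / \<bar>V\<bar>) \<longlongrightarrow> C / real_of_int \<bar>m\<bar>) (at_right 0))"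
proof (intro exI[of _ 1] allI impI)
  fix m :: int assume m: "m \<noteq> 0"
  define c where "c = norm (fib_mode m)"
  \<comment> \<open>The gap has asymptotic length \<open>2 * c * V\<close>; since
    \<open>c \<le> 1 / (pi * \<bar>real_of_int m\<bar>)\<close>, this \<open>C\<close> is at most
    \<open>2 / pi\<close>, so 1 is a common bound for all \<open>m\<close>.\<close>
  define C where "C = 2 * c * \<bar>real_of_int m\<bar>"
  have c: "0 < c" "c \<le> 1 / (pi * \<bar>real_of_int m\<bar>)" using norm_fib_mode[OF m] by (simp_all add: c_def)
  have mp: "\<bar>real_of_int m\<bar> > 0" using m by simp
  have "C \<le> 2 / pi" using c(2) mp by (simp add: C_def field_simps)
  also have "\<dots> < 1" using pi_gt3 by simp
  finally have C: "C \<in> {0<..<1}" using c(1) mp by (simp add: C_def)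
  have Cm: "C / real_of_int \<bar>m\<bar> = 2 * c" using mp by (simp add: C_def)
  have "((\<lambda>V. measure lborel (fib_gap m V) / \<bar>V\<bar>) \<longlongrightarrow> 2 * c) (at_right 0)"
  proof (rule tendstoI)
    fix e :: real assume e: "e > 0"
    \<comment> \<open>\<open>c / 2\<close> keeps the inner energies in order, and
      \<open>e / 4\<close> makes the length error \<open>2 * \<epsilon>\<close> smaller than
      \<open>e\<close>.\<close>
    define \<epsilon> where "\<epsilon> = min (e / 4) (c / 2)"
    have \<epsilon>: "0 < \<epsilon>" "\<epsilon> < norm (fib_mode m)" "2 * \<epsilon> < e" using e c(1) by (auto simp: \<epsilon>_def c_def[symmetric])
    obtain V0 where V0: "V0 > 0" "\<And>V. 0 < V \<and> V < V0 \<Longrightarrow>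
      2 * (c - \<epsilon>) \<le> measure lborel (fib_gap m V) / V \<and> measure lborel (fib_gap m V) / V \<le> 2 * (c + \<epsilon>)"
      using fib_gap_measure[OF m \<epsilon>(1,2)] unfolding c_def by blast
    show "eventually (\<lambda>V. dist (measure lborel (fib_gap m V) / \<bar>V\<bar>) (2 * c) < e) (at_right 0)"
      unfolding eventually_at_right_field
    proof (intro exI[of _ V0] conjI allI impI V0(1))
      fix V :: real assume "0 < V" "V < V0"
      then show "dist (measure lborel (fib_gap m V) / \<bar>V\<bar>) (2 * c) < e"
        using V0(2)[of V] \<epsilon>(3) by (simp add: dist_real_def abs_less_iff)
    qed
  qed
  then show "\<exists>C\<in>{0<..<1}. ((\<lambda>V::real. measure lborel (fib_gap m V) / \<bar>V\<bar>) \<longlongrightarrow> C / real_of_int \<bar>m\<bar>) (at_right 0)"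
    using C Cm by (intro bexI[of _ C]) simp_all
qed

end
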